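(* Let $f$ be a good function with $f'(x)\le\frac{1}{2(x+1)}$ for all $x \geq 0$, let $\mathcal{K}_f$ be the corresponding amalgamation class and $M_f$ its generic structure. Assume that $M_f$ is elementarily equivalent to an ultraproduct $\mathcal{M}=\prod_U F_i$ of finite $L$-structures $F_i$. Then for every $L$-formula $\Phi(\bar x)$ without parameters which is satisfiable in $M_f$, $$\Delta(\Phi(\bar x))=d(\Phi(\bar x)).$$
   Context: Let $L=\{R_i:i\le m\}$ be a finite relational language containing some 3-ary relation symbol $R$. For a finite $L$-structure $A$ the predimension is $\delta(A)=|A|-\sum_i|R_i[A]|$, where $R_i[A]$ is the set of tuples of $A$ satisfying $R_i$. For $A\subseteq B$ finite, $A\le B$ ($A$ is self-sufficient in $B$) means $\delta(A)<\delta(B')$ for all $A\subsetneq B'\subseteq B$; for arbitrary $A\subseteq N$, $A\le N$ means $A\cap X\le X$ for all finite $X\subseteq N$. An embedding $\alpha:A\to B$ with $\alpha(A)\le B$ is a $\le$-embedding. $\mathcal{K}_0$ is the class of finite $L$-structures $B$ with $\emptyset\le B$. Let $f:\mathbb{R}^{\ge0}\to\mathbb{R}$ be continuous and increasing with $f(x)\to\infty$ as $x\to\infty$, and let $\mathcal{K}_f=\{A\in\mathcal{K}_0:\delta(X)\ge f(|X|)\ \text{for all } X\subseteq A\}$. "Good" here means that $f$ is piecewise smooth and its right derivative $f'$ is non-increasing and satisfies $f'(x)\le 1/(x+1)$. Under these conditions $\mathcal{K}_f$ has the free $\le$-amalgamation property (if $A_0\le A_1,A_2\in\mathcal{K}_f$,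 then the structure on the disjoint union of $A_1,A_2$ over $A_0$ with only the relations of $A_1$ and of $A_2$ is in $\mathcal{K}_f$ and $A_1,A_2$ are self-sufficient in it). The generic structure $M_f$ is the countable $L$-structure (unique up to isomorphism) such that: (1) $M_f$ is the union of a chain of finite self-sufficient substructures, all in $\mathcal{K}_f$; (2) if $A\le M_f$ is finite and $A\le B\in\mathcal{K}_f$, there is a $\le$-embedding $\beta:B\to M_f$ which is the identity on $A$. For finite $X\subseteq M_f$, $d(X)=\min\{\delta(Y):X\subseteq Y\subseteq M_f,\ Y\text{ finite}\}$; for a tuple $\bar b$, $d(\bar b)$ is $d$ of its set of entries, and $d(\Phi(\bar x))=\max\{d(\bar b):M_f\models\Phi(\bar b)\}$. The coarse pseudofinite dimension $\Delta(\Phi(\bar x))$ is the standard part of the non-standard real $\prod_U \log|\Phi(F_i)|/\log|F_i|$, where $\Phi(F_i)$ is the solution set of $\Phi$ in $F_i$. *)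

theory Defs
  imports "HOL-Analysis.Analysis"
begin

section \<open>Relational structures\<close>

text \<open>A finite relational language is a finite type \<open>'r\<close> of relation symbols together with an
  arity function \<open>ar\<close>. A structure has an explicit universe, and relations are sets of lists.\<close>

record ('r, 'a) struc =
  univ :: "'a set"
  interp :: "'r \<Rightarrow> 'a list set"

definition structure_over :: "('r \<Rightarrow> nat) \<Rightarrow> ('r, 'a) struc \<Rightarrow> bool" where
  "structure_over ar N \<longleftrightarrow>
     (\<forall>r. \<forall>t \<in> interp N r. length t = ar r \<and> set t \<subseteq> univ N)"

definition finite_structure :: "('r \<Rightarrow> nat) \<Rightarrow> ('r, 'a) struc \<Rightarrow> bool" where
  "finite_structure ar N \<longleftrightarrow> structure_over ar N \<and> finite (univ N)"

definition induced :: "('r, 'a) struc \<Rightarrow> 'a set \<Rightarrow> ('r, 'a) struc" where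
  "induced N A = \<lparr>univ = A, interp = (\<lambda>r. {t \<in> interp N r. set t \<subseteq> A})\<rparr>"

definition embedding :: "('r, 'a) struc \<Rightarrow> ('r, 'b) struc \<Rightarrow> ('a \<Rightarrow> 'b) \<Rightarrow> bool" where
  "embedding N N' \<alpha> \<longleftrightarrow>
     inj_on \<alpha> (univ N) \<and> \<alpha> ` univ N \<subseteq> univ N' \<and>
     (\<forall>r. \<forall>t \<in> lists (univ N). t \<in> interp N r \<longleftrightarrow> map \<alpha> t \<in> interp N' r)"


section \<open>Predimension and self-sufficiency\<close>

definition predim :: "('r::finite, 'a) struc \<Rightarrow> 'a set \<Rightarrow> int" where
  "predim N X = int (card X) - (\<Sum>r\<in>UNIV. int (card {t \<in> interp N r. set t \<subseteq> X}))"

text \<open>Both relations compare subsets of an ambient structure \<open>N\<close>; the first one is meant for finite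
  \<open>A\<close> and \<open>B\<close>.\<close>

definition selfsuff_fin :: "('r::finite, 'a) struc \<Rightarrow> 'a set \<Rightarrow> 'a set \<Rightarrow> bool" where
  "selfsuff_fin N A B \<longleftrightarrow>
     A \<subseteq> B \<and> (\<forall>B'. A \<subset> B' \<and> B' \<subseteq> B \<longrightarrow> predim N A < predim N B')"

definition selfsuff :: "('r::finite, 'a) struc \<Rightarrow> 'a set \<Rightarrow> bool" where
  "selfsuff N A \<longleftrightarrow>
     A \<subseteq> univ N \<and> (\<forall>X. finite X \<and> X \<subseteq> univ N \<longrightarrow> selfsuff_fin N (A \<inter> X) X)"

definition selfsuff_embedding ::
    "('r::finite, 'a) struc \<Rightarrow> ('r, 'b) struc \<Rightarrow> ('a \<Rightarrow> 'b) \<Rightarrow> bool" where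
  "selfsuff_embedding N N' \<alpha> \<longleftrightarrow> embedding N N' \<alpha> \<and> selfsuff N' (\<alpha> ` univ N)"

lemma finite_tuples_within:
  assumes "structure_over ar N" "finite X"
  shows "finite {t \<in> interp N r. set t \<subseteq> X}"
proof (rule finite_subset)
  show "{t \<in> interp N r. set t \<subseteq> X} \<subseteq> {t. set t \<subseteq> X \<and> length t = ar r}"
    using assms(1) by (auto simp: structure_over_def)
  show "finite {t. set t \<subseteq> X \<and> length t = ar r}"
    using assms(2) by (rule finite_lists_length_eq)
qed

lemma predim_submodular:
  assumes "structure_over ar N" "finite X" "finite Y"
  shows "predim N (X \<union> Y) + predim N (X \<inter> Y) \<le> predim N X + predim N Y"
proof -
  let ?R = "\<lambda>Z r. {t \<in> interp N r. set t \<subseteq> Z}"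
  have fin: "finite (?R Z r)" if "finite Z" for Z r
    using finite_tuples_within[OF assms(1) that] .
  have "int (card (?R X r)) + int (card (?R Y r))
      \<le> int (card (?R (X \<union> Y) r)) + int (card (?R (X \<inter> Y) r))" for r
  proof -
    have "card (?R X r) + card (?R Y r) = card (?R X r \<union> ?R Y r) + card (?R X r \<inter> ?R Y r)"
      using card_Un_Int fin assms(2,3) by blast
    also have "?R X r \<inter> ?R Y r = ?R (X \<inter> Y) r" by auto
    also have "card (?R X r \<union> ?R Y r) \<le> card (?R (X \<union> Y) r)"
      by (rule card_mono) (use fin assms(2,3) in auto)
    finally show ?thesis by linarith
  qed
  then have "(\<Sum>r\<in>UNIV. int (card (?R X r)) + int (card (?R Y r)))
      \<le> (\<Sum>r\<in>UNIV. int (card (?R (X \<union> Y) r)) + int (card (?R (X \<inter> Y) r)))"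
    by (intro sum_mono) simp
  moreover have "int (card (X \<union> Y)) + int (card (X \<inter> Y)) = int (card X) + int (card Y)"
    using card_Un_Int[OF assms(2,3)] by linarith
  ultimately show ?thesis
    unfolding predim_def sum.distrib by linarith
qed

text \<open>On finite structures the two notions of self-sufficiency agree.\<close>

lemma selfsuff_iff_selfsuff_fin:
  assumes "finite_structure ar N"
  shows "selfsuff N A \<longleftrightarrow> selfsuff_fin N A (univ N)"
proof
  assume "selfsuff N A"
  then have "A \<subseteq> univ N" "selfsuff_fin N (A \<inter> univ N) (univ N)"
    using assms by (auto simp: selfsuff_def finite_structure_def)
  then show "selfsuff_fin N A (univ N)" by (simp add: Int_absorb2)
next
  assume A: "selfsuff_fin N A (univ N)"
  have str: "structure_over ar N" and fin: "finite (univ N)"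
    using assms by (auto simp: finite_structure_def)
  have sub: "A \<subseteq> univ N" using A by (simp add: selfsuff_fin_def)
  show "selfsuff N A"
    unfolding selfsuff_def
  proof (intro conjI allI impI)
    fix X assume X: "finite X \<and> X \<subseteq> univ N"
    show "selfsuff_fin N (A \<inter> X) X"
      unfolding selfsuff_fin_def
    proof (intro conjI allI impI)
      fix B' assume B': "A \<inter> X \<subset> B' \<and> B' \<subseteq> X"
      have "A \<subset> A \<union> B'" "A \<union> B' \<subseteq> univ N" using B' X sub by auto
      then have "predim N A < predim N (A \<union> B')" using A by (simp add: selfsuff_fin_def)
      moreover have "A \<inter> B' = A \<inter> X" using B' by auto
      moreover have "predim N (A \<union> B') + predim N (A \<inter> B') \<le> predim N A + predim N B'"
        using predim_submodular[OF str] finite_subset sub fin B' X by metis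
      ultimately show "predim N (A \<inter> X) < predim N B'" by simp
    qed simp
  qed (rule sub)
qed


section \<open>Control functions, amalgamation classes and generic structures\<close>

text \<open>The second argument is the right derivative of the first. Only the values on \<open>[0, \<infinity>)\<close> matter.
  There may be infinitely many break points, but only finitely many in each bounded interval.\<close>

definition good :: "(real \<Rightarrow> real) \<Rightarrow> (real \<Rightarrow> real) \<Rightarrow> bool" where
  "good f f' \<longleftrightarrow>
     continuous_on {0..} f \<and> mono_on {0..} f \<and> filterlim f at_top at_top \<and>
     (\<forall>b\<ge>0. f piecewise_C1_differentiable_on {0..b}) \<and>
     (\<forall>x\<ge>0. (f has_real_derivative f' x) (at_right x)) \<and>
     antimono_on {0..} f' \<and>
     (\<forall>x\<ge>0. f' x \<le> 1 / (x + 1))"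

definition in_K0 :: "('r::finite \<Rightarrow> nat) \<Rightarrow> ('r, 'a) struc \<Rightarrow> bool" where
  "in_K0 ar B \<longleftrightarrow> finite_structure ar B \<and> selfsuff_fin B {} (univ B)"

definition in_Kf :: "('r::finite \<Rightarrow> nat) \<Rightarrow> (real \<Rightarrow> real) \<Rightarrow> ('r, 'a) struc \<Rightarrow> bool" where
  "in_Kf ar f A \<longleftrightarrow>
     in_K0 ar A \<and> (\<forall>X \<subseteq> univ A. f (real (card X)) \<le> real_of_int (predim A X))"

text \<open>In the extension property an inclusion of \<open>A\<close> as a self-sufficient substructure of \<open>B\<close> is
  given by an embedding \<open>\<iota>\<close>, so that \<open>B\<close> may have its universe inside \<^typ>\<open>nat\<close> (every finite
  structure is isomorphic to such a \<open>B\<close>), whatever the type of elements of \<open>M\<close> is.\<close>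

definition generic :: "('r::finite \<Rightarrow> nat) \<Rightarrow> (real \<Rightarrow> real) \<Rightarrow> ('r, 'a) struc \<Rightarrow> bool" where
  "generic ar f M \<longleftrightarrow>
     structure_over ar M \<and> countable (univ M) \<and>
     (\<exists>C :: nat \<Rightarrow> 'a set.
        (\<forall>k. C k \<subseteq> C (Suc k) \<and> finite (C k) \<and> selfsuff M (C k) \<and> in_Kf ar f (induced M (C k))) \<and>
        univ M = (\<Union>k. C k)) \<and>
     (\<forall>A (B :: ('r, nat) struc) \<iota>.
        finite A \<and> selfsuff M A \<and> in_Kf ar f B \<and> selfsuff_embedding (induced M A) B \<iota> \<longrightarrow>
        (\<exists>\<beta>. selfsuff_embedding B M \<beta> \<and> (\<forall>a\<in>A. \<beta> (\<iota> a) = a)))"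


section \<open>First-order formulas\<close>

datatype 'r formula =
    Eq nat nat
  | Rel 'r "nat list"
  | Neg "'r formula"
  | Conj "'r formula" "'r formula"
  | Exi nat "'r formula"

primrec well_formed :: "('r \<Rightarrow> nat) \<Rightarrow> 'r formula \<Rightarrow> bool" where
  "well_formed ar (Eq x y) \<longleftrightarrow> True"
| "well_formed ar (Rel r xs) \<longleftrightarrow> length xs = ar r"
| "well_formed ar (Neg \<phi>) \<longleftrightarrow> well_formed ar \<phi>"
| "well_formed ar (Conj \<phi> \<psi>) \<longleftrightarrow> well_formed ar \<phi> \<and> well_formed ar \<psi>"
| "well_formed ar (Exi x \<phi>) \<longleftrightarrow> well_formed ar \<phi>"

primrec free_vars :: "'r formula \<Rightarrow> nat set" where
  "free_vars (Eq x y) = {x, y}"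
| "free_vars (Rel r xs) = set xs"
| "free_vars (Neg \<phi>) = free_vars \<phi>"
| "free_vars (Conj \<phi> \<psi>) = free_vars \<phi> \<union> free_vars \<psi>"
| "free_vars (Exi x \<phi>) = free_vars \<phi> - {x}"

primrec sat :: "('r, 'a) struc \<Rightarrow> (nat \<Rightarrow> 'a) \<Rightarrow> 'r formula \<Rightarrow> bool" where
  "sat N v (Eq x y) \<longleftrightarrow> v x = v y"
| "sat N v (Rel r xs) \<longleftrightarrow> map v xs \<in> interp N r"
| "sat N v (Neg \<phi>) \<longleftrightarrow> \<not> sat N v \<phi>"
| "sat N v (Conj \<phi> \<psi>) \<longleftrightarrow> sat N v \<phi> \<and> sat N v \<psi>"
| "sat N v (Exi x \<phi>) \<longleftrightarrow> (\<exists>a \<in> univ N. sat N (v(x := a)) \<phi>)"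

text \<open>An \<open>L\<close>-formula in the tuple of variables \<open>0, \<dots>, n - 1\<close>; the case \<open>n = 0\<close> gives the sentences.\<close>

definition formula_in :: "('r \<Rightarrow> nat) \<Rightarrow> nat \<Rightarrow> 'r formula \<Rightarrow> bool" where
  "formula_in ar n \<phi> \<longleftrightarrow> well_formed ar \<phi> \<and> free_vars \<phi> \<subseteq> {..<n}"

definition solutions :: "('r, 'a) struc \<Rightarrow> nat \<Rightarrow> 'r formula \<Rightarrow> 'a list set" where
  "solutions N n \<phi> = {bs. length bs = n \<and> set bs \<subseteq> univ N \<and> sat N (\<lambda>i. bs ! i) \<phi>}"

definition elementarily_equivalent ::
    "('r \<Rightarrow> nat) \<Rightarrow> ('r, 'a) struc \<Rightarrow> ('r, 'b) struc \<Rightarrow> bool" where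
  "elementarily_equivalent ar N N' \<longleftrightarrow>
     (\<forall>\<phi>. formula_in ar 0 \<phi> \<longrightarrow> (\<forall>v w. sat N v \<phi> \<longleftrightarrow> sat N' w \<phi>))"


section \<open>Ultraproducts\<close>

definition ultrafilter :: "'i filter \<Rightarrow> bool" where
  "ultrafilter U \<longleftrightarrow> U \<noteq> bot \<and> (\<forall>P. eventually P U \<or> eventually (\<lambda>i. \<not> P i) U)"

definition ucls :: "'i filter \<Rightarrow> ('i \<Rightarrow> 'b) set \<Rightarrow> ('i \<Rightarrow> 'b) \<Rightarrow> ('i \<Rightarrow> 'b) set" where
  "ucls U D g = {h \<in> D. \<forall>\<^sub>F i in U. h i = g i}"

definition ultraproduct :: "'i filter \<Rightarrow> ('i \<Rightarrow> ('r, 'b) struc) \<Rightarrow> ('r, ('i \<Rightarrow> 'b) set) struc" where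
  "ultraproduct U F =
     (let D = {g. \<forall>i. g i \<in> univ (F i)} in
      \<lparr>univ = ucls U D ` D,
       interp = (\<lambda>r. {map (ucls U D) gs | gs.
          set gs \<subseteq> D \<and> (\<forall>\<^sub>F i in U. map (\<lambda>g. g i) gs \<in> interp (F i) r)})\<rparr>)"


section \<open>The two dimensions\<close>

definition dim_set :: "('r::finite, 'a) struc \<Rightarrow> 'a set \<Rightarrow> int" where
  "dim_set M X = (LEAST k. \<exists>Y. X \<subseteq> Y \<and> Y \<subseteq> univ M \<and> finite Y \<and> k = predim M Y)"

definition dim_formula :: "('r::finite, 'a) struc \<Rightarrow> nat \<Rightarrow> 'r formula \<Rightarrow> int" where
  "dim_formula M n \<phi> = (GREATEST k. \<exists>bs \<in> solutions M n \<phi>. k = dim_set M (set bs))"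

text \<open>Non-standard reals are elements of the ultrapower of the reals, that is, classes modulo \<open>U\<close> of
  families of reals, and \<open>hyperreal U a\<close> is the one represented by \<open>a\<close>. The standard part is
  extended to infinite non-standard reals by the values \<open>\<infinity>\<close> and \<open>- \<infinity>\<close>, so that it is always
  defined; the lemmas below give this and the usual description of a finite standard part.\<close>

definition hyperreal :: "'i filter \<Rightarrow> ('i \<Rightarrow> real) \<Rightarrow> ('i \<Rightarrow> real) set" where
  "hyperreal U a = ucls U UNIV a"

definition standard_part :: "'i filter \<Rightarrow> ('i \<Rightarrow> real) set \<Rightarrow> ereal" where
  "standard_part U x = (THE s. \<exists>a\<in>x. ((\<lambda>i. ereal (a i)) \<longlongrightarrow> s) U)"

lemma standard_part_unique:
  assumes "U \<noteq> bot" "((\<lambda>i. ereal (a i)) \<longlongrightarrow> s) U"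
  shows "standard_part U (hyperreal U a) = s"
  unfolding standard_part_def
proof (rule the_equality)
  show "\<exists>b\<in>hyperreal U a. ((\<lambda>i. ereal (b i)) \<longlongrightarrow> s) U"
    by (rule bexI[of _ a]) (use assms(2) in \<open>auto simp: hyperreal_def ucls_def\<close>)
next
  fix s' assume "\<exists>b\<in>hyperreal U a. ((\<lambda>i. ereal (b i)) \<longlongrightarrow> s') U"
  then obtain b where b: "\<forall>\<^sub>F i in U. b i = a i" "((\<lambda>i. ereal (b i)) \<longlongrightarrow> s') U"
    by (auto simp: hyperreal_def ucls_def)
  have "((\<lambda>i. ereal (a i)) \<longlongrightarrow> s') U"
    by (rule Lim_transform_eventually[OF b(2)]) (use b(1) in \<open>auto elim: eventually_mono\<close>)
  then show "s' = s" using tendsto_unique assms by blast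
qed

lemma standard_part_tendsto:
  assumes "ultrafilter U"
  shows "((\<lambda>i. ereal (a i)) \<longlongrightarrow> standard_part U (hyperreal U a)) U"
proof -
  let ?e = "\<lambda>i. ereal (a i)"
  have U: "U \<noteq> bot" "\<And>P. eventually P U \<or> eventually (\<lambda>i. \<not> P i) U"
    using assms by (auto simp: ultrafilter_def)
  have "filtermap ?e U \<noteq> bot" using U(1) by (simp add: filtermap_bot_iff)
  then obtain s where s: "inf (nhds s) (filtermap ?e U) \<noteq> bot"
    using compact_UNIV[where 'a = ereal] unfolding compact_filter
    by (metis UNIV_I eventually_True eventually_mono)
  have "(?e \<longlongrightarrow> s) U"
  proof (rule topological_tendstoI, rule ccontr)
    fix S assume S: "open S" "s \<in> S" and "\<not> (\<forall>\<^sub>F i in U. ?e i \<in> S)"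
    then have "\<forall>\<^sub>F y in filtermap ?e U. y \<notin> S"
      using U(2) by (auto simp: eventually_filtermap)
    moreover have "\<forall>\<^sub>F y in nhds s. y \<in> S" using S by (simp add: eventually_nhds_in_open)
    ultimately have "\<forall>\<^sub>F y in inf (nhds s) (filtermap ?e U). False"
      unfolding eventually_inf by blast
    with s show False by (simp add: trivial_limit_def)
  qed
  with standard_part_unique[OF U(1) this] show ?thesis by simp
qed

lemma standard_part_eq_real_iff:
  assumes "ultrafilter U"
  shows "standard_part U (hyperreal U a) = ereal s \<longleftrightarrow>
    (\<forall>\<epsilon>>0. \<forall>\<^sub>F i in U. \<bar>a i - s\<bar> < \<epsilon>)"
proof -
  have "standard_part U (hyperreal U a) = ereal s \<longleftrightarrow> ((\<lambda>i. ereal (a i)) \<longlongrightarrow> ereal s) U"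
    using standard_part_tendsto[OF assms, of a] standard_part_unique assms
    unfolding ultrafilter_def by metis
  then show ?thesis by (simp add: tendsto_iff dist_real_def)
qed

definition coarse_dim ::
    "'i filter \<Rightarrow> ('i \<Rightarrow> ('r, 'b) struc) \<Rightarrow> nat \<Rightarrow> 'r formula \<Rightarrow> ereal" where
  "coarse_dim U F n \<phi> =
     standard_part U (hyperreal U
       (\<lambda>i. ln (real (card (solutions (F i) n \<phi>))) / ln (real (card (univ (F i))))))"

end

theory Submission
  imports Defs
begin

text \<open>Write \<open>\<delta>\<close> for the predimension, \<open>q\<close> for the size of a factor \<open>F i\<close>, \<open>S\<close> for the set of solutions of \<open>\<Phi>\<close> in it,
and \<open>k\<close> for the dimension of \<open>\<Phi>\<close>. It is to be shown that \<open>|S|\<close> has the order of magnitude \<open>q ^ k\<close>, up to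
factors that are negligible on a logarithmic scale. Each bound comes from a few sentences true in \<open>M\<close>;
these hold in \<open>U\<close>-almost all factors by the theorem of Los (\<open>sat_ultraproduct\<close>), and the rest is
counting in a single finite structure. Since \<open>f\<close> is unbounded, sets of bounded predimension
have bounded size in \<open>M\<close>, and the trace of this fact on sets of size at most \<open>2 n\<close> is first-order: almost
all factors are \<open>tame\<close>.

Upper bound. Every solution of \<open>\<Phi>\<close> lies in a set of bounded size with \<open>\<delta> \<le> k\<close>. In a tame structure
the number of \<open>m\<close>-tuples with this property is \<open>O(q ^ k)\<close> (\<open>card_low_tuples\<close>): reading the tuple from left
to right, an entry either raises the dimension, which happens at most \<open>k\<close> times, or it lies in
the bounded closure of the previous ones.

Lower bound. Choose a solution of dimension \<open>k\<close> in \<open>M\<close> and \<open>k\<close> of its coordinates that form a basis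
(\<open>dim_basis\<close>). Fix a number \<open>s\<close> of copies. For every independent tuple \<open>(a j i)\<close> with \<open>j < s\<close> and \<open>i < k\<close>
there are in \<open>M\<close> one point \<open>c\<close> and \<open>s\<close> solutions of \<open>\<Phi>\<close> such that the ternary relation \<open>R\<close> holds of \<open>a j i\<close>,
\<open>c\<close> and the \<open>i\<close>-th basis coordinate of the \<open>j\<close>-th solution (\<open>generic_hub_config\<close>). In a factor almost all of the
\<open>q ^ (s k)\<close> tuples are independent, because the dependent ones are \<open>O(q ^ (s k - 1))\<close>, and
\<open>R\<close> with the last two arguments fixed has boundedly many solutions. Hence
\<open>q ^ (s k) = O(q |S| ^ s)\<close>, that is, the exponent of \<open>|S|\<close> is asymptotically at least \<open>k - 1 / s\<close>. The single point \<open>c\<close> costs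
one factor \<open>q\<close> whatever the number of copies, so its cost disappears as \<open>s\<close> grows.

The configuration exists in \<open>M\<close> because the structure obtained by gluing a self-sufficient finite set containing
the tuple \<open>a\<close>, \<open>s\<close> disjoint copies of one containing the solution, and the hub \<open>c\<close> lies
in the class \<open>K_f\<close>, and the sets glued remain self-sufficient in it (locale \<open>glueing\<close>). Each new
relation uses its own \<open>a j i\<close> and its own basis element, so independence on either side bounds the
predimension lost; the logarithmic growth of \<open>f\<close> leaves enough room for the increase in size. Homogeneity
of \<open>M\<close> (\<open>sat_embedding\<close>) then shows that the copies of the solution are again solutions.\<close>

section \<open>Growth of the control function\<close>

text \<open>The last condition is the integrated form of \<open>f' x \<le> 1 / (2 * (x + 1))\<close>. The first one expresses that the
empty structure belongs to \<open>K_f\<close>.\<close>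

definition slow :: "(real \<Rightarrow> real) \<Rightarrow> bool" where
  "slow f \<longleftrightarrow> f 0 \<le> 0 \<and> mono_on {0..} f \<and>
     (\<forall>x y. 0 \<le> x \<longrightarrow> x \<le> y \<longrightarrow> f y \<le> f x + ln ((y + 1) / (x + 1)) / 2)"

text \<open>Off finitely many points \<open>f\<close> is differentiable, and its derivative agrees there with the right
derivative \<open>f'\<close>, so that the fundamental theorem of calculus applies to \<open>f'\<close>.\<close>

lemma good_growth:
  assumes good: "good f f'" and bd: "\<forall>x\<ge>0. f' x \<le> 1 / (2 * (x + 1))"
    and xy: "0 \<le> x" "x \<le> y"
  shows "f y \<le> f x + ln ((y + 1) / (x + 1)) / 2"
proof -
  have "f piecewise_C1_differentiable_on {0..y + 1}"
    using good xy by (auto simp: good_def)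
  then obtain S where S: "finite S" "f C1_differentiable_on ({0..y + 1} - S)"
    by (auto simp: piecewise_C1_differentiable_on_def)
  then obtain D where
    D: "\<And>z. z \<in> {0..y + 1} - S \<Longrightarrow> (f has_vector_derivative D z) (at z)"
    unfolding C1_differentiable_on_def by blast
  have "(f has_vector_derivative f' z) (at z)" if z: "z \<in> {x<..<y} - S" for z
  proof -
    have Dz: "(f has_vector_derivative D z) (at z)" using D z xy by auto
    then have "(f has_vector_derivative D z) (at z within {z<..})"
      by (rule has_vector_derivative_at_within)
    moreover have "(f has_vector_derivative f' z) (at z within {z<..})"
      using good z xy
      by (auto simp: good_def has_real_derivative_iff_has_vector_derivative)
    moreover have "at z within {z<..} \<noteq> bot"
      by simp
    ultimately have "D z = f' z"
      by (simp add: has_real_derivative_iff_has_vector_derivative[symmetric]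
          has_field_derivative_unique)
    with Dz show ?thesis by simp
  qed
  moreover have "continuous_on {x..y} f"
    using good xy by (auto simp: good_def intro: continuous_on_subset)
  ultimately have If: "(f' has_integral (f y - f x)) {x..y}"
    by (intro fundamental_theorem_of_calculus_interior_strong[OF S(1) xy(2)]) auto
  have "((\<lambda>x. ln (x + 1) / 2) has_vector_derivative 1 / (2 * (z + 1))) (at z within {x..y})"
    if z: "z \<in> {x..y}" for z
    unfolding has_real_derivative_iff_has_vector_derivative[symmetric]
    using z xy by (auto intro!: derivative_eq_intros simp: divide_simps)
  then have "((\<lambda>z. 1 / (2 * (z + 1))) has_integral (ln (y + 1) / 2 - ln (x + 1) / 2)) {x..y}"
    by (intro fundamental_theorem_of_calculus xy)
  from has_integral_le[OF If this] bd xy have "f y - f x \<le> ln (y + 1) / 2 - ln (x + 1) / 2"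
    by auto
  moreover have "ln ((y + 1) / (x + 1)) = ln (y + 1) - ln (x + 1)"
    using xy by (simp add: ln_div)
  ultimately show ?thesis by argo
qed

text \<open>Multiplying the size of a set by \<open>t\<close> costs at most \<open>ln t / 2 \<le> (t - 1) / 2\<close>; the shift by \<open>1\<close>
makes room for one extra point.\<close>

lemma slow_scale:
  assumes "slow f" "0 \<le> x" "z \<le> t * (x + 1) - 1" "x \<le> z"
  shows "f z \<le> f x + (t - 1) / 2"
proof -
  have "1 * (x + 1) \<le> t * (x + 1)" using assms(3,4) by (simp only: mult_1)
  then have t: "1 \<le> t"
    by (rule mult_right_le_imp_le) (use assms(2) in simp)
  have "f z \<le> f x + ln ((z + 1) / (x + 1)) / 2" using assms by (auto simp: slow_def)
  also have "ln ((z + 1) / (x + 1)) \<le> ln t"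
    using assms t by (intro ln_mono) (auto simp: field_simps)
  also have "ln t \<le> t - 1" using t ln_le_minus_one[of t] by auto
  finally show ?thesis by simp
qed

section \<open>The predimension\<close>

definition rels_within :: "('r, 'a) struc \<Rightarrow> 'r \<Rightarrow> 'a set \<Rightarrow> 'a list set" where
  "rels_within N r X = {t \<in> interp N r. set t \<subseteq> X}"

lemma predim_eq: "predim N X = int (card X) - (\<Sum>r\<in>UNIV. int (card (rels_within N r X)))"
  by (simp add: predim_def rels_within_def)

lemma finite_rels_within: "structure_over ar N \<Longrightarrow> finite X \<Longrightarrow> finite (rels_within N r X)"
  unfolding rels_within_def by (rule finite_tuples_within)

lemma predim_le_card: "predim N X \<le> int (card X)"
  by (simp add: predim_eq sum_nonneg)

lemma predim_empty:
  assumes "structure_over ar N" "\<forall>r. 0 < ar r"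
  shows "predim N {} = 0"
proof -
  have "rels_within N r {} = {}" for r
    using assms by (auto simp: rels_within_def structure_over_def)
       (metis list.size(3) less_irrefl)
  then show ?thesis by (simp add: predim_eq)
qed

lemma predim_Un_le:
  assumes "structure_over ar N" "finite X" "finite Y"
  shows "predim N (X \<union> Y) \<le> predim N X + int (card Y)"
proof -
  have "card (rels_within N r X) \<le> card (rels_within N r (X \<union> Y))" for r
    by (rule card_mono[OF finite_rels_within]) (use assms in \<open>auto simp: rels_within_def\<close>)
  then have "(\<Sum>r\<in>UNIV. int (card (rels_within N r X))) \<le> (\<Sum>r\<in>UNIV. int (card (rels_within N r (X \<union> Y))))"
    by (intro sum_mono) simp
  moreover have "card (X \<union> Y) \<le> card X + card Y" by (rule card_Un_le)
  ultimately show ?thesis unfolding predim_eq by linarith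
qed

lemma predim_embedding:
  assumes "embedding N N' \<alpha>" "X \<subseteq> univ N"
  shows "predim N' (\<alpha> ` X) = predim N X"
proof -
  have inj: "inj_on \<alpha> X" using assms by (auto simp: embedding_def intro: inj_on_subset)
  have "rels_within N' r (\<alpha> ` X) = map \<alpha> ` rels_within N r X" for r
  proof
    show "map \<alpha> ` rels_within N r X \<subseteq> rels_within N' r (\<alpha> ` X)"
      using assms by (fastforce simp: embedding_def rels_within_def lists_eq_set)
    show "rels_within N' r (\<alpha> ` X) \<subseteq> map \<alpha> ` rels_within N r X"
    proof
      fix t assume t: "t \<in> rels_within N' r (\<alpha> ` X)"
      then have "t \<in> map \<alpha> ` lists X" by (auto simp: rels_within_def lists_image[symmetric])
      then obtain u where u: "u \<in> lists X" "t = map \<alpha> u" by auto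
      then have "u \<in> interp N r"
        using assms t by (auto simp: embedding_def rels_within_def lists_eq_set)
      with u show "t \<in> map \<alpha> ` rels_within N r X" by (auto simp: rels_within_def)
    qed
  qed
  moreover have "inj_on (map \<alpha>) (rels_within N r X)" for r
    by (rule inj_on_mapI, rule inj_on_subset[OF inj]) (auto simp: rels_within_def)
  ultimately have "card (rels_within N' r (\<alpha> ` X)) = card (rels_within N r X)" for r
    by (simp add: card_image)
  then show ?thesis by (simp add: predim_eq card_image[OF inj])
qed

lemma univ_induced [simp]: "univ (induced N A) = A"
  by (simp add: induced_def)

lemma predim_induced:
  assumes "X \<subseteq> A"
  shows "predim (induced N A) X = predim N X"
proof -
  have "rels_within (induced N A) r X = rels_within N r X" for r
    unfolding rels_within_def induced_def using subset_trans[OF _ assms] by auto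
  then show ?thesis by (simp add: predim_eq)
qed

lemma structure_over_induced: "structure_over ar N \<Longrightarrow> structure_over ar (induced N A)"
  by (auto simp: structure_over_def induced_def)

section \<open>Building formulas\<close>

lemma sat_cong:
  "(\<And>x. x \<in> free_vars \<phi> \<Longrightarrow> v x = w x) \<Longrightarrow> sat N v \<phi> \<longleftrightarrow> sat N w \<phi>"
proof (induction \<phi> arbitrary: v w)
  case (Rel r xs)
  then have "map v xs = map w xs" by simp
  then show ?case by (simp only: sat.simps)
next
  case (Exi x \<phi>)
  have "sat N (v(x := a)) \<phi> \<longleftrightarrow> sat N (w(x := a)) \<phi>" for a
    by (rule Exi.IH) (use Exi.prems in auto)
  then show ?case by simp
next
  case (Neg \<phi>)
  from Neg.IH[of v w] Neg.prems show ?case by simp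
next
  case (Conj \<phi> \<psi>)
  from Conj.IH(1)[of v w] Conj.IH(2)[of v w] Conj.prems show ?case by simp
qed simp

definition fdisj :: "'r formula set \<Rightarrow> 'r formula" where
  "fdisj S = foldr (\<lambda>\<phi> \<psi>. Neg (Conj (Neg \<phi>) (Neg \<psi>))) (SOME xs. set xs = S)
     (Exi 0 (Neg (Eq 0 0)))"

definition fconj :: "'r formula set \<Rightarrow> 'r formula" where
  "fconj S = Neg (fdisj (Neg ` S))"

lemma fdisj_props:
  fixes S :: "'r formula set"
  assumes "finite S"
  shows sat_fdisj: "sat N v (fdisj S) \<longleftrightarrow> (\<exists>\<phi>\<in>S. sat N v \<phi>)"
    and free_vars_fdisj: "free_vars (fdisj S) = (\<Union>\<phi>\<in>S. free_vars \<phi>)"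
    and well_formed_fdisj: "well_formed ar (fdisj S) \<longleftrightarrow> (\<forall>\<phi>\<in>S. well_formed ar \<phi>)"
proof -
  define ys where "ys = (SOME xs. set xs = S)"
  have ys: "set ys = S"
    unfolding ys_def by (rule someI_ex) (use finite_list[OF assms] in blast)
  let ?d = "\<lambda>xs :: 'r formula list. foldr (\<lambda>\<phi> \<psi>. Neg (Conj (Neg \<phi>) (Neg \<psi>))) xs (Exi 0 (Neg (Eq 0 0)))"
  have d: "fdisj S = ?d ys" by (simp add: fdisj_def ys_def)
  have "sat N v (?d xs) \<longleftrightarrow> (\<exists>\<phi>\<in>set xs. sat N v \<phi>)" for xs by (induction xs) auto
  then show "sat N v (fdisj S) \<longleftrightarrow> (\<exists>\<phi>\<in>S. sat N v \<phi>)" by (simp add: d ys)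
  have "free_vars (?d xs) = (\<Union>\<phi>\<in>set xs. free_vars \<phi>)" for xs by (induction xs) auto
  then show "free_vars (fdisj S) = (\<Union>\<phi>\<in>S. free_vars \<phi>)" by (simp add: d ys)
  have "well_formed ar (?d xs) \<longleftrightarrow> (\<forall>\<phi>\<in>set xs. well_formed ar \<phi>)" for xs by (induction xs) auto
  then show "well_formed ar (fdisj S) \<longleftrightarrow> (\<forall>\<phi>\<in>S. well_formed ar \<phi>)" by (simp add: d ys)
qed

lemma fconj_props:
  assumes "finite S"
  shows sat_fconj: "sat N v (fconj S) \<longleftrightarrow> (\<forall>\<phi>\<in>S. sat N v \<phi>)"
    and free_vars_fconj: "free_vars (fconj S) = (\<Union>\<phi>\<in>S. free_vars \<phi>)"
    and well_formed_fconj: "well_formed ar (fconj S) \<longleftrightarrow> (\<forall>\<phi>\<in>S. well_formed ar \<phi>)"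
  using assms
  by (auto simp: fconj_def sat_fdisj free_vars_fdisj well_formed_fdisj)

definition exs :: "nat list \<Rightarrow> 'r formula \<Rightarrow> 'r formula" where
  "exs xs \<phi> = foldr Exi xs \<phi>"

lemma free_vars_exs [simp]: "free_vars (exs xs \<phi>) = free_vars \<phi> - set xs"
  by (induction xs) (auto simp: exs_def)

lemma well_formed_exs [simp]: "well_formed ar (exs xs \<phi>) \<longleftrightarrow> well_formed ar \<phi>"
  by (induction xs) (auto simp: exs_def)

text \<open>Blocks of quantifiers are treated at once, through the valuations that they allow to change.\<close>

lemma sat_exs:
  "sat N v (exs xs \<phi>) \<longleftrightarrow>
     (\<exists>w. (\<forall>x\<in>set xs. w x \<in> univ N) \<and> (\<forall>x. x \<notin> set xs \<longrightarrow> w x = v x) \<and> sat N w \<phi>)"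
proof (induction xs arbitrary: v)
  case Nil
  have "w = v" if "\<forall>x. w x = v x" for w using that by auto
  then show ?case by (auto simp: exs_def)
next
  case (Cons x xs)
  have "sat N v (exs (x # xs) \<phi>) \<longleftrightarrow> (\<exists>a\<in>univ N. sat N (v(x := a)) (exs xs \<phi>))"
    by (simp add: exs_def)
  also have "\<dots> \<longleftrightarrow> (\<exists>w. (\<forall>y\<in>set (x # xs). w y \<in> univ N) \<and>
      (\<forall>y. y \<notin> set (x # xs) \<longrightarrow> w y = v y) \<and> sat N w \<phi>)" (is "?l \<longleftrightarrow> ?r")
  proof
    assume ?l
    then obtain a w where a: "a \<in> univ N" "\<forall>y\<in>set xs. w y \<in> univ N"
        "\<forall>y. y \<notin> set xs \<longrightarrow> w y = (v(x := a)) y" "sat N w \<phi>"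
      unfolding Cons.IH by blast
    have "w x \<in> univ N" using a by (cases "x \<in> set xs") auto
    with a show ?r by (intro exI[of _ w]) auto
  next
    assume ?r
    then obtain w where w: "\<forall>y\<in>set (x # xs). w y \<in> univ N"
      "\<forall>y. y \<notin> set (x # xs) \<longrightarrow> w y = v y" "sat N w \<phi>" by blast
    have "sat N (v(x := w x)) (exs xs \<phi>)"
      unfolding Cons.IH by (rule exI[of _ w]) (use w in auto)
    with w show ?l by auto
  qed
  finally show ?case .
qed

text \<open>The formula \<open>low_fm ar V0 V l k\<close> says that some set \<open>Y\<close> between the values of the variables in
  \<open>V0\<close> and those in \<open>V\<close> has at least \<open>l\<close> elements and predimension at most \<open>k\<close>. It suffices to guess an
  index set \<open>J\<close> naming the elements of \<open>Y\<close> without repetition and a set \<open>T\<close> of atomic formulas that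
  hold: missing some of the relations on \<open>Y\<close> only makes the value bigger, so that the existence of
  a good guess is equivalent to the existence of \<open>Y\<close>.\<close>

definition tuples :: "('r \<Rightarrow> nat) \<Rightarrow> nat set \<Rightarrow> ('r \<times> nat list) set" where
  "tuples ar J = {(r, xs). set xs \<subseteq> J \<and> length xs = ar r}"

definition guesses :: "('r \<Rightarrow> nat) \<Rightarrow> nat set \<Rightarrow> nat \<Rightarrow> int \<Rightarrow> (nat set \<times> ('r \<times> nat list) set) set" where
  "guesses ar V l k =
     {(J, T). J \<subseteq> V \<and> T \<subseteq> tuples ar J \<and> l \<le> card J \<and> int (card J) - int (card T) \<le> k}"

definition guess_fm :: "nat set \<Rightarrow> nat set \<times> ('r \<times> nat list) set \<Rightarrow> 'r formula" where
  "guess_fm V0 = (\<lambda>(J, T). fconj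
     ((\<lambda>(i, j). Neg (Eq i j)) ` {(i, j). i \<in> J \<and> j \<in> J \<and> i \<noteq> j} \<union> (\<lambda>(r, xs). Rel r xs) ` T \<union>
      (\<lambda>i. fdisj (Eq i ` J)) ` V0))"

definition low_fm :: "('r \<Rightarrow> nat) \<Rightarrow> nat set \<Rightarrow> nat set \<Rightarrow> nat \<Rightarrow> int \<Rightarrow> 'r formula" where
  "low_fm ar V0 V l k = fdisj (guess_fm V0 ` guesses ar V l k)"

lemma finite_tuples:
  fixes ar :: "'r::finite \<Rightarrow> nat"
  assumes "finite J"
  shows "finite (tuples ar J)"
proof -
  have "tuples ar J = (\<Union>r. Pair r ` {xs. set xs \<subseteq> J \<and> length xs = ar r})"
    by (auto simp: tuples_def)
  then show ?thesis using assms by (auto intro: finite_lists_length_eq)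
qed

lemma finite_guesses:
  fixes ar :: "'r::finite \<Rightarrow> nat"
  assumes "finite V"
  shows "finite (guesses ar V l k)"
proof (rule finite_subset)
  have "tuples ar J \<subseteq> tuples ar V" if "J \<subseteq> V" for J using that by (auto simp: tuples_def)
  then show "guesses ar V l k \<subseteq> Pow V \<times> Pow (tuples ar V)"
    unfolding guesses_def by blast
  show "finite (Pow V \<times> Pow (tuples ar V))" using assms finite_tuples by blast
qed

lemma guess_fm_props:
  fixes ar :: "'r::finite \<Rightarrow> nat"
  assumes fin: "finite V" "finite V0" and JT: "(J, T) \<in> guesses ar V l k"
  shows sat_guess_fm: "sat N v (guess_fm V0 (J, T)) \<longleftrightarrow>
      inj_on v J \<and> (\<forall>(r, xs)\<in>T. map v xs \<in> interp N r) \<and> v ` V0 \<subseteq> v ` J"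
    and free_vars_guess_fm: "free_vars (guess_fm V0 (J, T)) \<subseteq> V \<union> V0"
    and well_formed_guess_fm: "well_formed ar (guess_fm V0 (J, T))"
proof -
  have J: "finite J" "J \<subseteq> V" and T: "T \<subseteq> tuples ar J"
    using JT fin finite_subset by (auto simp: guesses_def)
  have T': "finite T" using finite_subset[OF T finite_tuples[OF J(1)]] .
  have "finite {(i, j). i \<in> J \<and> j \<in> J \<and> i \<noteq> j}"
    by (rule finite_subset[of _ "J \<times> J"]) (use J in auto)
  then have f: "finite ((\<lambda>(i, j). Neg (Eq i j)) ` {(i, j). i \<in> J \<and> j \<in> J \<and> i \<noteq> j} \<union>
      (\<lambda>(r, xs). Rel r xs) ` T \<union> (\<lambda>i. fdisj (Eq i ` J)) ` V0)"
    using fin T' by simp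
  show "sat N v (guess_fm V0 (J, T)) \<longleftrightarrow>
      inj_on v J \<and> (\<forall>(r, xs)\<in>T. map v xs \<in> interp N r) \<and> v ` V0 \<subseteq> v ` J"
  proof -
    have "(\<forall>\<phi>\<in>(\<lambda>(i, j). Neg (Eq i j)) ` {(i, j). i \<in> J \<and> j \<in> J \<and> i \<noteq> j}. sat N v \<phi>) \<longleftrightarrow> inj_on v J"
      by (auto simp: inj_on_def)
    moreover have "(\<forall>\<phi>\<in>(\<lambda>(r, xs). Rel r xs) ` T. sat N v \<phi>) \<longleftrightarrow> (\<forall>(r, xs)\<in>T. map v xs \<in> interp N r)"
      by auto
    moreover have "(\<forall>\<phi>\<in>(\<lambda>i. fdisj (Eq i ` J)) ` V0. sat N v \<phi>) \<longleftrightarrow> v ` V0 \<subseteq> v ` J"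
      using J(1) by (auto simp: sat_fdisj image_subset_iff)
    ultimately show ?thesis
      unfolding guess_fm_def prod.case sat_fconj[OF f] ball_Un by blast
  qed
  show "free_vars (guess_fm V0 (J, T)) \<subseteq> V \<union> V0"
    unfolding guess_fm_def prod.case free_vars_fconj[OF f]
  proof (rule UN_least, elim UnE imageE)
    fix \<phi> x assume "\<phi> = (case x of (i, j) \<Rightarrow> Neg (Eq i j))" "x \<in> {(i, j). i \<in> J \<and> j \<in> J \<and> i \<noteq> j}"
    then show "free_vars \<phi> \<subseteq> V \<union> V0" using J(2) by auto
  next
    fix \<phi> x assume "\<phi> = (case x of (r, xs) \<Rightarrow> Rel r xs)" "x \<in> T"
    then show "free_vars \<phi> \<subseteq> V \<union> V0" using J(2) T by (cases x) (auto simp: tuples_def)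
  next
    fix \<phi> i assume "\<phi> = fdisj (Eq i ` J)" "i \<in> V0"
    then show "free_vars \<phi> \<subseteq> V \<union> V0" using J by (auto simp: free_vars_fdisj)
  qed
  show "well_formed ar (guess_fm V0 (J, T))"
    unfolding guess_fm_def prod.case well_formed_fconj[OF f]
    using J T by (auto simp: well_formed_fdisj tuples_def)
qed

lemma low_fm_props:
  fixes ar :: "'r::finite \<Rightarrow> nat"
  assumes "finite V" "V0 \<subseteq> V"
  shows free_vars_low_fm: "free_vars (low_fm ar V0 V l k) \<subseteq> V"
    and well_formed_low_fm: "well_formed ar (low_fm ar V0 V l k)"
proof -
  have f: "finite (guess_fm V0 ` guesses ar V l k)" using finite_guesses assms by blast
  have V0: "finite V0" using assms finite_subset by blast
  show "free_vars (low_fm ar V0 V l k) \<subseteq> V"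
    unfolding low_fm_def free_vars_fdisj[OF f]
    using free_vars_guess_fm[OF assms(1) V0, of _ _ ar l k] Un_absorb2[OF assms(2)] by auto
  show "well_formed ar (low_fm ar V0 V l k)"
    unfolding low_fm_def well_formed_fdisj[OF f]
    using well_formed_guess_fm[OF assms(1) V0, of _ _ ar l k] by auto
qed

lemma sat_low_fm:
  fixes ar :: "'r::finite \<Rightarrow> nat"
  assumes N: "structure_over ar N" and V: "finite V" "V0 \<subseteq> V"
  shows "sat N v (low_fm ar V0 V l k) \<longleftrightarrow>
    (\<exists>Y. v ` V0 \<subseteq> Y \<and> Y \<subseteq> v ` V \<and> l \<le> card Y \<and> predim N Y \<le> k)" (is "?l \<longleftrightarrow> ?r")
proof -
  have f: "finite (guess_fm V0 ` guesses ar V l k)" using finite_guesses V by blast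
  have V0: "finite V0" using V finite_subset by blast
  have rels: "(\<Sum>r\<in>UNIV. card (rels_within N r X)) = card (SIGMA r:UNIV. rels_within N r X)"
    if "finite X" for X
    using finite_rels_within[OF N that] by (simp add: card_SigmaI)
  have "?l \<longleftrightarrow> (\<exists>(J, T) \<in> guesses ar V l k. inj_on v J \<and>
      (\<forall>(r, xs)\<in>T. map v xs \<in> interp N r) \<and> v ` V0 \<subseteq> v ` J)"
    unfolding low_fm_def sat_fdisj[OF f] bex_simps
    by (intro bex_cong refl) (auto simp: sat_guess_fm[OF V(1) V0] image_subset_iff)
  also have "\<dots> \<longleftrightarrow> ?r"
  proof
    assume "\<exists>(J, T) \<in> guesses ar V l k. inj_on v J \<and>
      (\<forall>(r, xs)\<in>T. map v xs \<in> interp N r) \<and> v ` V0 \<subseteq> v ` J"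
    then obtain J T where J: "J \<subseteq> V" "l \<le> card J" "int (card J) - int (card T) \<le> k" "inj_on v J"
        "v ` V0 \<subseteq> v ` J"
      and T: "T \<subseteq> tuples ar J" "\<forall>(r, xs)\<in>T. map v xs \<in> interp N r"
      unfolding guesses_def by blast
    let ?h = "\<lambda>(r, xs). (r, map v xs)"
    have finJ: "finite J" using J(1) V(1) finite_subset by blast
    have "inj_on ?h T"
    proof (rule inj_onI, clarsimp)
      fix r xs ys assume "(r, xs) \<in> T" "(r, ys) \<in> T" and eq: "map v xs = map v ys"
      then have "set xs \<subseteq> J" "set ys \<subseteq> J" using T(1) by (auto simp: tuples_def)
      then have "inj_on v (set xs \<union> set ys)" by (intro inj_on_subset[OF J(4)]) simp
      then show "xs = ys" using eq by (simp add: inj_on_map_eq_map)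
    qed
    then have "card T = card (?h ` T)" by (rule card_image[symmetric])
    also have "\<dots> \<le> card (SIGMA r:UNIV. rels_within N r (v ` J))"
    proof (rule card_mono)
      show "finite (SIGMA r:UNIV. rels_within N r (v ` J))"
        using finite_rels_within[OF N] finJ by (intro finite_SigmaI) auto
      show "?h ` T \<subseteq> (SIGMA r:UNIV. rels_within N r (v ` J))"
        using T by (fastforce simp: rels_within_def tuples_def)
    qed
    finally have "predim N (v ` J) \<le> k"
      using J(3) rels[of "v ` J"] finJ
      by (simp add: predim_eq card_image[OF J(4)] flip: of_nat_sum)
    then show ?r using J by (intro exI[of _ "v ` J"]) (auto simp: card_image)
  next
    assume ?r
    then obtain Y where Y: "v ` V0 \<subseteq> Y" "Y \<subseteq> v ` V" "l \<le> card Y" "predim N Y \<le> k" by blast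
    obtain J where J: "J \<subseteq> V" "inj_on v J" "Y = v ` J"
      using Y(2) by (meson subset_image_inj)
    define u where "u = inv_into J v"
    have u: "u y \<in> J" "v (u y) = y" if "y \<in> Y" for y
      using that J by (auto simp: u_def inv_into_into f_inv_into_f)
    have finY: "finite Y" using Y(2) V(1) finite_surj by blast
    define T where "T = (\<lambda>(r, t). (r, map u t)) ` (SIGMA r:UNIV. rels_within N r Y)"
    have vu: "map v (map u t) = t" if "set t \<subseteq> Y" for t
      using that u(2) by (auto simp: map_idI subset_iff)
    have "inj_on (\<lambda>(r, t). (r, map u t)) (SIGMA r:UNIV. rels_within N r Y)"
    proof (rule inj_onI, clarsimp simp: rels_within_def)
      fix t s assume "set t \<subseteq> Y" "set s \<subseteq> Y" "map u t = map u s"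
      then show "t = s" using vu by metis
    qed
    then have "card T = (\<Sum>r\<in>UNIV. card (rels_within N r Y))"
      unfolding rels[OF finY] T_def by (rule card_image)
    then have "int (card J) - int (card T) \<le> k"
      using Y(4) card_image[OF J(2)] by (simp add: predim_eq J(3))
    moreover have "T \<subseteq> tuples ar J"
      using N u(1) by (fastforce simp: T_def tuples_def rels_within_def structure_over_def)
    moreover have "l \<le> card J" using Y(3) J by (simp add: card_image)
    ultimately have "(J, T) \<in> guesses ar V l k" using J(1) by (simp add: guesses_def)
    moreover have "\<forall>(r, xs)\<in>T. map v xs \<in> interp N r"
    proof (clarify)
      fix r xs assume "(r, xs) \<in> T"
      then obtain t where "xs = map u t" "t \<in> rels_within N r Y" by (auto simp: T_def)
      then show "map v xs \<in> interp N r" using vu[of t] by (simp add: rels_within_def)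
    qed
    ultimately show "\<exists>(J, T) \<in> guesses ar V l k. inj_on v J \<and>
      (\<forall>(r, xs)\<in>T. map v xs \<in> interp N r) \<and> v ` V0 \<subseteq> v ` J"
      using J Y(1) by blast
  qed
  finally show ?thesis .
qed

section \<open>Transfer to the factors of the ultraproduct\<close>

text \<open>The theorem of Los. In the step for the quantifier a witness is chosen in every factor that has one.\<close>

theorem sat_ultraproduct:
  assumes U: "ultrafilter U" and g: "\<And>x i. g x i \<in> univ (F i)"
  shows "sat (ultraproduct U F) (\<lambda>x. ucls U {h. \<forall>i. h i \<in> univ (F i)} (g x)) \<phi> \<longleftrightarrow>
    (\<forall>\<^sub>F i in U. sat (F i) (\<lambda>x. g x i) \<phi>)"
  using g
proof (induction \<phi> arbitrary: g)
  let ?D = "{h. \<forall>i. h i \<in> univ (F i)}"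
  have ucls_eq: "ucls U ?D h = ucls U ?D h' \<longleftrightarrow> (\<forall>\<^sub>F i in U. h i = h' i)"
    if "h \<in> ?D" "h' \<in> ?D" for h h'
  proof
    assume "ucls U ?D h = ucls U ?D h'"
    moreover have "h \<in> ucls U ?D h" using that by (simp add: ucls_def)
    ultimately show "\<forall>\<^sub>F i in U. h i = h' i" by (auto simp: ucls_def)
  next
    assume "\<forall>\<^sub>F i in U. h i = h' i"
    then show "ucls U ?D h = ucls U ?D h'"
      by (auto simp: ucls_def elim: eventually_elim2)
  qed
  have univ_up: "univ (ultraproduct U F) = ucls U ?D ` ?D"
    by (simp add: ultraproduct_def Let_def)
  have interp_up: "interp (ultraproduct U F) r = {map (ucls U ?D) gs | gs.
      set gs \<subseteq> ?D \<and> (\<forall>\<^sub>F i in U. map (\<lambda>g. g i) gs \<in> interp (F i) r)}" for r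
    by (simp add: ultraproduct_def Let_def)
  {
    case (Eq x y)
    then show ?case by (simp add: ucls_eq)
  next
    case (Rel r xs)
    show ?case
    proof
      assume "sat (ultraproduct U F) (\<lambda>x. ucls U ?D (g x)) (Rel r xs)"
      then have "map (\<lambda>x. ucls U ?D (g x)) xs \<in> interp (ultraproduct U F) r" by simp
      then obtain gs where gs: "map (\<lambda>x. ucls U ?D (g x)) xs = map (ucls U ?D) gs" "set gs \<subseteq> ?D"
          "\<forall>\<^sub>F i in U. map (\<lambda>g. g i) gs \<in> interp (F i) r"
        unfolding interp_up by blast
      have len: "length gs = length xs" using arg_cong[OF gs(1), of length] by simp
      have "\<forall>\<^sub>F i in U. g (xs ! j) i = (gs ! j) i" if "j < length xs" for j
      proof -
        have "ucls U ?D (g (xs ! j)) = ucls U ?D (gs ! j)"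
          using arg_cong[OF gs(1), of "\<lambda>ys. ys ! j"] that len by simp
        moreover have "gs ! j \<in> ?D" using that len gs(2) nth_mem by (metis subsetD)
        moreover have "g (xs ! j) \<in> ?D" using Rel.prems by blast
        ultimately show ?thesis using ucls_eq by blast
      qed
      then have "\<forall>\<^sub>F i in U. \<forall>j\<in>{..<length xs}. g (xs ! j) i = (gs ! j) i"
        by (subst eventually_ball_finite_distrib) auto
      with gs(3) show "\<forall>\<^sub>F i in U. sat (F i) (\<lambda>x. g x i) (Rel r xs)"
      proof eventually_elim
        case (elim i)
        have "map (\<lambda>x. g x i) xs = map (\<lambda>g. g i) gs"
          using elim len by (auto intro: nth_equalityI)
        then show ?case using elim by (simp only: sat.simps)
      qed
    next
      assume "\<forall>\<^sub>F i in U. sat (F i) (\<lambda>x. g x i) (Rel r xs)"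
      then have "\<forall>\<^sub>F i in U. map (\<lambda>g. g i) (map g xs) \<in> interp (F i) r"
        by (simp add: comp_def)
      moreover have "set (map g xs) \<subseteq> ?D" using Rel.prems by auto
      ultimately have "map (ucls U ?D) (map g xs) \<in> interp (ultraproduct U F) r"
        unfolding interp_up by blast
      then show "sat (ultraproduct U F) (\<lambda>x. ucls U ?D (g x)) (Rel r xs)"
        by (simp add: comp_def)
    qed
  next
    case (Neg \<phi>)
    have "(\<not> (\<forall>\<^sub>F i in U. P i)) \<longleftrightarrow> (\<forall>\<^sub>F i in U. \<not> P i)" for P
    proof
      assume "\<forall>\<^sub>F i in U. \<not> P i"
      then show "\<not> (\<forall>\<^sub>F i in U. P i)"
        using U eventually_happens[of "\<lambda>_. False" U] eventually_conj[of P U "\<lambda>i. \<not> P i"]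
        by (auto simp: ultrafilter_def)
    qed (use U in \<open>auto simp: ultrafilter_def\<close>)
    then show ?case using Neg by simp
  next
    case (Conj \<phi> \<psi>)
    then show ?case by (simp add: eventually_conj_iff)
  next
    case (Exi x \<phi>)
    have upd: "(\<lambda>y. ucls U ?D ((g(x := h)) y)) = (\<lambda>y. ucls U ?D (g y))(x := ucls U ?D h)" for h
      by (simp add: fun_eq_iff)
    have upd': "(\<lambda>y. (g(x := h)) y i) = (\<lambda>y. g y i)(x := h i)" for h i
      by (simp add: fun_eq_iff)
    have "sat (ultraproduct U F) (\<lambda>y. ucls U ?D (g y)) (Exi x \<phi>) \<longleftrightarrow>
        (\<exists>h\<in>?D. sat (ultraproduct U F) (\<lambda>y. ucls U ?D ((g(x := h)) y)) \<phi>)"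
      unfolding upd sat.simps univ_up by blast
    also have "\<dots> \<longleftrightarrow> (\<exists>h\<in>?D. \<forall>\<^sub>F i in U. sat (F i) ((\<lambda>y. g y i)(x := h i)) \<phi>)"
    proof (rule bex_cong[OF refl])
      fix h assume "h \<in> ?D"
      then show "sat (ultraproduct U F) (\<lambda>y. ucls U ?D ((g(x := h)) y)) \<phi> \<longleftrightarrow>
          (\<forall>\<^sub>F i in U. sat (F i) ((\<lambda>y. g y i)(x := h i)) \<phi>)"
        using Exi.IH[of "g(x := h)"] Exi.prems unfolding upd' by auto
    qed
    also have "\<dots> \<longleftrightarrow> (\<forall>\<^sub>F i in U. sat (F i) (\<lambda>y. g y i) (Exi x \<phi>))"
    proof
      assume "\<exists>h\<in>?D. \<forall>\<^sub>F i in U. sat (F i) ((\<lambda>y. g y i)(x := h i)) \<phi>"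
      then show "\<forall>\<^sub>F i in U. sat (F i) (\<lambda>y. g y i) (Exi x \<phi>)"
        by (auto elim!: eventually_mono)
    next
      assume ev: "\<forall>\<^sub>F i in U. sat (F i) (\<lambda>y. g y i) (Exi x \<phi>)"
      \<comment> \<open>where no witness exists, \<open>g x i\<close> keeps \<open>h\<close> inside the universe\<close>
      define h where "h i = (if sat (F i) (\<lambda>y. g y i) (Exi x \<phi>)
        then SOME a. a \<in> univ (F i) \<and> sat (F i) ((\<lambda>y. g y i)(x := a)) \<phi> else g x i)" for i
      have h: "h i \<in> univ (F i) \<and> (sat (F i) (\<lambda>y. g y i) (Exi x \<phi>) \<longrightarrow>
          sat (F i) ((\<lambda>y. g y i)(x := h i)) \<phi>)" for i
      proof (cases "sat (F i) (\<lambda>y. g y i) (Exi x \<phi>)")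
        case True
        then have "\<exists>a. a \<in> univ (F i) \<and> sat (F i) ((\<lambda>y. g y i)(x := a)) \<phi>" by auto
        from someI_ex[OF this] show ?thesis using True by (simp only: h_def if_True) simp
      next
        case False
        then show ?thesis using Exi.prems by (simp only: h_def if_False) simp
      qed
      have "\<forall>\<^sub>F i in U. sat (F i) ((\<lambda>y. g y i)(x := h i)) \<phi>"
        using ev by eventually_elim (use h in blast)
      with h show "\<exists>h\<in>?D. \<forall>\<^sub>F i in U. sat (F i) ((\<lambda>y. g y i)(x := h i)) \<phi>" by blast
    qed
    finally show ?case .
  }
qed

text \<open>The universe of the ultraproduct consists of classes of families that choose a point in every
factor, so it would be empty if a single factor were. Comparing with the nonempty \<open>M\<close> excludes this.\<close>

lemma transfer:
  assumes U: "ultrafilter U" and ee: "elementarily_equivalent ar M (ultraproduct U F)"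
    and ne: "univ M \<noteq> {}"
  shows transfer_nonempty: "univ (F i) \<noteq> {}"
    and transfer_sentence: "formula_in ar 0 \<phi> \<Longrightarrow> sat M v \<phi> \<Longrightarrow> \<forall>\<^sub>F i in U. \<forall>v. sat (F i) v \<phi>"
proof -
  have iff: "sat M v \<phi> \<longleftrightarrow> sat (ultraproduct U F) w \<phi>" if "formula_in ar 0 \<phi>" for \<phi> v w
    by (rule ee[unfolded elementarily_equivalent_def, rule_format, OF that])
  have "formula_in ar 0 (Exi 0 (Eq 0 0))" by (simp add: formula_in_def)
  moreover have "sat M v (Exi 0 (Eq 0 0))" for v using ne by auto
  ultimately have "sat (ultraproduct U F) w (Exi 0 (Eq 0 0))" for w
    using iff[of "Exi 0 (Eq 0 0)"] by blast
  then have "univ (ultraproduct U F) \<noteq> {}" by auto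
  then have "{h. \<forall>i. h i \<in> univ (F i)} \<noteq> {}"
    by (simp add: ultraproduct_def Let_def)
  then obtain g where g: "\<And>i. g i \<in> univ (F i)" by auto
  then show "univ (F i) \<noteq> {}" by blast
  assume \<phi>: "formula_in ar 0 \<phi>" "sat M v \<phi>"
  have ev: "\<forall>\<^sub>F i in U. sat (F i) (\<lambda>x. g i) \<phi>"
    unfolding sat_ultraproduct[OF U, of "\<lambda>x. g" F \<phi>, OF g, symmetric]
    by (rule iff[OF \<phi>(1), THEN iffD1, OF \<phi>(2)])
  have all: "sat (F i) w \<phi>" if "sat (F i) v \<phi>" for i v w
  proof -
    have "sat (F i) v \<phi> \<longleftrightarrow> sat (F i) w \<phi>"
      by (rule sat_cong) (use \<phi>(1) in \<open>simp add: formula_in_def\<close>)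
    with that show ?thesis by simp
  qed
  show "\<forall>\<^sub>F i in U. \<forall>v. sat (F i) v \<phi>"
    by (rule eventually_mono[OF ev]) (use all in blast)
qed

section \<open>Self-sufficient sets and embeddings\<close>

text \<open>It is enough to compare \<open>X\<close> itself with its trace on \<open>A\<close>, since an intermediate set is such an \<open>X\<close>.\<close>

lemma selfsuff_iff:
  "selfsuff N A \<longleftrightarrow> A \<subseteq> univ N \<and>
     (\<forall>X. finite X \<and> X \<subseteq> univ N \<and> \<not> X \<subseteq> A \<longrightarrow> predim N (A \<inter> X) < predim N X)" (is "?l \<longleftrightarrow> ?r")
proof
  assume l: ?l
  show ?r
  proof (intro conjI allI impI)
    show "A \<subseteq> univ N" using l by (simp add: selfsuff_def)
    fix X assume X: "finite X \<and> X \<subseteq> univ N \<and> \<not> X \<subseteq> A"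
    then have "selfsuff_fin N (A \<inter> X) X" using l by (simp add: selfsuff_def)
    moreover have "A \<inter> X \<subset> X" using X by blast
    ultimately show "predim N (A \<inter> X) < predim N X" by (simp add: selfsuff_fin_def)
  qed
next
  assume r: ?r
  show ?l
    unfolding selfsuff_def selfsuff_fin_def
  proof (intro conjI allI impI)
    show "A \<subseteq> univ N" using r by blast
    fix X B' assume X: "finite X \<and> X \<subseteq> univ N" and B': "A \<inter> X \<subset> B' \<and> B' \<subseteq> X"
    have "finite B'" using X B' finite_subset by blast
    moreover have "B' \<subseteq> univ N" "\<not> B' \<subseteq> A" "A \<inter> B' = A \<inter> X" using X B' by auto
    ultimately show "predim N (A \<inter> X) < predim N B'" using r by metis
  qed simp
qed

lemma selfsuffD:
  assumes "selfsuff N A" "finite X" "X \<subseteq> univ N"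
  shows selfsuff_less: "\<not> X \<subseteq> A \<Longrightarrow> predim N (A \<inter> X) < predim N X"
    and selfsuff_le: "predim N (A \<inter> X) \<le> predim N X"
proof -
  show *: "predim N (A \<inter> X) < predim N X" if "\<not> X \<subseteq> A"
    using assms that by (simp add: selfsuff_iff)
  show "predim N (A \<inter> X) \<le> predim N X"
    using * by (cases "X \<subseteq> A") (auto simp: Int_absorb1)
qed

lemma selfsuff_induced:
  assumes "selfsuff N A" "A \<subseteq> C" "C \<subseteq> univ N"
  shows "selfsuff (induced N C) A"
  unfolding selfsuff_iff
proof (intro conjI allI impI)
  show "A \<subseteq> univ (induced N C)" using assms by simp
  fix X assume X: "finite X \<and> X \<subseteq> univ (induced N C) \<and> \<not> X \<subseteq> A"
  then have "predim N (A \<inter> X) < predim N X" using assms by (intro selfsuff_less) auto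
  moreover have "predim (induced N C) (A \<inter> X) = predim N (A \<inter> X)"
    using assms by (intro predim_induced) auto
  moreover have "predim (induced N C) X = predim N X"
    using X by (intro predim_induced) auto
  ultimately show "predim (induced N C) (A \<inter> X) < predim (induced N C) X" by simp
qed

lemma embedding_comp:
  assumes "embedding N N' \<alpha>" "embedding N' N'' \<beta>"
  shows "embedding N N'' (\<beta> \<circ> \<alpha>)"
proof -
  have "inj_on (\<beta> \<circ> \<alpha>) (univ N)"
    using assms by (auto simp: embedding_def intro: comp_inj_on inj_on_subset)
  moreover have "(\<beta> \<circ> \<alpha>) ` univ N \<subseteq> univ N''" using assms by (fastforce simp: embedding_def)
  moreover have "t \<in> interp N r \<longleftrightarrow> map (\<beta> \<circ> \<alpha>) t \<in> interp N'' r" if "t \<in> lists (univ N)" for r t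
  proof -
    have "map \<alpha> t \<in> lists (univ N')" using assms(1) that by (auto simp: embedding_def lists_eq_set)
    then show ?thesis using assms that by (simp add: embedding_def)
  qed
  ultimately show ?thesis by (simp add: embedding_def)
qed

text \<open>Transitivity of self-sufficiency: intersecting a set first with the image of \<open>G\<close> and then with
that of \<open>A\<close> lowers the predimension strictly in at least one of the two steps.\<close>

lemma selfsuff_image:
  assumes \<beta>: "selfsuff_embedding G N \<beta>" and A: "selfsuff G A"
  shows "selfsuff N (\<beta> ` A)"
  unfolding selfsuff_iff
proof (intro conjI allI impI)
  have emb: "embedding G N \<beta>" and D: "selfsuff N (\<beta> ` univ G)"
    using \<beta> by (auto simp: selfsuff_embedding_def)
  have AG: "A \<subseteq> univ G" using A by (simp add: selfsuff_iff)
  then show "\<beta> ` A \<subseteq> univ N" using emb by (auto simp: embedding_def)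
  fix X assume X: "finite X \<and> X \<subseteq> univ N \<and> \<not> X \<subseteq> \<beta> ` A"
  define Y where "Y = {y \<in> univ G. \<beta> y \<in> X}"
  have inj: "inj_on \<beta> (univ G)" using emb by (simp add: embedding_def)
  have Y: "\<beta> ` Y = \<beta> ` univ G \<inter> X" "Y \<subseteq> univ G" by (auto simp: Y_def)
  have finY: "finite Y"
  proof (rule finite_imageD[of \<beta>])
    show "finite (\<beta> ` Y)" using X Y by simp
    show "inj_on \<beta> Y" using inj Y(2) inj_on_subset by blast
  qed
  have AX: "\<beta> ` A \<inter> X = \<beta> ` (A \<inter> Y)" using AG by (auto simp: Y_def)
  have 1: "predim N (\<beta> ` A \<inter> X) = predim G (A \<inter> Y)"
    unfolding AX by (rule predim_embedding[OF emb]) (use AG in auto)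
  have 2: "predim N (\<beta> ` univ G \<inter> X) = predim G Y"
    unfolding Y(1)[symmetric] by (rule predim_embedding[OF emb Y(2)])
  show "predim N (\<beta> ` A \<inter> X) < predim N X"
  proof (cases "X \<subseteq> \<beta> ` univ G")
    case False
    then have "predim N (\<beta> ` univ G \<inter> X) < predim N X" using selfsuff_less[OF D] X by blast
    then show ?thesis using 1 2 selfsuff_le[OF A finY Y(2)] by simp
  next
    case True
    then have "\<not> Y \<subseteq> A" using X Y(1) by blast
    then show ?thesis using 1 2 selfsuff_less[OF A finY Y(2)] True by (simp add: Int_absorb1)
  qed
qed

lemma in_Kf_induced:
  assumes "in_Kf ar f B" "A \<subseteq> univ B"
  shows "in_Kf ar f (induced B A)"
proof -
  have B: "structure_over ar B" "finite (univ B)" "selfsuff_fin B {} (univ B)"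
      "\<forall>X\<subseteq>univ B. f (real (card X)) \<le> real_of_int (predim B X)"
    using assms(1) by (auto simp: in_Kf_def in_K0_def finite_structure_def)
  have "finite A" using assms(2) B(2) finite_subset by blast
  moreover have "selfsuff_fin (induced B A) {} A"
    unfolding selfsuff_fin_def
  proof (intro conjI allI impI)
    fix B' assume B': "{} \<subset> B' \<and> B' \<subseteq> A"
    then have "predim B {} < predim B B'" using B(3) assms(2) by (auto simp: selfsuff_fin_def)
    then show "predim (induced B A) {} < predim (induced B A) B'"
      using B' predim_induced[of "{}" A B] predim_induced[of B' A B] by simp
  qed simp
  moreover have "f (real (card X)) \<le> real_of_int (predim (induced B A) X)" if "X \<subseteq> A" for X
    using B(4) that assms(2) predim_induced[OF that, of B] by simp
  ultimately show ?thesis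
    using structure_over_induced[OF B(1)] by (simp add: in_Kf_def in_K0_def finite_structure_def)
qed

lemma in_Kf_iso:
  assumes B: "in_Kf ar f B" and e: "embedding B B' e" "univ B' = e ` univ B"
    and str: "structure_over ar B'"
  shows "in_Kf ar f B'"
proof -
  have B: "finite (univ B)" "selfsuff_fin B {} (univ B)"
      "\<forall>X\<subseteq>univ B. f (real (card X)) \<le> real_of_int (predim B X)"
    using B by (auto simp: in_Kf_def in_K0_def finite_structure_def)
  have ex: "\<exists>X. X \<subseteq> univ B \<and> X' = e ` X \<and> card X' = card X \<and> predim B' X' = predim B X"
    if sub: "X' \<subseteq> univ B'" for X'
  proof -
    obtain X where X: "X \<subseteq> univ B" "X' = e ` X" using sub e(2) by (metis subset_imageE)
    moreover have "card X' = card X"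
      unfolding X(2) using e(1) X(1) by (intro card_image) (auto simp: embedding_def intro: inj_on_subset)
    moreover have "predim B' X' = predim B X"
      unfolding X(2) by (rule predim_embedding[OF e(1) X(1)])
    ultimately show ?thesis by blast
  qed
  have "selfsuff_fin B' {} (univ B')"
    unfolding selfsuff_fin_def
  proof (intro conjI allI impI)
    fix X' assume X': "{} \<subset> X' \<and> X' \<subseteq> univ B'"
    then have "X' \<subseteq> univ B'" by simp
    from ex[OF this] obtain X where X: "X \<subseteq> univ B" "X' = e ` X" "predim B' X' = predim B X"
      by (elim exE conjE)
    moreover have "predim B' {} = predim B {}" using predim_embedding[OF e(1), of "{}"] by simp
    moreover have "{} \<subset> X" using X X' by blast
    ultimately show "predim B' {} < predim B' X'" using B(2) by (auto simp: selfsuff_fin_def)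
  qed simp
  moreover have "f (real (card X')) \<le> real_of_int (predim B' X')" if "X' \<subseteq> univ B'" for X'
  proof -
    from ex[OF that] obtain X where "X \<subseteq> univ B" "card X' = card X" "predim B' X' = predim B X"
      by (elim exE conjE)
    with B(3) show ?thesis by simp
  qed
  ultimately show ?thesis
    using str B(1) e(2) by (simp add: in_Kf_def in_K0_def finite_structure_def)
qed

section \<open>The generic structure\<close>

lemma generic_structure_over: "generic ar f M \<Longrightarrow> structure_over ar M"
  by (simp add: generic_def)

lemma generic_cover:
  assumes "generic ar f M" "finite X" "X \<subseteq> univ M"
  shows "\<exists>E. X \<subseteq> E \<and> finite E \<and> selfsuff M E \<and> in_Kf ar f (induced M E)"
proof -
  from assms(1) obtain C where
    C': "\<forall>k. C k \<subseteq> C (Suc k) \<and> finite (C k) \<and> selfsuff M (C k) \<and> in_Kf ar f (induced M (C k))"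
    and U: "univ M = (\<Union>k. C k)"
    unfolding generic_def by (elim conjE exE)
  have C: "C k \<subseteq> C (Suc k)" "finite (C k)" "selfsuff M (C k)" "in_Kf ar f (induced M (C k))" for k
    using C' by auto
  have mono: "C i \<subseteq> C j" if "i \<le> j" for i j using lift_Suc_mono_le[of C, OF C(1) that] .
  have "\<exists>k. X \<subseteq> C k"
    using assms(2,3)
  proof (induction X)
    case (insert x X)
    then obtain i j where "X \<subseteq> C i" "x \<in> C j" using U by blast
    then have "insert x X \<subseteq> C (max i j)" using mono[of i "max i j"] mono[of j "max i j"] by auto
    then show ?case by blast
  qed simp
  then obtain k where "X \<subseteq> C k" ..
  with C(2-4)[of k] show ?thesis by blast
qed

lemma generic_finite_Kf:
  assumes "generic ar f M" "finite X" "X \<subseteq> univ M"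
  shows "in_Kf ar f (induced M X)"
proof -
  obtain E where E: "X \<subseteq> E" "in_Kf ar f (induced M E)" using generic_cover[OF assms] by blast
  then have "in_Kf ar f (induced (induced M E) X)" by (intro in_Kf_induced[OF E(2)]) simp
  moreover have "induced (induced M E) X = induced M X"
    using E(1) by (auto simp: induced_def fun_eq_iff)
  ultimately show ?thesis by simp
qed

lemma generic_predim:
  assumes M: "generic ar f M" and X: "finite X" "X \<subseteq> univ M"
  shows generic_predim_ge: "f (real (card X)) \<le> real_of_int (predim M X)"
    and generic_predim_pos: "\<forall>r. 0 < ar r \<Longrightarrow> X \<noteq> {} \<Longrightarrow> 0 < predim M X"
proof -
  have K: "in_Kf ar f (induced M X)" by (rule generic_finite_Kf[OF assms])
  then show "f (real (card X)) \<le> real_of_int (predim M X)"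
    using predim_induced[of X X M] by (auto simp: in_Kf_def)
  assume ar: "\<forall>r. 0 < ar r" and "X \<noteq> {}"
  then have "predim (induced M X) {} < predim (induced M X) X"
    using K by (auto simp: in_Kf_def in_K0_def selfsuff_fin_def)
  then show "0 < predim M X"
    using predim_induced[of X X M] predim_induced[of "{}" X M]
      predim_empty[OF generic_structure_over[OF M] ar] by simp
qed

lemma generic_predim_nonneg:
  assumes "generic ar f M" "\<forall>r. 0 < ar r" "finite X" "X \<subseteq> univ M"
  shows "0 \<le> predim M X"
proof (cases "X = {}")
  case True
  then show ?thesis using predim_empty[OF generic_structure_over[OF assms(1)] assms(2)] by simp
next
  case False
  then show ?thesis using generic_predim_pos[OF assms(1,3,4,2)] by simp
qed

text \<open>The defining property for structures \<open>B\<close> over an arbitrary type, obtained by transporting \<open>B\<close> to the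
natural numbers.\<close>

lemma generic_extend:
  fixes B :: "('r::finite, 'c) struc"
  assumes M: "generic ar f M" and A: "finite A" "selfsuff M A" and B: "in_Kf ar f B"
    and \<iota>: "selfsuff_embedding (induced M A) B \<iota>"
  shows "\<exists>\<beta>. selfsuff_embedding B M \<beta> \<and> (\<forall>a\<in>A. \<beta> (\<iota> a) = a)"
proof -
  have finB: "finite (univ B)" and strB: "structure_over ar B"
    using B by (auto simp: in_Kf_def in_K0_def finite_structure_def)
  obtain e :: "'c \<Rightarrow> nat" where e: "inj_on e (univ B)"
    using finite_imp_inj_to_nat_seg[OF finB] by blast
  define B' where "B' = \<lparr>univ = e ` univ B, interp = (\<lambda>r. map e ` interp B r)\<rparr>"
  have univB': "univ B' = e ` univ B" by (simp add: B'_def)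
  have interpB: "set t \<subseteq> univ B" if "t \<in> interp B r" for t r
    using strB that by (simp add: structure_over_def)
  have emb: "embedding B B' e"
    unfolding embedding_def
  proof (intro conjI allI ballI)
    fix r t assume t: "t \<in> lists (univ B)"
    show "t \<in> interp B r \<longleftrightarrow> map e t \<in> interp B' r"
    proof
      assume "map e t \<in> interp B' r"
      then obtain u where u: "u \<in> interp B r" "map e t = map e u" by (auto simp: B'_def)
      have "inj_on e (set t \<union> set u)"
        using e by (rule inj_on_subset) (use t interpB[OF u(1)] in auto)
      then show "t \<in> interp B r" using u by (simp add: inj_on_map_eq_map)
    qed (simp add: B'_def)
  qed (use e in \<open>auto simp: B'_def\<close>)
  have "structure_over ar B'"
    using strB by (fastforce simp: structure_over_def B'_def)
  then have KB': "in_Kf ar f B'" by (rule in_Kf_iso[OF B emb univB'])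
  have e': "selfsuff_embedding B B' e"
    using emb univB' by (auto simp: selfsuff_embedding_def selfsuff_iff)
  have "selfsuff_embedding (induced M A) B' (e \<circ> \<iota>)"
  proof -
    have "embedding (induced M A) B' (e \<circ> \<iota>)"
      using \<iota> emb embedding_comp by (auto simp: selfsuff_embedding_def)
    moreover have "selfsuff B' (e ` (\<iota> ` A))"
      by (rule selfsuff_image[OF e']) (use \<iota> in \<open>simp add: selfsuff_embedding_def\<close>)
    ultimately show ?thesis by (simp add: selfsuff_embedding_def image_comp)
  qed
  with A KB' have prem: "finite A \<and> selfsuff M A \<and> in_Kf ar f B' \<and>
      selfsuff_embedding (induced M A) B' (e \<circ> \<iota>)" by blast
  have "\<forall>A (B :: ('r, nat) struc) \<iota>.
        finite A \<and> selfsuff M A \<and> in_Kf ar f B \<and> selfsuff_embedding (induced M A) B \<iota> \<longrightarrow>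
        (\<exists>\<beta>. selfsuff_embedding B M \<beta> \<and> (\<forall>a\<in>A. \<beta> (\<iota> a) = a))"
    using M unfolding generic_def by (elim conjE)
  from this[rule_format, OF prem] obtain \<beta> where
    \<beta>: "selfsuff_embedding B' M \<beta>" "\<forall>a\<in>A. \<beta> ((e \<circ> \<iota>) a) = a"
    by (elim exE conjE)
  have "selfsuff_embedding B M (\<beta> \<circ> e)"
    using \<beta>(1) embedding_comp[OF emb, of M \<beta>] univB' by (simp add: selfsuff_embedding_def image_comp)
  with \<beta>(2) show ?thesis by (intro exI[of _ "\<beta> \<circ> e"]) simp
qed

subsection \<open>Homogeneity\<close>

lemma embedding_induced_interp:
  assumes "embedding (induced N A) N' \<alpha>" "u \<in> lists A"
  shows "u \<in> interp N r \<longleftrightarrow> map \<alpha> u \<in> interp N' r"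
proof -
  have "u \<in> interp (induced N A) r \<longleftrightarrow> map \<alpha> u \<in> interp N' r"
    using assms by (simp add: embedding_def)
  moreover have "u \<in> interp (induced N A) r \<longleftrightarrow> u \<in> interp N r"
    using assms(2) by (auto simp: induced_def)
  ultimately show ?thesis by simp
qed

lemma embedding_inv:
  assumes \<alpha>: "embedding (induced N A) N \<alpha>" and A: "A \<subseteq> univ N"
  shows "embedding (induced N (\<alpha> ` A)) N (inv_into A \<alpha>)"
proof -
  let ?i = "inv_into A \<alpha>"
  have inj: "inj_on \<alpha> A" using \<alpha> by (simp add: embedding_def)
  have "t \<in> interp (induced N (\<alpha> ` A)) r \<longleftrightarrow> map ?i t \<in> interp N r" if t: "t \<in> lists (\<alpha> ` A)" for t r
  proof -
    obtain u where u: "u \<in> lists A" "t = map \<alpha> u" using t by (auto simp: lists_image)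
    have "map ?i t = u" using u inj by (auto simp: comp_def intro: map_idI)
    moreover have "u \<in> interp N r \<longleftrightarrow> map \<alpha> u \<in> interp N r"
      by (rule embedding_induced_interp[OF \<alpha> u(1)])
    ultimately show ?thesis using t u by (auto simp: induced_def)
  qed
  then show ?thesis
    using inj A by (auto simp: embedding_def inj_on_inv_into inv_into_into)
qed

text \<open>The extension property is applied to \<open>C\<close>, viewed as an extension of \<open>\<alpha> ` A\<close> through the inverse of
\<open>\<alpha>\<close>.\<close>

lemma generic_extend_embedding:
  assumes M: "generic ar f M" and A: "selfsuff M A" and C: "finite C" "selfsuff M C" "A \<subseteq> C"
    and \<alpha>: "embedding (induced M A) M \<alpha>" "selfsuff M (\<alpha> ` A)"
  shows "\<exists>\<beta>. embedding (induced M C) M \<beta> \<and> selfsuff M (\<beta> ` C) \<and> (\<forall>a\<in>A. \<beta> a = \<alpha> a)"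
proof -
  have AM: "A \<subseteq> univ M" and CM: "C \<subseteq> univ M" using A C by (auto simp: selfsuff_iff)
  have inj: "inj_on \<alpha> A" using \<alpha> by (simp add: embedding_def)
  have im: "inv_into A \<alpha> ` \<alpha> ` A = A" using inj by (simp add: inv_into_image_cancel)
  have i: "embedding (induced M (\<alpha> ` A)) M (inv_into A \<alpha>)" by (rule embedding_inv[OF \<alpha>(1) AM])
  have "embedding (induced M (\<alpha> ` A)) (induced M C) (inv_into A \<alpha>)"
    unfolding embedding_def
  proof (intro conjI allI ballI)
    fix r t assume t: "t \<in> lists (univ (induced M (\<alpha> ` A)))"
    have "set (map (inv_into A \<alpha>) t) \<subseteq> C" using t im C(3) by (auto simp: lists_eq_set)
    moreover have "t \<in> interp (induced M (\<alpha> ` A)) r \<longleftrightarrow> map (inv_into A \<alpha>) t \<in> interp M r"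
      using i t by (simp add: embedding_def)
    ultimately show "t \<in> interp (induced M (\<alpha> ` A)) r \<longleftrightarrow> map (inv_into A \<alpha>) t \<in> interp (induced M C) r"
      by (auto simp: induced_def)
  qed (use i im C(3) in \<open>auto simp: embedding_def\<close>)
  then have "selfsuff_embedding (induced M (\<alpha> ` A)) (induced M C) (inv_into A \<alpha>)"
    using selfsuff_induced[OF A C(3) CM] im by (simp add: selfsuff_embedding_def)
  moreover have "finite (\<alpha> ` A)" using C finite_subset by blast
  ultimately obtain \<beta> where \<beta>: "selfsuff_embedding (induced M C) M \<beta>"
      "\<forall>a\<in>\<alpha> ` A. \<beta> (inv_into A \<alpha> a) = a"
    using generic_extend[OF M _ \<alpha>(2) generic_finite_Kf[OF M C(1) CM]] by blast
  then show ?thesis using inj by (auto simp: selfsuff_embedding_def)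
qed

text \<open>Back and forth: isomorphic self-sufficient finite sets satisfy the same formulas. In the step for
the quantifier the witness is absorbed into a larger self-sufficient set, to which the
isomorphism extends; the converse is the same argument for the inverse isomorphism.\<close>

lemma sat_embedding:
  assumes M: "generic ar f M"
    and "finite A" "selfsuff M A" "embedding (induced M A) M \<alpha>" "selfsuff M (\<alpha> ` A)"
    and "\<And>x. x \<in> free_vars \<phi> \<Longrightarrow> v x \<in> A"
  shows "sat M v \<phi> \<longleftrightarrow> sat M (\<alpha> \<circ> v) \<phi>"
  using assms(2-)
proof (induction \<phi> arbitrary: A \<alpha> v)
  case (Eq x y)
  then have "inj_on \<alpha> A" by (simp add: embedding_def)
  then show ?case using Eq by (simp add: inj_on_eq_iff)
next
  case (Rel r xs)
  then have "map v xs \<in> lists A" by (auto simp: lists_eq_set)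
  then have "map v xs \<in> interp M r \<longleftrightarrow> map \<alpha> (map v xs) \<in> interp M r"
    by (rule embedding_induced_interp[OF Rel.prems(3)])
  then show ?case by (simp add: comp_def)
next
  case (Neg \<phi>)
  show ?case using Neg.IH[OF Neg.prems(1-4)] Neg.prems(5) by simp
next
  case (Conj \<phi> \<psi>)
  show ?case using Conj.IH(1)[OF Conj.prems(1-4)] Conj.IH(2)[OF Conj.prems(1-4)] Conj.prems(5) by simp
next
  case (Exi x \<phi>)
  have step: "sat M (\<gamma> \<circ> w) (Exi x \<phi>)"
    if sat: "sat M w (Exi x \<phi>)" and D: "finite D" "selfsuff M D" "embedding (induced M D) M \<gamma>"
      "selfsuff M (\<gamma> ` D)" and w: "\<And>z. z \<in> free_vars (Exi x \<phi>) \<Longrightarrow> w z \<in> D" for D \<gamma> w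
  proof -
    obtain a where a: "a \<in> univ M" "sat M (w(x := a)) \<phi>" using sat by auto
    have "finite (insert a D)" "insert a D \<subseteq> univ M" using D a by (auto simp: selfsuff_iff)
    then obtain C where C: "insert a D \<subseteq> C" "finite C" "selfsuff M C"
      using generic_cover[OF M] by metis
    obtain \<beta> where \<beta>: "embedding (induced M C) M \<beta>" "selfsuff M (\<beta> ` C)" "\<forall>d\<in>D. \<beta> d = \<gamma> d"
      using generic_extend_embedding[OF M D(2) C(2,3) _ D(3,4)] C(1) by blast
    have "(w(x := a)) z \<in> C" if "z \<in> free_vars \<phi>" for z using w[of z] that C(1) by auto
    then have "sat M (w(x := a)) \<phi> \<longleftrightarrow> sat M (\<beta> \<circ> w(x := a)) \<phi>"
      by (rule Exi.IH[OF C(2,3) \<beta>(1,2)])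
    with a(2) have "sat M (\<beta> \<circ> w(x := a)) \<phi>" by blast
    also have "sat M (\<beta> \<circ> w(x := a)) \<phi> \<longleftrightarrow> sat M ((\<gamma> \<circ> w)(x := \<beta> a)) \<phi>"
      by (rule sat_cong) (use w \<beta>(3) in auto)
    finally have "sat M ((\<gamma> \<circ> w)(x := \<beta> a)) \<phi>" .
    moreover have "\<beta> a \<in> univ M" using \<beta>(1) C(1) by (auto simp: embedding_def)
    ultimately show ?thesis by auto
  qed
  have AM: "A \<subseteq> univ M" using Exi.prems by (simp add: selfsuff_iff)
  have inj: "inj_on \<alpha> A" using Exi.prems by (simp add: embedding_def)
  show ?case
  proof
    assume "sat M v (Exi x \<phi>)"
    then show "sat M (\<alpha> \<circ> v) (Exi x \<phi>)" by (rule step[OF _ Exi.prems])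
  next
    assume "sat M (\<alpha> \<circ> v) (Exi x \<phi>)"
    then have "sat M (inv_into A \<alpha> \<circ> (\<alpha> \<circ> v)) (Exi x \<phi>)"
    proof (rule step)
      show "embedding (induced M (\<alpha> ` A)) M (inv_into A \<alpha>)"
        by (rule embedding_inv[OF Exi.prems(3) AM])
      show "selfsuff M (inv_into A \<alpha> ` \<alpha> ` A)" using Exi.prems(2) inj by (simp add: inv_into_image_cancel)
    qed (use Exi.prems in auto)
    also have "sat M (inv_into A \<alpha> \<circ> (\<alpha> \<circ> v)) (Exi x \<phi>) \<longleftrightarrow> sat M v (Exi x \<phi>)"
      by (rule sat_cong) (use Exi.prems(5) inj in auto)
    finally show "sat M v (Exi x \<phi>)" .
  qed
qed

section \<open>Copies of a structure glued through one new point\<close>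

text \<open>For a family of nonempty sets of sizes \<open>c j\<close> and predimensions \<open>d j\<close>, the largest one accounts for
\<open>f x\<close>, and each of the others contributes at least \<open>1\<close>. This beats the growth of \<open>f\<close> from \<open>x\<close>
to the size of the union, which is at most \<open>card J * x\<close>.\<close>

lemma slow_group_bound:
  fixes c :: "'j \<Rightarrow> nat" and d :: "'j \<Rightarrow> int"
  assumes "finite J" "J \<noteq> {}" and d: "\<And>j. j \<in> J \<Longrightarrow> 1 \<le> d j \<and> f (real (c j)) \<le> real_of_int (d j)"
  shows "\<exists>x. (\<Sum>j\<in>J. c j) \<le> card J * x \<and> (\<exists>j\<in>J. x = c j) \<and>
    f (real x) + real (card J) - 1 \<le> real_of_int (\<Sum>j\<in>J. d j)"
proof -
  have "Max (c ` J) \<in> c ` J" using assms(1,2) by (intro Max_in) auto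
  then obtain j where j: "j \<in> J" and max: "c j = Max (c ` J)" by auto
  have j2: "c i \<le> c j" if "i \<in> J" for i unfolding max using that assms(1) by simp
  have "(\<Sum>i\<in>J. c i) \<le> card J * c j" using sum_bounded_above[of J c "c j"] j2 by simp
  moreover have "f (real (c j)) + real (card J) - 1 \<le> real_of_int (\<Sum>i\<in>J. d i)"
  proof -
    have "int (card (J - {j})) \<le> (\<Sum>i\<in>J - {j}. d i)"
      using sum_bounded_below[of "J - {j}" 1 d] d by simp
    moreover have "(\<Sum>i\<in>J. d i) = d j + (\<Sum>i\<in>J - {j}. d i)"
      using sum.remove[OF assms(1) j] .
    moreover have "card J = Suc (card (J - {j}))"
      using card.remove[OF assms(1) j] .
    ultimately have "real_of_int (d j) + real (card J) - 1 \<le> real_of_int (\<Sum>i\<in>J. d i)"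
      by linarith
    with d[OF j] show ?thesis by linarith
  qed
  ultimately show ?thesis using j by blast
qed

definition hub :: "('a + nat \<times> 'a) option" where "hub = None"
definition base_pt :: "'a \<Rightarrow> ('a + nat \<times> 'a) option" where "base_pt e = Some (Inl e)"
definition copy_pt :: "nat \<Rightarrow> 'a \<Rightarrow> ('a + nat \<times> 'a) option" where "copy_pt j b = Some (Inr (j, b))"

lemmas pt_defs = hub_def base_pt_def copy_pt_def

text \<open>The points are those of \<open>E\<close>, those of \<open>s\<close> disjoint copies of \<open>B\<close>, and the hub. Without the hub the
structure would be a free sum; the only relations across tie the point \<open>a j i\<close> of \<open>E\<close> to the copy of
\<open>y i\<close> in the \<open>j\<close>-th copy of \<open>B\<close>.\<close>

definition glue :: "('r, 'a) struc \<Rightarrow> 'r \<Rightarrow> 'a set \<Rightarrow> 'a set \<Rightarrow> nat \<Rightarrow> nat \<Rightarrow>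
    (nat \<Rightarrow> nat \<Rightarrow> 'a) \<Rightarrow> (nat \<Rightarrow> 'a) \<Rightarrow> ('r, ('a + nat \<times> 'a) option) struc" where
  "glue M R E B s k a y =
     \<lparr>univ = insert hub (base_pt ` E \<union> (\<Union>j<s. copy_pt j ` B)),
      interp = (\<lambda>r. map base_pt ` rels_within M r E \<union> (\<Union>j<s. map (copy_pt j) ` rels_within M r B) \<union>
        {t. r = R \<and> (\<exists>j<s. \<exists>i<k. t = [base_pt (a j i), hub, copy_pt j (y i)])})\<rparr>"

text \<open>The assumptions on \<open>a\<close> and \<open>y\<close> say that these families are independent: a set containing \<open>l\<close> of
their members has predimension at least \<open>l\<close>. An independent set may have a closure larger than itself, and
such closures may even be the rule among the tuples of a finite factor; therefore \<open>E\<close> is an arbitrary finite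
set around the \<open>a j i\<close>.\<close>

locale glueing =
  fixes ar :: "'r::finite \<Rightarrow> nat" and f :: "real \<Rightarrow> real" and M :: "('r, 'a) struc"
    and R :: 'r and E B :: "'a set" and s k :: nat and a :: "nat \<Rightarrow> nat \<Rightarrow> 'a" and y :: "nat \<Rightarrow> 'a"
  assumes slow: "slow f" and str: "structure_over ar M" and ar: "\<forall>r. 0 < ar r" and R: "ar R = 3"
    and finE: "finite E" and finB: "finite B" and EM: "E \<subseteq> univ M" and BM: "B \<subseteq> univ M"
    and Kf: "\<And>X. finite X \<Longrightarrow> X \<subseteq> univ M \<Longrightarrow> f (real (card X)) \<le> real_of_int (predim M X)"
    and pos: "\<And>X. finite X \<Longrightarrow> X \<subseteq> univ M \<Longrightarrow> X \<noteq> {} \<Longrightarrow> 0 < predim M X"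
    and aE: "\<And>i j. j < s \<Longrightarrow> i < k \<Longrightarrow> a j i \<in> E"
    and indep_a: "\<And>X. X \<subseteq> E \<Longrightarrow> int (card {(j, i). j < s \<and> i < k \<and> a j i \<in> X}) \<le> predim M X"
    and yB: "\<And>i. i < k \<Longrightarrow> y i \<in> B"
    and indep_y: "\<And>X. X \<subseteq> B \<Longrightarrow> int (card {i. i < k \<and> y i \<in> X}) \<le> predim M X"
begin

abbreviation "G \<equiv> glue M R E B s k a y"

lemma predim_M_empty: "predim M {} = 0"
  by (rule predim_empty[OF str ar])

lemma predim_M_nonneg: "finite X \<Longrightarrow> X \<subseteq> univ M \<Longrightarrow> 0 \<le> predim M X"
  using pos[of X] predim_M_empty by (cases "X = {}") auto

lemma in_univ_glue:
  "e \<in> E \<Longrightarrow> base_pt e \<in> univ G" "hub \<in> univ G" "j < s \<Longrightarrow> b \<in> B \<Longrightarrow> copy_pt j b \<in> univ G"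
  unfolding glue_def by auto

lemma univ_glue_cases:
  assumes "x \<in> univ G"
  obtains "x = hub" | e where "e \<in> E" "x = base_pt e" | j b where "j < s" "b \<in> B" "x = copy_pt j b"
proof -
  from assms have "x \<in> insert hub (base_pt ` E \<union> (\<Union>j<s. copy_pt j ` B))" by (simp add: glue_def)
  then show ?thesis using that by blast
qed

lemma interp_glue_cases:
  assumes "t \<in> interp G r"
  obtains u where "u \<in> rels_within M r E" "t = map base_pt u"
    | j u where "j < s" "u \<in> rels_within M r B" "t = map (copy_pt j) u"
    | j i where "j < s" "i < k" "r = R" "t = [base_pt (a j i), hub, copy_pt j (y i)]"
proof -
  from assms have "t \<in> map base_pt ` rels_within M r E \<union> (\<Union>j<s. map (copy_pt j) ` rels_within M r B) \<union>
        {t. r = R \<and> (\<exists>j<s. \<exists>i<k. t = [base_pt (a j i), hub, copy_pt j (y i)])}"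
    by (simp add: glue_def)
  then show ?thesis using that by blast
qed

lemma glue_structure: "structure_over ar G"
  unfolding structure_over_def
proof (intro allI ballI)
  fix r t assume "t \<in> interp G r"
  then show "length t = ar r \<and> set t \<subseteq> univ G"
  proof (cases rule: interp_glue_cases)
    case 1
    then show ?thesis using str by (auto simp: rels_within_def structure_over_def glue_def)
  next
    case (2 j u)
    then have "set t \<subseteq> copy_pt j ` B" "length t = ar r"
      using str by (auto simp: rels_within_def structure_over_def)
    moreover have "copy_pt j ` B \<subseteq> univ G" using 2(1) in_univ_glue by blast
    ultimately show ?thesis by blast
  next
    case 3
    then show ?thesis using R aE yB by (simp add: in_univ_glue)
  qed
qed

lemma glue_finite: "finite (univ G)"
  using finE finB by (simp add: glue_def)

text \<open>For a set \<open>X\<close> with part \<open>X2\<close> in \<open>E\<close> and parts \<open>Z j\<close> in the copies, the predimension is additive except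
for the relations through the hub. Their number is at most the number of the \<open>a j i\<close> in \<open>X2\<close>, and
also at most that of the \<open>y i\<close> in the \<open>Z j\<close>. By independence they consume at most
the predimension of \<open>X2\<close>, or at most the sum of the predimensions of the \<open>Z j\<close>, so that the other
side survives in full together with the \<open>1\<close> contributed by the hub.\<close>

lemma predim_glue:
  assumes X: "X \<subseteq> univ G"
  defines "X2 \<equiv> {e. base_pt e \<in> X}" and "Z \<equiv> \<lambda>j. {b. copy_pt j b \<in> X}"
  shows glue_parts: "X2 \<subseteq> E" "Z j \<subseteq> B"
    and card_glue: "card X = of_bool (hub \<in> X) + card X2 + (\<Sum>j<s. card (Z j))"
    and predim_glue_ge_hub1: "hub \<in> X \<Longrightarrow> 1 + predim M X2 \<le> predim G X"
    and predim_glue_ge_hub2: "hub \<in> X \<Longrightarrow> 1 + (\<Sum>j<s. predim M (Z j)) \<le> predim G X"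
    and predim_glue_ge: "hub \<notin> X \<Longrightarrow> predim M X2 + (\<Sum>j<s. predim M (Z j)) \<le> predim G X"
proof -
  show X2E: "X2 \<subseteq> E" and ZB: "Z j \<subseteq> B" for j
    using X by (auto simp: X2_def Z_def glue_def pt_defs)
  have inj: "inj base_pt" "inj (copy_pt j)" for j :: nat
    by (auto simp: inj_on_def pt_defs)
  have fin: "finite X2" "finite (Z j)" for j
    using X2E ZB finE finB finite_subset by blast+
  have XM: "X2 \<subseteq> univ M" "Z j \<subseteq> univ M" for j using X2E ZB EM BM by blast+
  have X_eq: "X = (if hub \<in> X then {hub} else {}) \<union> (base_pt ` X2 \<union> (\<Union>j<s. copy_pt j ` Z j))"
    (is "_ = ?X")
  proof
    show "X \<subseteq> ?X"
    proof
      fix x assume x: "x \<in> X"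
      then have "x \<in> univ G" using X by blast
      then show "x \<in> ?X" using x by (cases rule: univ_glue_cases) (auto simp: X2_def Z_def)
    qed
    show "?X \<subseteq> X" by (auto simp: X2_def Z_def)
  qed
  show cardX: "card X = of_bool (hub \<in> X) + card X2 + (\<Sum>j<s. card (Z j))"
  proof -
    have "card (\<Union>j<s. copy_pt j ` Z j) = (\<Sum>j<s. card (copy_pt j ` Z j))"
      by (rule card_UN_disjoint) (use fin in \<open>auto simp: pt_defs\<close>)
    also have "\<dots> = (\<Sum>j<s. card (Z j))"
      by (intro sum.cong refl card_image) (use inj in \<open>auto intro: inj_on_subset\<close>)
    finally have "card (base_pt ` X2 \<union> (\<Union>j<s. copy_pt j ` Z j)) = card X2 + (\<Sum>j<s. card (Z j))"
      using fin inj(1) by (subst card_Un_disjoint)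
        (auto simp: pt_defs card_image[OF inj_on_subset[OF inj(1)], unfolded pt_defs])
    then show ?thesis
      by (subst X_eq, subst card_Un_disjoint) (use fin in \<open>auto simp: pt_defs split: if_splits\<close>)
  qed
  define P where "P = {(j, i). j < s \<and> i < k \<and> a j i \<in> X2 \<and> y i \<in> Z j \<and> hub \<in> X}"
  have finP: "finite P" by (rule finite_subset[of _ "{..<s} \<times> {..<k}"]) (auto simp: P_def)
  have rels: "card (rels_within G r X) \<le> card (rels_within M r X2) + (\<Sum>j<s. card (rels_within M r (Z j)))
      + (if r = R then card P else 0)" for r
  proof -
    let ?A = "map base_pt ` rels_within M r X2" and ?B = "\<Union>j<s. map (copy_pt j) ` rels_within M r (Z j)"
    let ?C = "if r = R then (\<lambda>(j, i). [base_pt (a j i), hub, copy_pt j (y i)]) ` P else {}"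
    have fr: "finite (rels_within M r X2)" "finite (rels_within M r (Z j))" for j
      using fin finite_rels_within[OF str] by blast+
    have "rels_within G r X \<subseteq> ?A \<union> ?B \<union> ?C"
    proof
      fix t assume t: "t \<in> rels_within G r X"
      then have tX: "set t \<subseteq> X" and "t \<in> interp G r" by (auto simp: rels_within_def)
      from this(2) show "t \<in> ?A \<union> ?B \<union> ?C"
      proof (cases rule: interp_glue_cases)
        case (1 u)
        then have "u \<in> rels_within M r X2" using tX by (auto simp: rels_within_def X2_def)
        then show ?thesis using 1 by blast
      next
        case (2 j u)
        then have "u \<in> rels_within M r (Z j)" using tX by (auto simp: rels_within_def Z_def)
        then show ?thesis using 2 by blast
      next
        case (3 j i)
        then have "(j, i) \<in> P" using tX by (auto simp: P_def X2_def Z_def)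
        then show ?thesis using 3 by force
      qed
    qed
    then have "card (rels_within G r X) \<le> card (?A \<union> ?B \<union> ?C)"
      by (rule card_mono[rotated]) (use fr finP in auto)
    also have "\<dots> \<le> card ?A + card ?B + card ?C"
      by (intro order_trans[OF card_Un_le] add_right_mono card_Un_le)
    also have "card ?A \<le> card (rels_within M r X2)" using fr by (intro card_image_le)
    also have "card ?B \<le> (\<Sum>j<s. card (map (copy_pt j) ` rels_within M r (Z j)))"
      by (rule card_UN_le) simp
    also have "\<dots> \<le> (\<Sum>j<s. card (rels_within M r (Z j)))"
      using fr by (intro sum_mono card_image_le)
    also have "card ?C \<le> (if r = R then card P else 0)" using finP by (auto intro: card_image_le)
    finally show ?thesis by simp
  qed
  have "(\<Sum>r\<in>UNIV. card (rels_within G r X)) \<le> (\<Sum>r\<in>UNIV. card (rels_within M r X2) +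
      (\<Sum>j<s. card (rels_within M r (Z j))) + (if r = R then card P else 0))"
    by (rule sum_mono) (rule rels)
  also have "\<dots> = (\<Sum>r\<in>UNIV. card (rels_within M r X2)) +
      (\<Sum>j<s. \<Sum>r\<in>UNIV. card (rels_within M r (Z j))) + card P"
    by (simp add: sum.distrib sum.swap[of _ UNIV])
  finally have "(\<Sum>r\<in>UNIV. int (card (rels_within G r X))) \<le> (\<Sum>r\<in>UNIV. int (card (rels_within M r X2))) +
      (\<Sum>j<s. \<Sum>r\<in>UNIV. int (card (rels_within M r (Z j)))) + int (card P)"
    unfolding of_nat_sum[symmetric] of_nat_add[symmetric] of_nat_le_iff .
  then have main: "of_bool (hub \<in> X) + predim M X2 + (\<Sum>j<s. predim M (Z j)) - int (card P) \<le> predim G X"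
    by (simp add: predim_eq cardX sum_subtractf)
  {
    assume hub: "hub \<notin> X"
    then have "P = {}" by (auto simp: P_def)
    then show "predim M X2 + (\<Sum>j<s. predim M (Z j)) \<le> predim G X" using main hub by simp
  next
    assume hub: "hub \<in> X"
    have "card P \<le> card (SIGMA j:{..<s}. {i. i < k \<and> y i \<in> Z j})"
      by (rule card_mono) (auto simp: P_def)
    also have "\<dots> = (\<Sum>j<s. card {i. i < k \<and> y i \<in> Z j})" by (rule card_SigmaI) auto
    finally have "int (card P) \<le> (\<Sum>j<s. int (card {i. i < k \<and> y i \<in> Z j}))"
      unfolding of_nat_sum[symmetric] of_nat_le_iff .
    also have "\<dots> \<le> (\<Sum>j<s. predim M (Z j))" by (intro sum_mono indep_y ZB)
    finally show "1 + predim M X2 \<le> predim G X" using main hub by simp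
    have "{(j, i). j < s \<and> i < k \<and> a j i \<in> X2} \<subseteq> {..<s} \<times> {..<k}" by auto
    then have "finite {(j, i). j < s \<and> i < k \<and> a j i \<in> X2}" by (rule finite_subset) simp
    then have "card P \<le> card {(j, i). j < s \<and> i < k \<and> a j i \<in> X2}"
      by (rule card_mono) (auto simp: P_def)
    then have "int (card P) \<le> predim M X2" using indep_a[OF X2E] by linarith
    then show "1 + (\<Sum>j<s. predim M (Z j)) \<le> predim G X" using main hub by simp
  }
qed

text \<open>Without the hub, \<open>X\<close> is a disjoint union and \<open>slow_group_bound\<close> applies to all its parts. With the
hub, the larger of the two sides, \<open>X2\<close> or the union of the \<open>Z j\<close>, is used: \<open>X\<close> has at most twice its size,
apart from the hub, and the \<open>1\<close> gained from the hub pays for the doubling.\<close>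

lemma predim_glue_ge_f:
  assumes X: "X \<subseteq> univ G"
  shows "f (real (card X)) \<le> real_of_int (predim G X)"
proof -
  define X2 where "X2 = {e. base_pt e \<in> X}"
  define Z where "Z j = {b. copy_pt j b \<in> X}" for j
  note parts = glue_parts[OF X, folded X2_def, folded Z_def]
  have fin: "finite X2" "finite (Z j)" for j
    using parts finE finB finite_subset by blast+
  have XM: "X2 \<subseteq> univ M" "Z j \<subseteq> univ M" for j using parts EM BM by blast+
  have mono: "f x \<le> f z" if "0 \<le> x" "x \<le> z" for x z
    using slow that by (auto simp: slow_def mono_on_def)
  note cardX = card_glue[OF X, folded X2_def, folded Z_def]
  show ?thesis
  proof (cases "hub \<in> X")
    case False
    \<comment> \<open>the part in \<open>E\<close> is listed as the part with index \<open>s\<close>\<close>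
    define W where "W j = (if j = s then X2 else Z j)" for j
    have W: "finite (W j)" "W j \<subseteq> univ M" for j using fin XM by (auto simp: W_def)
    have sums: "(\<Sum>j<s. h (Z j)) + h X2 = (\<Sum>j\<le>s. h (W j))" for h :: "'a set \<Rightarrow> int"
      by (simp add: W_def lessThan_Suc_atMost[symmetric])
    have sums': "(\<Sum>j<s. card (Z j)) + card X2 = (\<Sum>j\<le>s. card (W j))"
      by (simp add: W_def lessThan_Suc_atMost[symmetric])
    let ?J = "{j. j \<le> s \<and> W j \<noteq> {}}"
    have J: "(\<Sum>j\<le>s. predim M (W j)) = (\<Sum>j\<in>?J. predim M (W j))"
      by (rule sum.mono_neutral_right) (auto simp: predim_M_empty)
    have J': "(\<Sum>j\<le>s. card (W j)) = (\<Sum>j\<in>?J. card (W j))"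
      by (rule sum.mono_neutral_right) auto
    have le: "(\<Sum>j\<in>?J. predim M (W j)) \<le> predim G X"
      using predim_glue_ge[OF X False, folded X2_def, folded Z_def] sums[of "predim M"] J by simp
    have card_eq: "card X = (\<Sum>j\<in>?J. card (W j))" using cardX False sums' J' by simp
    show ?thesis
    proof (cases "?J = {}")
      case True
      have "f (real (card X)) \<le> 0" using card_eq slow unfolding True by (simp add: slow_def)
      moreover have "0 \<le> predim G X" using le unfolding True by simp
      ultimately show ?thesis by linarith
    next
      case J: False
      have d: "1 \<le> predim M (W j) \<and> f (real (card (W j))) \<le> real_of_int (predim M (W j))" if "j \<in> ?J" for j
        using that pos[of "W j"] Kf[of "W j"] W[of j] by fastforce
      have "finite ?J" by simp
      from slow_group_bound[of ?J "\<lambda>j. predim M (W j)" f "\<lambda>j. card (W j)", OF this J d]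
      obtain x where x: "(\<Sum>j\<in>?J. card (W j)) \<le> card ?J * x" "\<exists>j\<in>?J. x = card (W j)"
        "f (real x) + real (card ?J) - 1 \<le> real_of_int (\<Sum>j\<in>?J. predim M (W j))" by blast
      obtain j where j: "j \<in> ?J" "x = card (W j)" using x(2) by blast
      have p: "1 \<le> card ?J" using J \<open>finite ?J\<close> by (simp add: Suc_le_eq card_gt_0_iff)
      have "x \<le> card X" unfolding card_eq j(2) using j(1)
        by (intro member_le_sum) auto
      moreover have "real (card X) \<le> real (card ?J) * (real x + 1) - 1"
      proof -
        have "real (card X) \<le> real (card ?J) * real x"
          using x(1) unfolding card_eq[symmetric] of_nat_mult[symmetric] of_nat_le_iff .
        then show ?thesis using p by (simp add: algebra_simps)
      qed
      ultimately have "f (real (card X)) \<le> f (real x) + (real (card ?J) - 1) / 2"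
        by (intro slow_scale[OF slow]) auto
      also have "\<dots> \<le> f (real x) + real (card ?J) - 1" using p by simp
      also have "\<dots> \<le> real_of_int (predim G X)" using x(3) le by linarith
      finally show ?thesis .
    qed
  next
    case True
    note h1 = predim_glue_ge_hub1[OF X True, folded X2_def]
    note h2 = predim_glue_ge_hub2[OF X True, folded Z_def]
    show ?thesis
    proof (cases "(\<Sum>j<s. card (Z j)) \<le> card X2")
      case le: True
      have "card X2 \<le> card X" "card X \<le> 1 + 2 * card X2" using cardX True le by auto
      then have "f (real (card X)) \<le> f (real (card X2)) + (2 - 1) / 2"
        by (intro slow_scale[OF slow]) auto
      moreover have "f (real (card X2)) \<le> real_of_int (predim M X2)" by (rule Kf[OF fin(1) XM(1)])
      moreover have "1 + real_of_int (predim M X2) \<le> real_of_int (predim G X)" using h1 by linarith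
      ultimately show ?thesis by simp
    next
      case gt: False
      let ?J = "{j. j < s \<and> Z j \<noteq> {}}"
      have J: "(\<Sum>j<s. predim M (Z j)) = (\<Sum>j\<in>?J. predim M (Z j))"
        by (rule sum.mono_neutral_right) (auto simp: predim_M_empty)
      have J': "(\<Sum>j<s. card (Z j)) = (\<Sum>j\<in>?J. card (Z j))"
        by (rule sum.mono_neutral_right) auto
      have d: "1 \<le> predim M (Z j) \<and> f (real (card (Z j))) \<le> real_of_int (predim M (Z j))" if "j \<in> ?J" for j
        using that pos[of "Z j"] Kf[of "Z j"] fin XM by fastforce
      have "finite ?J" by simp
      moreover have ne: "?J \<noteq> {}"
      proof
        assume "?J = {}"
        then have "(\<Sum>j<s. card (Z j)) = 0" unfolding J' by (simp only: sum.empty)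
        with gt show False by simp
      qed
      ultimately obtain x where x: "(\<Sum>j\<in>?J. card (Z j)) \<le> card ?J * x"
        "f (real x) + real (card ?J) - 1 \<le> real_of_int (\<Sum>j\<in>?J. predim M (Z j))"
        using slow_group_bound[of ?J "\<lambda>j. predim M (Z j)" f "\<lambda>j. card (Z j)", OF _ _ d] by blast
      have p: "1 \<le> card ?J" using ne \<open>finite ?J\<close> by (simp add: Suc_le_eq card_gt_0_iff)
      have "card X \<le> 2 * (\<Sum>j<s. card (Z j))" using cardX True gt by simp
      also have "\<dots> \<le> 2 * (card ?J * x)" using x(1) J' by simp
      finally have "real (card X) \<le> 2 * real (card ?J) * real x"
        by (metis (no_types) of_nat_le_iff of_nat_mult of_nat_numeral mult.assoc)
      then have "f (real (card X)) \<le> f (2 * real (card ?J) * real x)" by (intro mono) auto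
      also have "\<dots> \<le> f (real x) + (2 * real (card ?J) - 1) / 2"
      proof (rule slow_scale[OF slow])
        show "2 * real (card ?J) * real x \<le> 2 * real (card ?J) * (real x + 1) - 1"
          using p by (simp add: algebra_simps)
        have "1 * real x \<le> 2 * real (card ?J) * real x" using p by (intro mult_right_mono) auto
        then show "real x \<le> 2 * real (card ?J) * real x" by simp
      qed simp
      also have "\<dots> \<le> real_of_int (predim G X)"
      proof -
        have "1 + real_of_int (\<Sum>j\<in>?J. predim M (Z j)) \<le> real_of_int (predim G X)"
          using h2 unfolding J by linarith
        with x(2) show ?thesis by argo
      qed
      finally show ?thesis .
    qed
  qed
qed

lemma predim_glue_empty: "predim G {} = 0"
  by (rule predim_empty[OF glue_structure ar])

lemma predim_glue_pos:
  assumes X: "X \<subseteq> univ G" "X \<noteq> {}"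
  shows "0 < predim G X"
proof -
  define X2 where "X2 = {e. base_pt e \<in> X}"
  define Z where "Z j = {b. copy_pt j b \<in> X}" for j
  note parts = glue_parts[OF X(1), folded X2_def, folded Z_def]
  have fin: "finite X2" "finite (Z j)" for j
    using parts finE finB finite_subset by blast+
  have XM: "X2 \<subseteq> univ M" "Z j \<subseteq> univ M" for j using parts EM BM by blast+
  have "finite X" using X glue_finite finite_subset by blast
  then have cX: "0 < card X" using X(2) by (simp add: card_gt_0_iff)
  show ?thesis
  proof (cases "hub \<in> X")
    case True
    then show ?thesis
      using predim_glue_ge_hub1[OF X(1), folded X2_def] predim_M_nonneg[OF fin(1) XM(1)] by simp
  next
    case False
    have nn: "0 \<le> predim M X2" "\<And>j. 0 \<le> predim M (Z j)" using predim_M_nonneg fin XM by auto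
    have "X2 \<noteq> {} \<or> (\<exists>j<s. Z j \<noteq> {})"
    proof (rule ccontr)
      assume "\<not> ?thesis"
      then have "card X = 0"
        using card_glue[OF X(1), folded X2_def, folded Z_def] False by simp
      with cX show False by simp
    qed
    then have "0 < predim M X2 + (\<Sum>j<s. predim M (Z j))"
    proof
      assume "X2 \<noteq> {}"
      then show ?thesis using pos[OF fin(1) XM(1)] nn by (simp add: add_pos_nonneg sum_nonneg)
    next
      assume "\<exists>j<s. Z j \<noteq> {}"
      then obtain j where j: "j < s" "Z j \<noteq> {}" by blast
      have "0 < (\<Sum>j<s. predim M (Z j))"
        by (rule sum_pos2[of _ j]) (use j pos[OF fin(2) XM(2)] nn in auto)
      then show ?thesis using nn by simp
    qed
    then show ?thesis using predim_glue_ge[OF X(1) False, folded X2_def, folded Z_def] by simp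
  qed
qed

lemma glue_in_Kf: "in_Kf ar f G"
proof -
  have "selfsuff_fin G {} (univ G)"
    unfolding selfsuff_fin_def using predim_glue_empty predim_glue_pos by auto
  then show ?thesis
    using predim_glue_ge_f glue_structure glue_finite
    by (simp add: in_Kf_def in_K0_def finite_structure_def)
qed

lemma rels_nonempty: "t \<in> rels_within M r X \<Longrightarrow> t \<noteq> []"
  using str ar by (auto simp: rels_within_def structure_over_def) (metis less_irrefl list.size(3))

lemma embedding_base: "embedding (induced M E) G base_pt"
  unfolding embedding_def
proof (intro conjI allI ballI)
  fix r t assume t: "t \<in> lists (univ (induced M E))"
  have inj: "inj base_pt" by (auto simp: inj_on_def pt_defs)
  show "t \<in> interp (induced M E) r \<longleftrightarrow> map base_pt t \<in> interp G r"
  proof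
    assume "t \<in> interp (induced M E) r"
    then show "map base_pt t \<in> interp G r" by (auto simp: glue_def induced_def rels_within_def)
  next
    assume "map base_pt t \<in> interp G r"
    then show "t \<in> interp (induced M E) r"
    proof (cases rule: interp_glue_cases)
      case (1 u)
      then have "t = u" using inj_map_eq_map[OF inj] by blast
      with 1(1) show ?thesis by (simp add: rels_within_def induced_def)
    next
      case (2 j u)
      then show ?thesis using rels_nonempty[OF 2(2)] by (cases u; cases t) (auto simp: pt_defs)
    next
      case 3
      then show ?thesis by (auto simp: pt_defs)
    qed
  qed
qed (use in_univ_glue in \<open>auto simp: inj_on_def base_pt_def\<close>)

lemma embedding_copy:
  assumes j: "j < s"
  shows "embedding (induced M B) G (copy_pt j)"
  unfolding embedding_def
proof (intro conjI allI ballI)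
  fix r t assume t: "t \<in> lists (univ (induced M B))"
  have inj: "inj (copy_pt j)" by (auto simp: inj_on_def pt_defs)
  show "t \<in> interp (induced M B) r \<longleftrightarrow> map (copy_pt j) t \<in> interp G r"
  proof
    assume "t \<in> interp (induced M B) r"
    then show "map (copy_pt j) t \<in> interp G r" using j by (auto simp: glue_def induced_def rels_within_def)
  next
    assume "map (copy_pt j) t \<in> interp G r"
    then show "t \<in> interp (induced M B) r"
    proof (cases rule: interp_glue_cases)
      case (1 u)
      then show ?thesis using rels_nonempty[OF 1(1)] by (cases u; cases t) (auto simp: pt_defs)
    next
      case (2 j' u)
      then have "j' = j" using rels_nonempty[OF 2(2)] by (cases u; cases t) (auto simp: pt_defs)
      then have "t = u" using 2(3) inj_map_eq_map[OF inj] by blast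
      with 2(2) show ?thesis by (simp add: rels_within_def induced_def)
    next
      case 3
      then show ?thesis by (auto simp: pt_defs)
    qed
  qed
qed (use j in_univ_glue in \<open>auto simp: inj_on_def copy_pt_def\<close>)

lemma selfsuff_base: "selfsuff G (base_pt ` E)"
proof -
  have "selfsuff_fin G (base_pt ` E) (univ G)"
    unfolding selfsuff_fin_def
  proof (intro conjI allI impI)
    show "base_pt ` E \<subseteq> univ G" using in_univ_glue by blast
    fix X assume X': "base_pt ` E \<subset> X \<and> X \<subseteq> univ G"
    then have X: "X \<subseteq> univ G" by simp
    define X2 where "X2 = {e. base_pt e \<in> X}"
    define Z where "Z j = {b. copy_pt j b \<in> X}" for j
    note parts = glue_parts[OF X, folded X2_def, folded Z_def]
    have ZM: "finite (Z j)" "Z j \<subseteq> univ M" for j using parts(2) finB BM finite_subset by blast+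
    have X2: "X2 = E" using parts(1) X' by (auto simp: X2_def)
    have E: "predim G (base_pt ` E) = predim M E"
      using predim_embedding[OF embedding_base, of E] predim_induced[of E E M] by simp
    show "predim G (base_pt ` E) < predim G X"
    proof (cases "hub \<in> X")
      case True
      then show ?thesis using predim_glue_ge_hub1[OF X, folded X2_def] X2 E by simp
    next
      case False
      obtain x where "x \<in> X" "x \<notin> base_pt ` E" using X' by blast
      moreover have "x \<in> univ G" "x \<noteq> hub" using X \<open>x \<in> X\<close> False by auto
      ultimately obtain j b where "j < s" "x = copy_pt j b" by (blast elim: univ_glue_cases)
      then have "j < s" "Z j \<noteq> {}" using \<open>x \<in> X\<close> by (auto simp: Z_def)
      then have "0 < (\<Sum>j<s. predim M (Z j))"
        by (intro sum_pos2[of _ j]) (use pos[OF ZM] predim_M_nonneg[OF ZM] in auto)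
      then show ?thesis using predim_glue_ge[OF X False, folded X2_def, folded Z_def] X2 E by simp
    qed
  qed
  then show ?thesis
    using selfsuff_iff_selfsuff_fin[of ar G] glue_structure glue_finite by (simp add: finite_structure_def)
qed

lemma selfsuff_copy:
  assumes j: "j < s"
  shows "selfsuff G (copy_pt j ` B)"
proof -
  have "selfsuff_fin G (copy_pt j ` B) (univ G)"
    unfolding selfsuff_fin_def
  proof (intro conjI allI impI)
    show "copy_pt j ` B \<subseteq> univ G" using j in_univ_glue by blast
    fix X assume X': "copy_pt j ` B \<subset> X \<and> X \<subseteq> univ G"
    then have X: "X \<subseteq> univ G" by simp
    define X2 where "X2 = {e. base_pt e \<in> X}"
    define Z where "Z j = {b. copy_pt j b \<in> X}" for j
    note parts = glue_parts[OF X, folded X2_def, folded Z_def]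
    have ZM: "finite (Z j)" "Z j \<subseteq> univ M" for j using parts(2) finB BM finite_subset by blast+
    have X2M: "finite X2" "X2 \<subseteq> univ M" using parts(1) finE EM finite_subset by blast+
    have Zj: "Z j = B" using parts(2) X' by (auto simp: Z_def)
    have B: "predim G (copy_pt j ` B) = predim M B"
      using predim_embedding[OF embedding_copy[OF j], of B] predim_induced[of B B M] by simp
    have sum: "(\<Sum>i<s. predim M (Z i)) = predim M B + (\<Sum>i\<in>{..<s} - {j}. predim M (Z i))"
      using j by (subst sum.remove[of _ j]) (auto simp: Zj)
    have rest: "0 \<le> (\<Sum>i\<in>{..<s} - {j}. predim M (Z i))"
      using predim_M_nonneg[OF ZM] by (intro sum_nonneg) auto
    show "predim G (copy_pt j ` B) < predim G X"
    proof (cases "hub \<in> X")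
      case True
      then show ?thesis using predim_glue_ge_hub2[OF X, folded Z_def] sum rest B by simp
    next
      case False
      obtain x where x: "x \<in> X" "x \<notin> copy_pt j ` B" using X' by blast
      have "x \<in> univ G" "x \<noteq> hub" using X x(1) False by auto
      then consider e where "x = base_pt e" | i b where "i < s" "b \<in> B" "x = copy_pt i b"
        by (blast elim: univ_glue_cases)
      then have "X2 \<noteq> {} \<or> (\<exists>i<s. i \<noteq> j \<and> Z i \<noteq> {})"
      proof cases
        case 1
        then show ?thesis using x(1) by (auto simp: X2_def)
      next
        case 2
        then have "i \<noteq> j" "b \<in> Z i" using x by (auto simp: Z_def)
        then show ?thesis using 2 by blast
      qed
      then consider "X2 \<noteq> {}" | i where "i < s" "i \<noteq> j" "Z i \<noteq> {}" by blast
      then have "0 < predim M X2 + (\<Sum>i\<in>{..<s} - {j}. predim M (Z i))"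
      proof cases
        case 1
        then show ?thesis using pos[OF X2M] rest by simp
      next
        case 2
        then have "0 < (\<Sum>i\<in>{..<s} - {j}. predim M (Z i))"
          by (intro sum_pos2[of _ i]) (use 2 pos[OF ZM] predim_M_nonneg[OF ZM] in auto)
        then show ?thesis using predim_M_nonneg[OF X2M] by simp
      qed
      then show ?thesis
        using predim_glue_ge[OF X False, folded X2_def, folded Z_def] sum B by simp
    qed
  qed
  then show ?thesis
    using selfsuff_iff_selfsuff_fin[of ar G] glue_structure glue_finite by (simp add: finite_structure_def)
qed

end

text \<open>The glued structure is embedded into \<open>M\<close> over \<open>E\<close>. The copies of \<open>B\<close> land on self-sufficient sets, as
is needed to apply homogeneity to them.\<close>

lemma generic_glue:
  fixes ar :: "'r::finite \<Rightarrow> nat" and M :: "('r, 'a) struc"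
    and a :: "nat \<Rightarrow> nat \<Rightarrow> 'a" and y :: "nat \<Rightarrow> 'a"
  assumes M: "generic ar f M" and slow: "slow f" and ar: "\<forall>r. 0 < ar r" and R: "ar R = 3"
    and E: "finite E" "selfsuff M E" and B: "finite B" "B \<subseteq> univ M"
    and a: "\<And>i j. j < s \<Longrightarrow> i < k \<Longrightarrow> a j i \<in> E"
      "\<And>X. X \<subseteq> E \<Longrightarrow> int (card {(j, i). j < s \<and> i < k \<and> a j i \<in> X}) \<le> predim M X"
    and y: "\<And>i. i < k \<Longrightarrow> y i \<in> B"
      "\<And>X. X \<subseteq> B \<Longrightarrow> int (card {i. i < k \<and> y i \<in> X}) \<le> predim M X"
  shows "\<exists>c g. c \<in> univ M - E \<and> (\<forall>j<s. embedding (induced M B) M (g j) \<and> selfsuff M (g j ` B) \<and>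
    (\<forall>i<k. [a j i, c, g j (y i)] \<in> interp M R))"
proof -
  have EM: "E \<subseteq> univ M" using E by (simp add: selfsuff_iff)
  interpret glueing ar f M R E B s k a y
    by unfold_locales
      (use slow generic_structure_over[OF M] ar R E B EM a y generic_predim_ge[OF M]
        generic_predim_pos[OF M _ _ ar] in auto)
  have "selfsuff_embedding (induced M E) G base_pt"
    using embedding_base selfsuff_base by (simp add: selfsuff_embedding_def)
  from generic_extend[OF M E glue_in_Kf this] obtain \<beta> where
    \<beta>: "selfsuff_embedding G M \<beta>" "\<forall>e\<in>E. \<beta> (base_pt e) = e" by blast
  have emb: "embedding G M \<beta>" using \<beta>(1) by (simp add: selfsuff_embedding_def)
  have inj: "inj_on \<beta> (univ G)" and im: "\<beta> ` univ G \<subseteq> univ M" using emb by (auto simp: embedding_def)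
  note hub = in_univ_glue(2)
  have "\<beta> hub \<in> univ M - E"
  proof
    show "\<beta> hub \<in> univ M" using im hub by blast
    show "\<beta> hub \<notin> E"
    proof
      assume e: "\<beta> hub \<in> E"
      then have "\<beta> (base_pt (\<beta> hub)) = \<beta> hub" using \<beta>(2) by blast
      moreover have "base_pt (\<beta> hub) \<in> univ G" using e by (rule in_univ_glue)
      ultimately have "base_pt (\<beta> hub) = hub" using inj hub by (meson inj_onD)
      then show False by (simp add: pt_defs)
    qed
  qed
  moreover have "embedding (induced M B) M (\<beta> \<circ> copy_pt j)" if "j < s" for j
    by (rule embedding_comp[OF embedding_copy[OF that] emb])
  moreover have "selfsuff M ((\<beta> \<circ> copy_pt j) ` B)" if "j < s" for j
    using selfsuff_image[OF \<beta>(1) selfsuff_copy[OF that]] by (simp add: image_comp)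
  moreover have "[a j i, \<beta> hub, (\<beta> \<circ> copy_pt j) (y i)] \<in> interp M R" if ji: "j < s" "i < k" for j i
  proof -
    let ?t = "[base_pt (a j i), hub, copy_pt j (y i)]"
    have "?t \<in> interp G R" using ji by (auto simp: glue_def)
    moreover have "?t \<in> lists (univ G)" using ji a(1) y(1) by (simp add: in_univ_glue)
    ultimately have "map \<beta> ?t \<in> interp M R" using emb by (simp add: embedding_def)
    then show ?thesis using \<beta>(2) a(1)[OF ji] by simp
  qed
  ultimately show ?thesis by (intro exI[of _ "\<beta> hub"] exI[of _ "\<lambda>j. \<beta> \<circ> copy_pt j"]) blast
qed

section \<open>Counting in finite structures\<close>

text \<open>The part of the relation between size and predimension in \<open>M\<close> that a single sentence expresses. The union of two
sets of size at most \<open>n\<close> is covered by the condition, so that the bound \<open>n\<close> is restored whenever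
submodularity keeps the predimension of the union below \<open>K\<close>.\<close>

definition tame :: "nat \<Rightarrow> int \<Rightarrow> ('r::finite, 'b) struc \<Rightarrow> bool" where
  "tame n K N \<longleftrightarrow> (\<forall>Y. finite Y \<and> Y \<subseteq> univ N \<and> card Y \<le> 2 * n \<longrightarrow>
     0 \<le> predim N Y \<and> (predim N Y \<le> K \<longrightarrow> card Y \<le> n))"

definition low_tuples :: "nat \<Rightarrow> ('r::finite, 'b) struc \<Rightarrow> nat \<Rightarrow> int \<Rightarrow> 'b list set" where
  "low_tuples n N m k = {as. length as = m \<and> set as \<subseteq> univ N \<and>
     (\<exists>Y. set as \<subseteq> Y \<and> Y \<subseteq> univ N \<and> card Y \<le> n \<and> predim N Y \<le> k)}"

text \<open>If \<open>A\<close> has dimension at least \<open>k\<close>, then the sets of predimension at most \<open>k\<close> around \<open>A\<close> are closed under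
unions by submodularity, so that a maximal one, the closure of \<open>A\<close>, contains all of them.\<close>

lemma low_sets_bounded:
  assumes N: "finite_structure ar N" and tame: "tame n K N" and k: "k \<le> K"
    and A: "\<nexists>Y. A \<subseteq> Y \<and> Y \<subseteq> univ N \<and> card Y \<le> n \<and> predim N Y \<le> k - 1"
  shows "\<exists>W. finite W \<and> card W \<le> n \<and> (\<forall>Y. A \<subseteq> Y \<and> Y \<subseteq> univ N \<and> card Y \<le> n \<and> predim N Y \<le> k \<longrightarrow> Y \<subseteq> W)"
proof -
  let ?S = "{Y. A \<subseteq> Y \<and> Y \<subseteq> univ N \<and> card Y \<le> n \<and> predim N Y \<le> k}"
  have fin: "finite (univ N)" and str: "structure_over ar N"
    using N by (auto simp: finite_structure_def)
  have finS: "finite ?S" by (rule finite_subset[of _ "Pow (univ N)"]) (use fin in auto)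
  show ?thesis
  proof (cases "?S = {}")
    case True
    then show ?thesis by (intro exI[of _ "{}"]) auto
  next
    case False
    from finite_has_maximal[OF finS False] obtain W where
      W: "W \<in> ?S" and max: "\<forall>Y\<in>?S. W \<subseteq> Y \<longrightarrow> W = Y" by (elim bexE)
    have finW: "finite W" using W fin finite_subset by blast
    have "Y \<subseteq> W" if Y: "Y \<in> ?S" for Y
    proof -
      have finY: "finite Y" using Y fin finite_subset by blast
      have "card (W \<inter> Y) \<le> card W" by (rule card_mono[OF finW]) simp
      then have "A \<subseteq> W \<inter> Y \<and> W \<inter> Y \<subseteq> univ N \<and> card (W \<inter> Y) \<le> n" using W Y by auto
      then have "k \<le> predim N (W \<inter> Y)" using A by force
      then have le: "predim N (W \<union> Y) \<le> k"
        using predim_submodular[OF str finW finY] W Y by auto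
      have "card (W \<union> Y) \<le> card W + card Y" by (rule card_Un_le)
      then have "card (W \<union> Y) \<le> 2 * n" using W Y by simp
      moreover have "finite (W \<union> Y)" "W \<union> Y \<subseteq> univ N" using finW finY W Y by auto
      ultimately have "card (W \<union> Y) \<le> n" using tame le k unfolding tame_def by fastforce
      then have "W \<union> Y \<in> ?S" using W Y le by auto
      with max have "W \<subseteq> W \<union> Y \<longrightarrow> W = W \<union> Y" by (rule bspec)
      then have "W = W \<union> Y" by simp
      then show ?thesis by blast
    qed
    then show ?thesis using W finW by (intro exI[of _ W]) auto
  qed
qed

lemma finite_low_tuples:
  assumes "finite (univ N)"
  shows "finite (low_tuples n N m k)"
  by (rule finite_subset[OF _ finite_lists_length_eq[OF assms, of m]]) (auto simp: low_tuples_def)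

text \<open>Removing the last entry \<open>b\<close>, the remaining tuple \<open>as\<close> has dimension at most \<open>k - 1\<close>, and \<open>b\<close> is arbitrary,
or it has dimension \<open>k\<close>, and \<open>b\<close> is one of the at most \<open>n\<close> points of its closure.\<close>

lemma card_low_tuples:
  assumes N: "finite_structure ar N" and tame: "tame n K N" and ne: "univ N \<noteq> {}"
    and k: "int k \<le> K"
  shows "card (low_tuples n N m (int k)) \<le> (n + 1) ^ m * card (univ N) ^ k"
  using k
proof (induction m arbitrary: k)
  case 0
  have fin: "finite (univ N)" using N by (simp add: finite_structure_def)
  have "low_tuples n N 0 (int k) \<subseteq> {[]}" by (auto simp: low_tuples_def)
  from card_mono[OF _ this] have "card (low_tuples n N 0 (int k)) \<le> 1" by simp
  also have "\<dots> \<le> card (univ N) ^ k" using ne fin by (simp add: Suc_le_eq card_gt_0_iff)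
  finally show ?case by simp
next
  case (Suc m)
  let ?L = "low_tuples n N" and ?q = "card (univ N)" and ?app = "\<lambda>(as, b). as @ [b]"
  have fin: "finite (univ N)" using N by (simp add: finite_structure_def)
  define D where "D as = {b. \<exists>Y. set as \<subseteq> Y \<and> b \<in> Y \<and> Y \<subseteq> univ N \<and> card Y \<le> n \<and> predim N Y \<le> int k}" for as
  have D: "finite (D as) \<and> card (D as) \<le> n" if as: "as \<notin> ?L m (int k - 1)" "as \<in> ?L m (int k)" for as
  proof -
    have "\<nexists>Y. set as \<subseteq> Y \<and> Y \<subseteq> univ N \<and> card Y \<le> n \<and> predim N Y \<le> int k - 1"
      using as by (auto simp: low_tuples_def)
    from low_sets_bounded[OF N tame Suc.prems this] obtain W where
      W: "finite W" "card W \<le> n"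
        "\<forall>Y. set as \<subseteq> Y \<and> Y \<subseteq> univ N \<and> card Y \<le> n \<and> predim N Y \<le> int k \<longrightarrow> Y \<subseteq> W" by blast
    then have "D as \<subseteq> W" unfolding D_def by blast
    then show ?thesis using W card_mono finite_subset by (metis order_trans)
  qed
  let ?A = "?app ` (?L m (int k - 1) \<times> univ N)"
  let ?B = "?app ` (SIGMA as:?L m (int k) - ?L m (int k - 1). D as)"
  have "?L (Suc m) (int k) \<subseteq> ?A \<union> ?B"
  proof
    fix cs assume cs: "cs \<in> ?L (Suc m) (int k)"
    then obtain Y where Y: "set cs \<subseteq> Y" "Y \<subseteq> univ N" "card Y \<le> n" "predim N Y \<le> int k"
      and len: "length cs = Suc m" by (auto simp: low_tuples_def)
    obtain as b where ab: "cs = as @ [b]" using len by (cases cs rule: rev_cases) auto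
    have as: "as \<in> ?L m (int k)" using Y len ab by (auto simp: low_tuples_def)
    have b: "b \<in> D as" "b \<in> univ N" using Y ab by (auto simp: D_def)
    show "cs \<in> ?A \<union> ?B"
    proof (cases "as \<in> ?L m (int k - 1)")
      case True
      then have "(as, b) \<in> ?L m (int k - 1) \<times> univ N" using b by simp
      then show ?thesis unfolding ab by force
    next
      case False
      then have "(as, b) \<in> (SIGMA as:?L m (int k) - ?L m (int k - 1). D as)" using as b by simp
      then show ?thesis unfolding ab by force
    qed
  qed
  moreover have finB: "finite (SIGMA as:?L m (int k) - ?L m (int k - 1). D as)"
    using D finite_low_tuples[OF fin] by (intro finite_SigmaI) auto
  moreover have finA: "finite (?L m (int k - 1) \<times> univ N)" using finite_low_tuples[OF fin] fin by blast
  ultimately have "card (?L (Suc m) (int k)) \<le> card (?A \<union> ?B)" by (intro card_mono) auto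
  also have "\<dots> \<le> card ?A + card ?B" by (rule card_Un_le)
  also have "card ?A \<le> (n + 1) ^ m * ?q ^ k"
  proof -
    have "card ?A \<le> card (?L m (int k - 1)) * ?q"
      using card_image_le[OF finA, of ?app] by (simp add: card_cartesian_product)
    also have "\<dots> \<le> (n + 1) ^ m * ?q ^ k"
    proof (cases k)
      case 0
      have "?L m (int k - 1) = {}"
      proof (rule ccontr)
        assume "?L m (int k - 1) \<noteq> {}"
        then obtain Y where Y: "Y \<subseteq> univ N" "card Y \<le> n" "predim N Y \<le> - 1"
          using 0 by (auto simp: low_tuples_def)
        then have "finite Y" "card Y \<le> 2 * n" using fin finite_subset by auto
        then have "0 \<le> predim N Y" using tame Y(1) by (auto simp: tame_def)
        then show False using Y by simp
      qed
      then show ?thesis by simp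
    next
      case (Suc k')
      have "card (?L m (int k')) \<le> (n + 1) ^ m * ?q ^ k'"
        by (rule Suc.IH) (use Suc.prems Suc in auto)
      then show ?thesis using Suc by (simp add: algebra_simps)
    qed
    finally show ?thesis .
  qed
  also have "card ?B \<le> n * ((n + 1) ^ m * ?q ^ k)"
  proof -
    have "card ?B \<le> card (SIGMA as:?L m (int k) - ?L m (int k - 1). D as)"
      by (rule card_image_le[OF finB])
    also have "\<dots> = (\<Sum>as\<in>?L m (int k) - ?L m (int k - 1). card (D as))"
      using D finite_low_tuples[OF fin] by (intro card_SigmaI) auto
    also have "\<dots> \<le> card (?L m (int k) - ?L m (int k - 1)) * n"
      using sum_bounded_above[of "?L m (int k) - ?L m (int k - 1)" "\<lambda>as. card (D as)" n] D by auto
    also have "\<dots> \<le> card (?L m (int k)) * n"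
      by (intro mult_right_mono card_mono finite_low_tuples[OF fin]) auto
    also have "\<dots> \<le> ((n + 1) ^ m * ?q ^ k) * n"
      by (intro mult_right_mono Suc.IH Suc.prems) simp
    finally show ?thesis by (simp add: mult.commute)
  qed
  finally show ?case by (simp add: algebra_simps)
qed

text \<open>Adding to \<open>{c, d}\<close> points related to them does not raise the predimension above \<open>2\<close>, so that only boundedly many
such points exist.\<close>

lemma card_ternary_fibre:
  assumes N: "finite_structure ar N" and tame: "tame n K N" and "2 \<le> K" "3 \<le> n"
    and cd: "c \<in> univ N" "d \<in> univ N"
  shows "card {b \<in> univ N. [b, c, d] \<in> interp N R} \<le> n"
proof (rule ccontr)
  assume "\<not> ?thesis"
  then have "Suc n \<le> card {b \<in> univ N. [b, c, d] \<in> interp N R}" by simp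
  then obtain V where V: "V \<subseteq> {b \<in> univ N. [b, c, d] \<in> interp N R}" "card V = Suc n"
    by (meson obtain_subset_with_card_n)
  have str: "structure_over ar N" and fin: "finite (univ N)" using N by (auto simp: finite_structure_def)
  define Y where "Y = V \<union> {c, d}"
  have "finite V" by (rule card_ge_0_finite) (simp add: V(2))
  then have Y: "Y \<subseteq> univ N" "finite Y" using V cd by (auto simp: Y_def)
  have "card Y \<le> card V + card {c, d}" unfolding Y_def by (rule card_Un_le)
  also have "card {c, d} \<le> 2" by (simp add: card_insert_if)
  finally have cY: "card Y \<le> n + 3" using V by simp
  have "card V = card ((\<lambda>b. [b, c, d]) ` V)" by (rule card_image[symmetric]) (auto simp: inj_on_def)
  also have "\<dots> \<le> card (rels_within N R Y)"
    by (rule card_mono[OF finite_rels_within[OF str Y(2)]]) (use V in \<open>auto simp: rels_within_def Y_def\<close>)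
  also have "\<dots> \<le> (\<Sum>r\<in>UNIV. card (rels_within N r Y))" by (rule member_le_sum) auto
  finally have "int (Suc n) \<le> (\<Sum>r\<in>UNIV. int (card (rels_within N r Y)))"
    unfolding V(2) of_nat_sum[symmetric] of_nat_le_iff .
  then have "predim N Y \<le> 2" using cY by (simp add: predim_eq)
  then have "card Y \<le> n" using tame Y cY assms(3,4) unfolding tame_def by fastforce
  moreover have "card V \<le> card Y" using Y(2) by (intro card_mono) (auto simp: Y_def)
  ultimately show False using V by simp
qed

lemma card_lists_choice:
  assumes "\<And>i. i < m \<Longrightarrow> finite (S i) \<and> card (S i) \<le> n"
  shows "finite {as. length as = m \<and> (\<forall>i<m. as ! i \<in> S i)}"
    and "card {as. length as = m \<and> (\<forall>i<m. as ! i \<in> S i)} \<le> n ^ m"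
proof -
  let ?P = "PiE {..<m} S"
  have fin: "finite ?P" using assms by (intro finite_PiE) auto
  have sub: "{as. length as = m \<and> (\<forall>i<m. as ! i \<in> S i)} \<subseteq> (\<lambda>h. map h [0..<m]) ` ?P"
  proof
    fix as assume "as \<in> {as. length as = m \<and> (\<forall>i<m. as ! i \<in> S i)}"
    then have as: "length as = m" "\<forall>i<m. as ! i \<in> S i" by auto
    have "as = map (restrict (\<lambda>i. as ! i) {..<m}) [0..<m]"
      using as(1) by (intro nth_equalityI) auto
    moreover have "restrict (\<lambda>i. as ! i) {..<m} \<in> ?P" using as by auto
    ultimately show "as \<in> (\<lambda>h. map h [0..<m]) ` ?P" by (rule image_eqI)
  qed
  show "finite {as. length as = m \<and> (\<forall>i<m. as ! i \<in> S i)}"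
    by (rule finite_subset[OF sub]) (use fin in simp)
  have "card {as. length as = m \<and> (\<forall>i<m. as ! i \<in> S i)} \<le> card ((\<lambda>h. map h [0..<m]) ` ?P)"
    by (rule card_mono[OF _ sub]) (use fin in simp)
  also have "\<dots> \<le> card ?P" by (rule card_image_le[OF fin])
  also have "\<dots> = (\<Prod>i<m. card (S i))" by (simp add: card_PiE)
  also have "\<dots> \<le> (\<Prod>i<m. n)" by (rule prod_mono) (use assms in auto)
  finally show "card {as. length as = m \<and> (\<forall>i<m. as ! i \<in> S i)} \<le> n ^ m" by simp
qed

text \<open>A tuple in \<open>I\<close> is determined, up to \<open>n\<close> possibilities for each entry, by its hub and its \<open>s\<close> elements
of \<open>S\<close>. The entries are indexed by \<open>l = j * k + i\<close>.\<close>

lemma card_configurations: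
  assumes N: "finite_structure ar N" and tame: "tame n K N" and K: "2 \<le> K" "3 \<le> n"
    and S: "finite S" "\<And>bs. bs \<in> S \<Longrightarrow> set bs \<subseteq> univ N" "\<And>bs i. bs \<in> S \<Longrightarrow> i < k \<Longrightarrow> \<iota> i < length bs"
    and I: "\<And>as. as \<in> I \<Longrightarrow> length as = s * k \<and> set as \<subseteq> univ N \<and> (\<exists>c\<in>univ N. \<forall>j<s. \<exists>bs\<in>S. \<forall>i<k.
        [as ! (j * k + i), c, bs ! \<iota> i] \<in> interp N R)"
  shows "card I \<le> card (univ N) * card S ^ s * n ^ (s * k)"
proof -
  have fin: "finite (univ N)" using N by (simp add: finite_structure_def)
  let ?T = "{bl. set bl \<subseteq> S \<and> length bl = s}"
  define V where "V c d = {b \<in> univ N. [b, c, d] \<in> interp N R}" for c d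
  define Q where "Q = (\<lambda>(c, bl). {as. length as = s * k \<and>
    (\<forall>l<s * k. as ! l \<in> V c (bl ! (l div k) ! \<iota> (l mod k)))})"
  have finT: "finite ?T" by (rule finite_lists_length_eq[OF S(1)])
  have Q: "finite (Q (c, bl)) \<and> card (Q (c, bl)) \<le> n ^ (s * k)" if cbl: "(c, bl) \<in> univ N \<times> ?T" for c bl
  proof -
    have "finite (V c (bl ! (l div k) ! \<iota> (l mod k))) \<and> card (V c (bl ! (l div k) ! \<iota> (l mod k))) \<le> n"
      if l: "l < s * k" for l
    proof -
      have k: "0 < k" using l by (cases k) auto
      have "l div k < length bl" using l cbl by (simp add: less_mult_imp_div_less)
      then have bs: "bl ! (l div k) \<in> S" using cbl nth_mem by blast
      have "\<iota> (l mod k) < length (bl ! (l div k))" using S(3)[OF bs] k by simp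
      then have "bl ! (l div k) ! \<iota> (l mod k) \<in> univ N" using S(2)[OF bs] nth_mem by blast
      then show ?thesis
        using card_ternary_fibre[OF N tame K, of c _ R] cbl fin by (auto simp: V_def)
    qed
    from card_lists_choice[of "s * k" "\<lambda>l. V c (bl ! (l div k) ! \<iota> (l mod k))", OF this]
    show ?thesis by (auto simp: Q_def)
  qed
  have "I \<subseteq> (\<Union>x\<in>univ N \<times> ?T. Q x)"
  proof
    fix as assume "as \<in> I"
    from I[OF this] obtain c where as: "length as = s * k" "set as \<subseteq> univ N" "c \<in> univ N"
      "\<forall>j<s. \<exists>bs\<in>S. \<forall>i<k. [as ! (j * k + i), c, bs ! \<iota> i] \<in> interp N R" by blast
    from as(4) obtain h where h: "\<forall>j<s. h j \<in> S \<and> (\<forall>i<k. [as ! (j * k + i), c, h j ! \<iota> i] \<in> interp N R)"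
      by metis
    define bl where "bl = map h [0..<s]"
    have "as ! l \<in> V c (bl ! (l div k) ! \<iota> (l mod k))" if l: "l < s * k" for l
    proof -
      have k: "0 < k" using l by (cases k) auto
      have j: "l div k < s" using l by (simp add: less_mult_imp_div_less)
      have "[as ! (l div k * k + l mod k), c, h (l div k) ! \<iota> (l mod k)] \<in> interp N R"
        using h[rule_format, OF j] mod_less_divisor[OF k] by blast
      moreover have "as ! l \<in> univ N" using as(1,2) l nth_mem[of l as] by auto
      ultimately show ?thesis using j by (simp add: V_def bl_def)
    qed
    then have "as \<in> Q (c, bl)" using as by (simp add: Q_def)
    moreover have "(c, bl) \<in> univ N \<times> ?T" using as(3) h by (auto simp: bl_def)
    ultimately show "as \<in> (\<Union>x\<in>univ N \<times> ?T. Q x)" by blast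
  qed
  moreover have "finite (\<Union>x\<in>univ N \<times> ?T. Q x)" using fin finT Q by auto
  ultimately have "card I \<le> card (\<Union>x\<in>univ N \<times> ?T. Q x)" by (rule card_mono[rotated])
  also have "\<dots> \<le> (\<Sum>x\<in>univ N \<times> ?T. card (Q x))" by (rule card_UN_le) (use fin finT in simp)
  also have "\<dots> \<le> card (univ N \<times> ?T) * n ^ (s * k)"
    using sum_bounded_above[of "univ N \<times> ?T" "\<lambda>x. card (Q x)" "n ^ (s * k)"] Q by auto
  finally show ?thesis
    by (simp add: card_cartesian_product card_lists_length_eq[OF S(1)])
qed

section \<open>Dimension in the generic structure\<close>

text \<open>Predimensions in \<open>M\<close> are nonnegative, so the minimum over the integers exists.\<close>

lemma dim_set_props:
  assumes M: "generic ar f M" and ar: "\<forall>r. 0 < ar r" and X: "finite X" "X \<subseteq> univ M"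
  shows dim_set_attained: "\<exists>Y. X \<subseteq> Y \<and> Y \<subseteq> univ M \<and> finite Y \<and> dim_set M X = predim M Y"
    and dim_set_le: "\<And>Y. X \<subseteq> Y \<Longrightarrow> Y \<subseteq> univ M \<Longrightarrow> finite Y \<Longrightarrow> dim_set M X \<le> predim M Y"
proof -
  let ?P = "\<lambda>Y. X \<subseteq> Y \<and> Y \<subseteq> univ M \<and> finite Y"
  have nn: "0 \<le> predim M Y" if "?P Y" for Y using generic_predim_nonneg[OF M ar] that by blast
  have "?P X" using X by simp
  then obtain Y where Y: "?P Y" "\<forall>Y'. ?P Y' \<longrightarrow> nat (predim M Y) \<le> nat (predim M Y')"
    using ex_has_least_nat[of ?P X "\<lambda>Y. nat (predim M Y)"] by blast
  have least: "predim M Y \<le> predim M Y'" if "?P Y'" for Y'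
    using Y(2)[rule_format, OF that] nn[OF Y(1)] nn[OF that] by linarith
  have "dim_set M X = predim M Y"
    unfolding dim_set_def
  proof (rule Least_equality)
    show "\<exists>Y'. X \<subseteq> Y' \<and> Y' \<subseteq> univ M \<and> finite Y' \<and> predim M Y = predim M Y'" using Y(1) by blast
    show "predim M Y \<le> k" if "\<exists>Y'. X \<subseteq> Y' \<and> Y' \<subseteq> univ M \<and> finite Y' \<and> k = predim M Y'" for k
      using that least by blast
  qed
  then show "\<exists>Y. X \<subseteq> Y \<and> Y \<subseteq> univ M \<and> finite Y \<and> dim_set M X = predim M Y"
    and "\<And>Y. X \<subseteq> Y \<Longrightarrow> Y \<subseteq> univ M \<Longrightarrow> finite Y \<Longrightarrow> dim_set M X \<le> predim M Y"
    using Y(1) least by auto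
qed

lemma dim_formula_props:
  assumes M: "generic ar f M" and ar: "\<forall>r. 0 < ar r" and ne: "solutions M n \<Phi> \<noteq> {}"
  shows dim_formula_attained: "\<exists>bs\<in>solutions M n \<Phi>. dim_formula M n \<Phi> = dim_set M (set bs)"
    and dim_formula_ge: "\<And>bs. bs \<in> solutions M n \<Phi> \<Longrightarrow> dim_set M (set bs) \<le> dim_formula M n \<Phi>"
    and dim_formula_nonneg: "0 \<le> dim_formula M n \<Phi>"
proof -
  let ?d = "\<lambda>bs. dim_set M (set bs)"
  have sol: "finite (set bs)" "set bs \<subseteq> univ M" "length bs = n" if "bs \<in> solutions M n \<Phi>" for bs
    using that by (auto simp: solutions_def)
  have nn: "0 \<le> ?d bs" if "bs \<in> solutions M n \<Phi>" for bs
    using dim_set_attained[OF M ar sol(1,2)[OF that]] generic_predim_nonneg[OF M ar] by metis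
  have le: "nat (?d bs) < Suc n" if "bs \<in> solutions M n \<Phi>" for bs
  proof -
    have "?d bs \<le> predim M (set bs)" using dim_set_le[OF M ar sol(1,2)[OF that]] sol[OF that] by simp
    also have "\<dots> \<le> int (card (set bs))" by (rule predim_le_card)
    also have "card (set bs) \<le> n" using card_length[of bs] sol(3)[OF that] by simp
    finally show ?thesis by simp
  qed
  obtain bs0 where bs0: "bs0 \<in> solutions M n \<Phi>" using ne by blast
  obtain bs where bs: "bs \<in> solutions M n \<Phi>"
      "\<And>bs'. bs' \<in> solutions M n \<Phi> \<Longrightarrow> nat (?d bs') \<le> nat (?d bs)"
    using ex_has_greatest_nat[of "\<lambda>bs. bs \<in> solutions M n \<Phi>" bs0 "\<lambda>bs. nat (?d bs)" "Suc n", OF bs0]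
      le by (metis less_imp_le)
  have greatest: "?d bs' \<le> ?d bs" if "bs' \<in> solutions M n \<Phi>" for bs'
    using bs(2)[OF that] nn[OF that] nn[OF bs(1)] by linarith
  have "dim_formula M n \<Phi> = ?d bs"
    unfolding dim_formula_def
    by (rule Greatest_equality) (use bs(1) greatest in auto)
  then show "\<exists>bs\<in>solutions M n \<Phi>. dim_formula M n \<Phi> = ?d bs"
    and "\<And>bs. bs \<in> solutions M n \<Phi> \<Longrightarrow> ?d bs \<le> dim_formula M n \<Phi>"
    and "0 \<le> dim_formula M n \<Phi>"
    using bs(1) greatest nn[OF bs(1)] by auto
qed

text \<open>The dimension is the rank function of a matroid. For a maximal independent \<open>J\<close> every further point of
\<open>S\<close> lies with \<open>J\<close> in a set of predimension at most \<open>card J\<close>, and by submodularity the union of these sets still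
has predimension at most \<open>card J\<close>.\<close>

lemma dim_basis:
  assumes M: "generic ar f M" and ar: "\<forall>r. 0 < ar r" and S: "finite S" "S \<subseteq> univ M"
  shows "\<exists>J. J \<subseteq> S \<and> int (card J) = dim_set M S \<and>
    (\<forall>Y. J \<subseteq> Y \<and> Y \<subseteq> univ M \<and> finite Y \<longrightarrow> int (card J) \<le> predim M Y)"
proof -
  let ?ind = "\<lambda>J. \<forall>Y. J \<subseteq> Y \<and> Y \<subseteq> univ M \<and> finite Y \<longrightarrow> int (card J) \<le> predim M Y"
  let ?I = "{J. J \<subseteq> S \<and> ?ind J}"
  have "finite ?I" by (rule finite_subset[of _ "Pow S"]) (use S in auto)
  moreover have "{} \<in> ?I" using generic_predim_nonneg[OF M ar] by simp
  ultimately have "\<exists>J\<in>?I. \<forall>J'\<in>?I. J \<subseteq> J' \<longrightarrow> J = J'" by (intro finite_has_maximal) auto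
  then obtain J where J: "J \<in> ?I" and max: "\<forall>J'\<in>?I. J \<subseteq> J' \<longrightarrow> J = J'" by (elim bexE)
  have JS: "J \<subseteq> S" "finite J" using J S finite_subset by auto
  have ex: "\<exists>W. J \<subseteq> W \<and> T \<subseteq> W \<and> W \<subseteq> univ M \<and> finite W \<and> predim M W \<le> int (card J)"
    if T: "finite T" "T \<subseteq> S" for T
    using T
  proof (induction T)
    case empty
    show ?case using JS S predim_le_card by (intro exI[of _ J]) auto
  next
    case (insert t T)
    then obtain W where W: "J \<subseteq> W" "T \<subseteq> W" "W \<subseteq> univ M" "finite W" "predim M W \<le> int (card J)"
      by blast
    show ?case
    proof (cases "t \<in> J")
      case True
      then show ?thesis using W by (intro exI[of _ W]) auto
    next
      case False
      then have "insert t J \<notin> ?I" using max by blast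
      then have "\<not> ?ind (insert t J)" using JS insert.prems by blast
      then obtain Y where Y: "insert t J \<subseteq> Y" "Y \<subseteq> univ M" "finite Y" "\<not> int (card (insert t J)) \<le> predim M Y"
        by blast
      have "predim M Y \<le> int (card J)" using Y(4) False JS by simp
      moreover have "int (card J) \<le> predim M (W \<inter> Y)"
      proof -
        have "J \<subseteq> W \<inter> Y" "W \<inter> Y \<subseteq> univ M" "finite (W \<inter> Y)" using W Y by auto
        then show ?thesis using J by blast
      qed
      moreover have "predim M (W \<union> Y) + predim M (W \<inter> Y) \<le> predim M W + predim M Y"
        by (rule predim_submodular[OF generic_structure_over[OF M] W(4) Y(3)])
      ultimately have "predim M (W \<union> Y) \<le> int (card J)" using W(5) by linarith
      then show ?thesis using W Y by (intro exI[of _ "W \<union> Y"]) auto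
    qed
  qed
  from ex[OF S(1)] obtain W where "S \<subseteq> W" "W \<subseteq> univ M" "finite W" "predim M W \<le> int (card J)" by blast
  then have "dim_set M S \<le> int (card J)" using dim_set_le[OF M ar S] by (meson order_trans)
  moreover have "int (card J) \<le> dim_set M S"
  proof -
    obtain Y where Y: "S \<subseteq> Y" "Y \<subseteq> univ M" "finite Y" "dim_set M S = predim M Y"
      using dim_set_attained[OF M ar S] by blast
    have "J \<subseteq> Y \<and> Y \<subseteq> univ M \<and> finite Y" using JS(1) Y by blast
    then show ?thesis using J Y(4) by simp
  qed
  ultimately show ?thesis using J by (intro exI[of _ J]) simp
qed

text \<open>Adding the missing members of the family to \<open>X\<close> raises its predimension to at least \<open>card I\<close>, at
the price of at most \<open>1\<close> for each.\<close>

lemma independent_count: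
  assumes str: "structure_over ar M" and I: "finite I" "h ` I \<subseteq> univ M"
    and ind: "\<And>Y. h ` I \<subseteq> Y \<Longrightarrow> Y \<subseteq> univ M \<Longrightarrow> finite Y \<Longrightarrow> int (card I) \<le> predim M Y"
    and X: "finite X" "X \<subseteq> univ M"
  shows "int (card {i \<in> I. h i \<in> X}) \<le> predim M X"
proof -
  let ?J = "{i \<in> I. h i \<notin> X}"
  have "int (card I) \<le> predim M (X \<union> h ` ?J)" by (rule ind) (use I X in auto)
  also have "\<dots> \<le> predim M X + int (card (h ` ?J))" by (rule predim_Un_le[OF str X(1)]) (use I in simp)
  also have "card (h ` ?J) \<le> card ?J" using I(1) by (intro card_image_le) simp
  finally have "int (card I) \<le> predim M X + int (card ?J)" by simp
  moreover have "card I = card {i \<in> I. h i \<in> X} + card ?J"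
    using I(1) by (subst card_Un_disjoint[symmetric]) (auto intro: arg_cong[where f = card])
  ultimately show ?thesis by simp
qed

section \<open>The sentences that are transferred\<close>

lemma sat_low_exs:
  fixes ar :: "'r::finite \<Rightarrow> nat"
  assumes N: "structure_over ar N" and ne: "univ N \<noteq> {}" and V0: "finite V0" "V0 \<inter> {p..<p + m} = {}"
    "v ` V0 \<subseteq> univ N"
  shows "sat N v (exs [p..<p + m] (low_fm ar V0 (V0 \<union> {p..<p + m}) l k)) \<longleftrightarrow>
    (\<exists>Y. v ` V0 \<subseteq> Y \<and> Y \<subseteq> univ N \<and> finite Y \<and> card (Y - v ` V0) \<le> m \<and> l \<le> card Y \<and> predim N Y \<le> k)"
    (is "?l \<longleftrightarrow> ?r")
proof -
  have notin: "x \<notin> {p..<p + m}" if "x \<in> V0" for x using V0(2) that by blast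
  have fin: "finite (V0 \<union> {p..<p + m})" "V0 \<subseteq> V0 \<union> {p..<p + m}" using V0 by auto
  have "?l \<longleftrightarrow> (\<exists>w. (\<forall>x\<in>{p..<p + m}. w x \<in> univ N) \<and> (\<forall>x. x \<notin> {p..<p + m} \<longrightarrow> w x = v x) \<and>
    (\<exists>Y. w ` V0 \<subseteq> Y \<and> Y \<subseteq> w ` (V0 \<union> {p..<p + m}) \<and> l \<le> card Y \<and> predim N Y \<le> k))"
    unfolding sat_exs sat_low_fm[OF N fin] set_upt ..
  also have "\<dots> \<longleftrightarrow> ?r"
  proof
    assume "\<exists>w. (\<forall>x\<in>{p..<p + m}. w x \<in> univ N) \<and> (\<forall>x. x \<notin> {p..<p + m} \<longrightarrow> w x = v x) \<and>
      (\<exists>Y. w ` V0 \<subseteq> Y \<and> Y \<subseteq> w ` (V0 \<union> {p..<p + m}) \<and> l \<le> card Y \<and> predim N Y \<le> k)"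
    then obtain w Y where w: "\<forall>x\<in>{p..<p + m}. w x \<in> univ N" "\<forall>x. x \<notin> {p..<p + m} \<longrightarrow> w x = v x"
      and Y: "w ` V0 \<subseteq> Y" "Y \<subseteq> w ` (V0 \<union> {p..<p + m})" "l \<le> card Y" "predim N Y \<le> k" by blast
    have wV0: "w ` V0 = v ` V0" by (intro image_cong refl w(2)[rule_format] notin)
    have sub: "Y \<subseteq> v ` V0 \<union> w ` {p..<p + m}" using Y(2) wV0 by (simp add: image_Un)
    then have "Y \<subseteq> univ N" using V0(3) w(1) by blast
    moreover have "finite Y" using finite_subset[OF sub] V0(1) by simp
    moreover have "card (Y - v ` V0) \<le> m"
    proof -
      have "card (Y - v ` V0) \<le> card (w ` {p..<p + m})" by (rule card_mono) (use sub in auto)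
      also have "\<dots> \<le> card {p..<p + m}" by (rule card_image_le) simp
      finally show ?thesis by simp
    qed
    ultimately show ?r using Y wV0 by (intro exI[of _ Y]) simp
  next
    assume ?r
    then obtain Y where Y: "v ` V0 \<subseteq> Y" "Y \<subseteq> univ N" "finite Y" "card (Y - v ` V0) \<le> m"
      "l \<le> card Y" "predim N Y \<le> k" by blast
    obtain u where u: "u \<in> univ N" using ne by blast
    have "finite (Y - v ` V0)" using Y(3) by simp
    from ex_bij_betw_nat_finite[OF this] obtain h where
      h: "bij_betw h {0..<card (Y - v ` V0)} (Y - v ` V0)" by blast
    define w where "w x = (if x \<in> {p..<p + m} then if x - p < card (Y - v ` V0) then h (x - p) else u else v x)" for x
    have hY: "h i \<in> Y - v ` V0" if "i < card (Y - v ` V0)" for i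
      using bij_betwE[OF h] that by simp
    have "w x \<in> univ N" if "x \<in> {p..<p + m}" for x using that hY Y(2) u by (auto simp: w_def)
    moreover have "w x = v x" if "x \<notin> {p..<p + m}" for x using that by (simp only: w_def if_False)
    moreover have wV0: "w ` V0 = v ` V0"
      by (intro image_cong refl) (use notin in \<open>simp only: w_def if_False\<close>)
    moreover have "Y \<subseteq> w ` (V0 \<union> {p..<p + m})"
    proof
      fix b assume b: "b \<in> Y"
      show "b \<in> w ` (V0 \<union> {p..<p + m})"
      proof (cases "b \<in> v ` V0")
        case True
        then show ?thesis unfolding image_Un wV0 by simp
      next
        case False
        then have "b \<in> h ` {0..<card (Y - v ` V0)}" using b h by (simp add: bij_betw_def)
        then obtain i where i: "i < card (Y - v ` V0)" "b = h i" by auto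
        then have "w (p + i) = b" "p + i \<in> {p..<p + m}" using Y(4) by (auto simp: w_def)
        then show ?thesis by blast
      qed
    qed
    ultimately show "\<exists>w. (\<forall>x\<in>{p..<p + m}. w x \<in> univ N) \<and> (\<forall>x. x \<notin> {p..<p + m} \<longrightarrow> w x = v x) \<and>
      (\<exists>Y. w ` V0 \<subseteq> Y \<and> Y \<subseteq> w ` (V0 \<union> {p..<p + m}) \<and> l \<le> card Y \<and> predim N Y \<le> k)"
      using Y by (intro exI[of _ w] conjI exI[of _ Y]) auto
  qed
  finally show ?thesis .
qed

definition small_low :: "('r::finite \<Rightarrow> nat) \<Rightarrow> nat \<Rightarrow> nat \<Rightarrow> int \<Rightarrow> 'r formula" where
  "small_low ar m l k = exs [0..<0 + m] (low_fm ar {} ({} \<union> {0..<0 + m}) l k)"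

lemma formula_in_small_low: "formula_in ar 0 (small_low ar m l k)"
  using free_vars_low_fm[of "{0..<m}" "{}" ar l k] well_formed_low_fm[of "{0..<m}" "{}" ar l k]
  by (auto simp: formula_in_def small_low_def)

lemma sat_small_low:
  assumes "structure_over ar N" "univ N \<noteq> {}"
  shows "sat N v (small_low ar m l k) \<longleftrightarrow>
    (\<exists>Y. Y \<subseteq> univ N \<and> finite Y \<and> card Y \<le> m \<and> l \<le> card Y \<and> predim N Y \<le> k)"
  unfolding small_low_def using sat_low_exs[OF assms, of "{}" 0 m v l k] by simp

lemma sat_solutions:
  assumes "formula_in ar n \<Phi>"
  shows "map w [0..<n] \<in> solutions N n \<Phi> \<longleftrightarrow> (\<forall>i<n. w i \<in> univ N) \<and> sat N w \<Phi>"
proof -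
  have "sat N (\<lambda>i. map w [0..<n] ! i) \<Phi> \<longleftrightarrow> sat N w \<Phi>"
    by (rule sat_cong) (use assms in \<open>auto simp: formula_in_def\<close>)
  then show ?thesis by (auto simp: solutions_def)
qed

lemma sat_exs_solutions:
  assumes \<Phi>: "formula_in ar n \<Phi>"
    and P: "\<And>w. (\<forall>x. n \<le> x \<longrightarrow> w x = v x) \<Longrightarrow> (\<forall>i<n. w i \<in> univ N) \<Longrightarrow> sat N w \<psi> \<longleftrightarrow> P (map w [0..<n])"
  shows "sat N v (exs [0..<n] (Conj \<Phi> \<psi>)) \<longleftrightarrow> (\<exists>bs\<in>solutions N n \<Phi>. P bs)"
proof
  assume "sat N v (exs [0..<n] (Conj \<Phi> \<psi>))"
  then obtain w where w: "\<forall>x\<in>{0..<n}. w x \<in> univ N" "\<forall>x. x \<notin> {0..<n} \<longrightarrow> w x = v x"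
    "sat N w \<Phi>" "sat N w \<psi>" unfolding sat_exs by auto
  then have "map w [0..<n] \<in> solutions N n \<Phi>" by (simp add: sat_solutions[OF \<Phi>])
  moreover have "P (map w [0..<n])" using P[of w] w by simp
  ultimately show "\<exists>bs\<in>solutions N n \<Phi>. P bs" by blast
next
  assume "\<exists>bs\<in>solutions N n \<Phi>. P bs"
  then obtain bs where bs: "bs \<in> solutions N n \<Phi>" "P bs" by blast
  define w where "w x = (if x < n then bs ! x else v x)" for x
  have bs_w: "map w [0..<n] = bs" using bs(1) by (auto simp: w_def solutions_def intro: nth_equalityI)
  then have "(\<forall>i<n. w i \<in> univ N) \<and> sat N w \<Phi>" using bs(1) sat_solutions[OF \<Phi>, of w N] by simp
  moreover from this have "sat N w \<psi>" using P[of w] bs(2) bs_w by (simp add: w_def)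
  ultimately show "sat N v (exs [0..<n] (Conj \<Phi> \<psi>))"
    unfolding sat_exs by (intro exI[of _ w]) (simp add: w_def)
qed

definition low_over :: "('r::finite, 'a) struc \<Rightarrow> 'a set \<Rightarrow> nat \<Rightarrow> int \<Rightarrow> bool" where
  "low_over N A m k \<longleftrightarrow> (\<exists>Y. A \<subseteq> Y \<and> Y \<subseteq> univ N \<and> finite Y \<and> card (Y - A) \<le> m \<and> predim N Y \<le> k)"

definition low_solutions :: "('r::finite \<Rightarrow> nat) \<Rightarrow> nat \<Rightarrow> 'r formula \<Rightarrow> nat \<Rightarrow> int \<Rightarrow> 'r formula" where
  "low_solutions ar n \<Phi> m k = Neg (exs [0..<n] (Conj \<Phi> (Neg
     (exs [n..<n + m] (low_fm ar {0..<n} ({0..<n} \<union> {n..<n + m}) 0 k)))))"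

lemma formula_in_low_solutions:
  assumes "formula_in ar n \<Phi>"
  shows "formula_in ar 0 (low_solutions ar n \<Phi> m k)"
  using assms free_vars_low_fm[of "{0..<n} \<union> {n..<n + m}" "{0..<n}" ar 0 k]
    well_formed_low_fm[of "{0..<n} \<union> {n..<n + m}" "{0..<n}" ar 0 k]
  by (auto simp: formula_in_def low_solutions_def)

lemma sat_low_solutions:
  assumes N: "structure_over ar N" "univ N \<noteq> {}" and \<Phi>: "formula_in ar n \<Phi>"
  shows "sat N v (low_solutions ar n \<Phi> m k) \<longleftrightarrow> (\<forall>bs\<in>solutions N n \<Phi>. low_over N (set bs) m k)"
proof -
  have "sat N v (exs [0..<n] (Conj \<Phi> (Neg (exs [n..<n + m] (low_fm ar {0..<n} ({0..<n} \<union> {n..<n + m}) 0 k)))))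
    \<longleftrightarrow> (\<exists>bs\<in>solutions N n \<Phi>. \<not> low_over N (set bs) m k)"
  proof (rule sat_exs_solutions[OF \<Phi>])
    fix w assume "\<forall>i<n. w i \<in> univ N"
    then have "w ` {0..<n} \<subseteq> univ N" by auto
    from sat_low_exs[OF N _ _ this, of n m 0 k]
    show "sat N w (Neg (exs [n..<n + m] (low_fm ar {0..<n} ({0..<n} \<union> {n..<n + m}) 0 k))) \<longleftrightarrow>
      \<not> low_over N (set (map w [0..<n])) m k"
      by (simp add: low_over_def)
  qed
  then show ?thesis by (simp add: low_solutions_def)
qed

text \<open>The variables below \<open>n\<close> are reserved for the solution of \<open>\<Phi>\<close>, which is quantified anew for each \<open>j\<close>, so
that no variable of \<open>\<Phi>\<close> has to be renamed. The entries of the tuple \<open>as\<close> are the variables from \<open>n\<close> on, and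
the variable after them is the hub.\<close>

definition config_fm :: "'r \<Rightarrow> nat \<Rightarrow> 'r formula \<Rightarrow> nat \<Rightarrow> nat \<Rightarrow> (nat \<Rightarrow> nat) \<Rightarrow> 'r formula" where
  "config_fm R n \<Phi> s k \<iota> = Exi (n + s * k) (fconj ((\<lambda>j. exs [0..<n] (Conj \<Phi>
     (fconj ((\<lambda>i. Rel R [n + (j * k + i), n + s * k, \<iota> i]) ` {..<k})))) ` {..<s}))"

definition config_sentence :: "('r::finite \<Rightarrow> nat) \<Rightarrow> 'r \<Rightarrow> nat \<Rightarrow> 'r formula \<Rightarrow> nat \<Rightarrow> nat \<Rightarrow>
    (nat \<Rightarrow> nat) \<Rightarrow> nat \<Rightarrow> 'r formula" where
  "config_sentence ar R n \<Phi> s k \<iota> m = Neg (exs [n..<n + s * k] (Conj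
     (Neg (exs [n + s * k..<n + s * k + m] (low_fm ar {n..<n + s * k}
       ({n..<n + s * k} \<union> {n + s * k..<n + s * k + m}) 0 (int (s * k) - 1))))
     (Neg (config_fm R n \<Phi> s k \<iota>))))"

definition hub_config :: "('r, 'a) struc \<Rightarrow> 'r \<Rightarrow> 'a list set \<Rightarrow> nat \<Rightarrow> nat \<Rightarrow> (nat \<Rightarrow> nat) \<Rightarrow> 'a list \<Rightarrow> bool" where
  "hub_config N R S s k \<iota> as \<longleftrightarrow> (\<exists>c\<in>univ N. \<forall>j<s. \<exists>bs\<in>S. \<forall>i<k.
     [as ! (j * k + i), c, bs ! \<iota> i] \<in> interp N R)"

lemma index_less: "j < s \<Longrightarrow> i < k \<Longrightarrow> j * k + i < s * (k::nat)"
proof -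
  assume "j < s" "i < k"
  then have "j * k + i < Suc j * k" by simp
  also have "\<dots> \<le> s * k" using \<open>j < s\<close> by (intro mult_right_mono) auto
  finally show ?thesis .
qed

lemma formula_in_config_sentence:
  assumes \<Phi>: "formula_in ar n \<Phi>" and R: "ar R = 3" and \<iota>: "\<forall>i<k. \<iota> i < n"
  shows "formula_in ar 0 (config_sentence ar R n \<Phi> s k \<iota> m)"
proof -
  let ?V = "{n..<n + s * k} \<union> {n + s * k..<n + s * k + m}"
  have low: "free_vars (low_fm ar {n..<n + s * k} ?V 0 (int (s * k) - 1)) \<subseteq> ?V"
    "well_formed ar (low_fm ar {n..<n + s * k} ?V 0 (int (s * k) - 1))"
    by (rule free_vars_low_fm well_formed_low_fm; simp)+
  have free: "free_vars (config_fm R n \<Phi> s k \<iota>) \<subseteq> {n..<n + s * k}"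
  proof -
    have "free_vars (exs [0..<n] (Conj \<Phi>
        (fconj ((\<lambda>i. Rel R [n + (j * k + i), n + s * k, \<iota> i]) ` {..<k})))) \<subseteq> {n..<Suc (n + s * k)}"
      if j: "j < s" for j
    proof -
      have vars: "set [n + (j * k + i), n + s * k, \<iota> i] \<subseteq> {0..<n} \<union> {n..<Suc (n + s * k)}" if "i < k" for i
        using index_less[OF j that] \<iota>[rule_format, OF that] by simp
      have "free_vars (fconj ((\<lambda>i. Rel R [n + (j * k + i), n + s * k, \<iota> i]) ` {..<k})) \<subseteq>
          {0..<n} \<union> {n..<Suc (n + s * k)}"
        unfolding free_vars_fconj[OF finite_imageI[OF finite_lessThan]]
      proof (intro UN_least)
        fix \<psi> assume "\<psi> \<in> (\<lambda>i. Rel R [n + (j * k + i), n + s * k, \<iota> i]) ` {..<k}"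
        then obtain i where "i < k" "\<psi> = Rel R [n + (j * k + i), n + s * k, \<iota> i]" by blast
        then show "free_vars \<psi> \<subseteq> {0..<n} \<union> {n..<Suc (n + s * k)}"
          using vars[of i] by (simp only: free_vars.simps)
      qed
      moreover have "free_vars \<Phi> \<subseteq> {0..<n}" using \<Phi> by (auto simp: formula_in_def)
      ultimately show ?thesis unfolding free_vars_exs free_vars.simps set_upt by blast
    qed
    then have "(\<Union>\<psi>\<in>(\<lambda>j. exs [0..<n] (Conj \<Phi>
        (fconj ((\<lambda>i. Rel R [n + (j * k + i), n + s * k, \<iota> i]) ` {..<k})))) ` {..<s}. free_vars \<psi>)
        \<subseteq> {n..<Suc (n + s * k)}"
      by (intro UN_least, elim imageE) (simp only: lessThan_iff)
    then show ?thesis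
      unfolding config_fm_def free_vars.simps free_vars_fconj[OF finite_imageI[OF finite_lessThan]]
      by (rule order_trans[OF Diff_mono[OF _ subset_refl]]) auto
  qed
  have "well_formed ar (config_fm R n \<Phi> s k \<iota>)"
    using \<Phi> R by (auto simp: config_fm_def well_formed_fconj formula_in_def)
  then show ?thesis
    using low free by (simp add: formula_in_def config_sentence_def) blast
qed

lemma sat_config_fm:
  assumes \<Phi>: "formula_in ar n \<Phi>" and \<iota>: "\<forall>i<k. \<iota> i < n"
  shows "sat N v (config_fm R n \<Phi> s k \<iota>) \<longleftrightarrow>
    hub_config N R (solutions N n \<Phi>) s k \<iota> (map v [n..<n + s * k])"
proof -
  have "sat N (v(n + s * k := c)) (exs [0..<n] (Conj \<Phi>
      (fconj ((\<lambda>i. Rel R [n + (j * k + i), n + s * k, \<iota> i]) ` {..<k})))) \<longleftrightarrow>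
    (\<exists>bs\<in>solutions N n \<Phi>. \<forall>i<k. [map v [n..<n + s * k] ! (j * k + i), c, bs ! \<iota> i] \<in> interp N R)"
    if j: "j < s" for c j
  proof (rule sat_exs_solutions[OF \<Phi>])
    fix w assume w: "\<forall>x. n \<le> x \<longrightarrow> w x = (v(n + s * k := c)) x"
    have "map w [n + (j * k + i), n + s * k, \<iota> i] =
        [map v [n..<n + s * k] ! (j * k + i), c, map w [0..<n] ! \<iota> i]" if i: "i < k" for i
      using w index_less[OF j i] \<iota>[rule_format, OF i] by simp
    then show "sat N w (fconj ((\<lambda>i. Rel R [n + (j * k + i), n + s * k, \<iota> i]) ` {..<k})) \<longleftrightarrow>
      (\<forall>i<k. [map v [n..<n + s * k] ! (j * k + i), c, map w [0..<n] ! \<iota> i] \<in> interp N R)"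
      by (auto simp: sat_fconj)
  qed
  then show ?thesis by (simp add: config_fm_def hub_config_def sat_fconj Ball_def[of "{..<s}"])
qed

lemma sat_config_sentence:
  assumes N: "structure_over ar N" "univ N \<noteq> {}"
    and \<Phi>: "formula_in ar n \<Phi>" and \<iota>: "\<forall>i<k. \<iota> i < n"
  shows "sat N v (config_sentence ar R n \<Phi> s k \<iota> m) \<longleftrightarrow>
    (\<forall>as. length as = s * k \<and> set as \<subseteq> univ N \<and> \<not> low_over N (set as) m (int (s * k) - 1) \<longrightarrow>
      hub_config N R (solutions N n \<Phi>) s k \<iota> as)"
proof -
  let ?V = "{n..<n + s * k}"
  have body: "sat N w (Conj (Neg (exs [n + s * k..<n + s * k + m] (low_fm ar ?V
       (?V \<union> {n + s * k..<n + s * k + m}) 0 (int (s * k) - 1)))) (Neg (config_fm R n \<Phi> s k \<iota>))) \<longleftrightarrow>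
      \<not> low_over N (set (map w [n..<n + s * k])) m (int (s * k) - 1) \<and>
      \<not> hub_config N R (solutions N n \<Phi>) s k \<iota> (map w [n..<n + s * k])"
    if w: "\<forall>x\<in>?V. w x \<in> univ N" for w
  proof -
    have "w ` ?V \<subseteq> univ N" using w by auto
    from sat_low_exs[OF N _ _ this, of "n + s * k" m 0 "int (s * k) - 1"]
    show ?thesis by (simp add: low_over_def sat_config_fm[OF \<Phi> \<iota>])
  qed
  show ?thesis
  proof
    assume sat: "sat N v (config_sentence ar R n \<Phi> s k \<iota> m)"
    show "\<forall>as. length as = s * k \<and> set as \<subseteq> univ N \<and> \<not> low_over N (set as) m (int (s * k) - 1) \<longrightarrow>
      hub_config N R (solutions N n \<Phi>) s k \<iota> as"
    proof (intro allI impI, elim conjE, rule ccontr)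
      fix as assume as: "length as = s * k" "set as \<subseteq> univ N" "\<not> low_over N (set as) m (int (s * k) - 1)"
        "\<not> hub_config N R (solutions N n \<Phi>) s k \<iota> as"
      define w where "w x = (if x \<in> ?V then as ! (x - n) else v x)" for x
      have mw: "map w [n..<n + s * k] = as" using as(1) by (intro nth_equalityI) (auto simp: w_def)
      have wN: "\<forall>x\<in>?V. w x \<in> univ N" using mw as(2) by (metis imageI set_map set_upt subsetD)
      have "\<forall>x. x \<notin> set [n..<n + s * k] \<longrightarrow> w x = v x" by (simp add: w_def)
      then show False using sat body[OF wN] as(3,4) wN
        unfolding config_sentence_def sat.simps(3) sat_exs mw by auto
    qed
  next
    assume r: "\<forall>as. length as = s * k \<and> set as \<subseteq> univ N \<and> \<not> low_over N (set as) m (int (s * k) - 1) \<longrightarrow>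
      hub_config N R (solutions N n \<Phi>) s k \<iota> as"
    show "sat N v (config_sentence ar R n \<Phi> s k \<iota> m)"
      unfolding config_sentence_def sat.simps(3) sat_exs
    proof (intro notI, elim exE conjE)
      fix w assume wN: "\<forall>x\<in>set [n..<n + s * k]. w x \<in> univ N"
        and sat: "sat N w (Conj (Neg (exs [n + s * k..<n + s * k + m] (low_fm ar ?V
          (?V \<union> {n + s * k..<n + s * k + m}) 0 (int (s * k) - 1)))) (Neg (config_fm R n \<Phi> s k \<iota>)))"
      have "set (map w [n..<n + s * k]) \<subseteq> univ N" using wN by auto
      moreover have "\<forall>x\<in>?V. w x \<in> univ N" using wN by simp
      ultimately show False using r[rule_format, of "map w [n..<n + s * k]"] body[of w] sat by simp
    qed
  qed
qed

section \<open>From the counts to the exponent\<close>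

text \<open>All tuples of length \<open>s * k\<close> but the dependent ones extend to a configuration, and the size
of \<open>N\<close> is chosen such that the dependent ones are at most half of all tuples.\<close>

lemma card_power_le_configurations:
  assumes N: "finite_structure ar N" and ne: "univ N \<noteq> {}" and tame: "tame n K N"
    and K: "2 \<le> K" "int (s * k) \<le> K" and n: "3 \<le> n" "s * k + m \<le> n"
    and S: "finite S" "\<And>bs. bs \<in> S \<Longrightarrow> set bs \<subseteq> univ N" "\<And>bs i. bs \<in> S \<Longrightarrow> i < k \<Longrightarrow> \<iota> i < length bs"
    and conf: "\<And>as. length as = s * k \<Longrightarrow> set as \<subseteq> univ N \<Longrightarrow> \<not> low_over N (set as) m (int (s * k) - 1) \<Longrightarrow>
      hub_config N R S s k \<iota> as"
    and large: "2 * (n + 1) ^ (s * k) \<le> card (univ N)"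
  shows "card (univ N) ^ (s * k) \<le> 2 * (card (univ N) * card S ^ s * n ^ (s * k))"
proof -
  let ?q = "card (univ N)" and ?m = "s * k"
  have fin: "finite (univ N)" using N by (simp add: finite_structure_def)
  let ?all = "{as. set as \<subseteq> univ N \<and> length as = ?m}"
  define I where "I = {as \<in> ?all. hub_config N R S s k \<iota> as}"
  have finall: "finite ?all" by (rule finite_lists_length_eq[OF fin])
  have low: "as \<in> low_tuples n N ?m (int ?m - 1)"
    if as: "as \<in> ?all" "low_over N (set as) m (int ?m - 1)" for as
  proof -
    obtain Y where Y: "set as \<subseteq> Y" "Y \<subseteq> univ N" "finite Y" "card (Y - set as) \<le> m" "predim N Y \<le> int ?m - 1"
      using as(2) unfolding low_over_def by blast
    have "card Y = card (Y - set as) + card (set as)"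
      using Y(1,3) by (metis card_Diff_subset card_mono finite_set le_add_diff_inverse2)
    also have "\<dots> \<le> m + ?m" using Y(4) card_length[of as] as(1) by simp
    also have "\<dots> \<le> n" using n(2) by simp
    finally show ?thesis using as(1) Y unfolding low_tuples_def by blast
  qed
  have "?all \<subseteq> I \<union> low_tuples n N ?m (int ?m - 1)"
  proof
    fix as assume as: "as \<in> ?all"
    show "as \<in> I \<union> low_tuples n N ?m (int ?m - 1)"
    proof (cases "low_over N (set as) m (int ?m - 1)")
      case True
      then show ?thesis using low[OF as] by blast
    next
      case False
      then show ?thesis using conf[of as] as by (simp add: I_def)
    qed
  qed
  moreover have "finite (I \<union> low_tuples n N ?m (int ?m - 1))"
    using finite_subset[OF _ finall, of I] finite_low_tuples[OF fin] by (auto simp: I_def)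
  ultimately have "card ?all \<le> card (I \<union> low_tuples n N ?m (int ?m - 1))" by (rule card_mono[rotated])
  also have "\<dots> \<le> card I + card (low_tuples n N ?m (int ?m - 1))" by (rule card_Un_le)
  finally have all: "?q ^ ?m \<le> card I + card (low_tuples n N ?m (int ?m - 1))"
    by (simp add: card_lists_length_eq[OF fin])
  have "2 * card (low_tuples n N ?m (int ?m - 1)) \<le> ?q ^ ?m"
  proof (cases "?m")
    case 0
    have "low_tuples n N ?m (int ?m - 1) = {}"
    proof (rule ccontr)
      assume "\<not> ?thesis"
      then obtain Y where Y: "Y \<subseteq> univ N" "card Y \<le> n" "predim N Y \<le> - 1"
        using 0 by (auto simp: low_tuples_def)
      then have "finite Y \<and> Y \<subseteq> univ N \<and> card Y \<le> 2 * n" using fin finite_subset by auto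
      then have "0 \<le> predim N Y" using tame unfolding tame_def by blast
      then show False using Y by simp
    qed
    then show ?thesis by simp
  next
    case (Suc l)
    have "int l \<le> K" "int ?m - 1 = int l" using K Suc by auto
    then have "card (low_tuples n N ?m (int ?m - 1)) \<le> (n + 1) ^ ?m * ?q ^ l"
      using card_low_tuples[OF N tame ne, of l ?m] by simp
    then have "2 * card (low_tuples n N ?m (int ?m - 1)) \<le> (2 * (n + 1) ^ ?m) * ?q ^ l" by simp
    also have "\<dots> \<le> ?q * ?q ^ l" by (rule mult_right_mono[OF large]) simp
    finally show ?thesis unfolding Suc by simp
  qed
  then have "?q ^ ?m \<le> 2 * card I" using all by linarith
  also have "card I \<le> ?q * card S ^ s * n ^ ?m"
    by (rule card_configurations[OF N tame K(1) n(1) S, where R = R])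
      (auto simp: I_def hub_config_def)
  finally show ?thesis by simp
qed

text \<open>After taking logarithms the lower bound reads \<open>s * k * ln q \<le> ln D + ln q + s * ln p\<close>, that is,
\<open>k \<le> ln p / ln q + 1 / s + o(1)\<close>. The error \<open>\<epsilon>\<close> is shared between \<open>1 / s\<close> and the constants \<open>C\<close> and
\<open>D\<close>, which become negligible against \<open>ln q\<close>.\<close>

lemma log_ratio_limit:
  fixes p q :: "'i \<Rightarrow> nat"
  assumes q: "\<And>Q. \<forall>\<^sub>F i in U. Q \<le> q i"
    and upper: "\<exists>C. \<forall>\<^sub>F i in U. p i \<le> C * q i ^ k"
    and lower: "\<And>s. 0 < s \<Longrightarrow> \<exists>D. \<forall>\<^sub>F i in U. q i ^ (s * k) \<le> D * (q i * p i ^ s)"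
    and \<epsilon>: "0 < (\<epsilon>::real)"
  shows "\<forall>\<^sub>F i in U. \<bar>ln (real (p i)) / ln (real (q i)) - real k\<bar> < \<epsilon>"
proof -
  obtain C where C: "\<forall>\<^sub>F i in U. p i \<le> C * q i ^ k" using upper by blast
  obtain s :: nat where s: "2 / \<epsilon> < real s" using reals_Archimedean2 by blast
  have s0: "0 < s" using s \<epsilon> by (cases s) (auto simp: divide_less_0_iff)
  obtain D where D: "\<forall>\<^sub>F i in U. q i ^ (s * k) \<le> D * (q i * p i ^ s)" using lower[OF s0] by blast
  define B where "B = max 0 (max (ln (real C)) (ln (real D)))"
  obtain Q :: nat where Q: "exp (2 * B / \<epsilon> + 1) < real Q" using reals_Archimedean2 by blast
  show ?thesis
    using C D q[of Q]
  proof eventually_elim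
    case (elim i)
    have qQ: "exp (2 * B / \<epsilon> + 1) < real (q i)" using Q elim(3) by linarith
    have q0: "0 < real (q i)" using qQ exp_gt_zero less_trans by blast
    have "ln (exp (2 * B / \<epsilon> + 1)) < ln (real (q i))" by (rule ln_less_cancel_iff[THEN iffD2, OF exp_gt_zero q0 qQ])
    then have lnq: "2 * B / \<epsilon> + 1 < ln (real (q i))" by simp
    have B0: "0 \<le> B" by (simp add: B_def)
    have lnq0: "0 < ln (real (q i))" using lnq B0 \<epsilon> by (smt (verit) divide_nonneg_pos)
    have small: "B < \<epsilon> / 2 * ln (real (q i))"
    proof -
      have "\<epsilon> / 2 * (2 * B / \<epsilon>) < \<epsilon> / 2 * ln (real (q i))" using lnq \<epsilon> by (intro mult_strict_left_mono) auto
      then show ?thesis using \<epsilon> by simp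
    qed
    have "0 < q i ^ (s * k)" using q0 by simp
    then have "0 < D * (q i * p i ^ s)" using elim(2) by (rule less_le_trans)
    then have DP: "0 < D" "p i ^ s \<noteq> 0" by auto
    have p0: "0 < p i"
    proof (rule gr0I)
      assume "p i = 0"
      with DP(2) s0 show False by (simp add: zero_power)
    qed
    have C0: "0 < C" using elim(1) p0 by (cases C) auto
    have "ln (real (p i)) \<le> ln (real (C * q i ^ k))"
      using p0 elim(1) by (intro ln_mono) (simp_all only: of_nat_0_less_iff of_nat_le_iff)
    also have "\<dots> = ln (real C) + real k * ln (real (q i))"
      using C0 q0 by (simp add: ln_mult ln_realpow)
    also have "ln (real C) \<le> B" by (simp add: B_def)
    finally have up: "ln (real (p i)) \<le> B + real k * ln (real (q i))" by simp
    have "ln (real (q i ^ (s * k))) \<le> ln (real (D * (q i * p i ^ s)))"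
      using q0 elim(2) by (intro ln_mono) (simp_all only: of_nat_0_less_iff of_nat_le_iff zero_less_power)
    also have "\<dots> = ln (real D) + (ln (real (q i)) + real s * ln (real (p i)))"
      using DP p0 q0 by (simp add: ln_mult ln_realpow)
    also have "ln (real (q i ^ (s * k))) = real s * (real k * ln (real (q i)))"
      using q0 by (simp add: ln_realpow)
    finally have low: "real s * (real k * ln (real (q i))) \<le> B + ln (real (q i)) + real s * ln (real (p i))"
      by (smt (verit) B_def max_def)
    have "real s * (\<epsilon> / 2) > 1" using s \<epsilon> by (simp add: field_simps)
    then have "ln (real (q i)) < real s * (\<epsilon> / 2) * ln (real (q i))"
      using lnq0 by simp
    moreover have "B \<le> real s * B" using s0 B0 by (simp add: mult_le_cancel_right1)
    ultimately have "real s * (real k * ln (real (q i))) <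
        real s * B + real s * (\<epsilon> / 2 * ln (real (q i))) + real s * ln (real (p i))"
      using low by (simp add: mult.assoc)
    then have "real s * (real k * ln (real (q i))) < real s * (B + \<epsilon> / 2 * ln (real (q i)) + ln (real (p i)))"
      by (simp only: distrib_left)
    then have low': "real k * ln (real (q i)) < B + \<epsilon> / 2 * ln (real (q i)) + ln (real (p i))"
      using s0 by (simp only: mult_less_cancel_left_pos of_nat_0_less_iff)
    have "\<bar>ln (real (p i)) - real k * ln (real (q i))\<bar> < \<epsilon> * ln (real (q i))"
      using up low' small by (simp add: abs_less_iff field_simps)
    moreover have "ln (real (p i)) / ln (real (q i)) - real k =
        (ln (real (p i)) - real k * ln (real (q i))) / ln (real (q i))"
      using lnq0 by (simp add: field_simps)
    ultimately show ?case using lnq0 by (simp add: abs_divide pos_divide_less_eq)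
  qed
qed

section \<open>Finite factors of an ultraproduct equivalent to the generic structure\<close>

locale pseudofinite_generic =
  fixes ar :: "'r::finite \<Rightarrow> nat" and f :: "real \<Rightarrow> real" and M :: "('r, 'a) struc"
    and U :: "'i filter" and F :: "'i \<Rightarrow> ('r, 'b) struc" and R :: 'r
  assumes ar: "\<forall>r. 0 < ar r" and R: "ar R = 3" and slow: "slow f" and f_lim: "filterlim f at_top at_top"
    and M: "generic ar f M" and U: "ultrafilter U" and fin: "\<And>i. finite_structure ar (F i)"
    and ee: "elementarily_equivalent ar M (ultraproduct U F)"
begin

lemma str: "structure_over ar M"
  by (rule generic_structure_over[OF M])

text \<open>Gluing no copy at all still provides the hub, a point outside any given finite set.\<close>

lemma infinite_univ: "infinite (univ M)"
proof
  assume finM: "finite (univ M)"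
  from generic_cover[OF M finM subset_refl] obtain E where E: "univ M \<subseteq> E" "finite E" "selfsuff M E"
    by blast
  have "\<exists>c g. c \<in> univ M - E \<and> (\<forall>j<0::nat. embedding (induced M {}) M (g j) \<and> selfsuff M (g j ` {}) \<and>
    (\<forall>i<0::nat. [undefined j i, c, g j (undefined i)] \<in> interp M R))"
    by (rule generic_glue[OF M slow ar R E(2,3), where s = 0 and k = 0])
      (use generic_predim_nonneg[OF M ar] E finite_subset in \<open>auto simp: selfsuff_iff\<close>)
  then show False using E(1) by blast
qed

lemma univ_nonempty: "univ M \<noteq> {}"
  using infinite_univ by auto

lemma F_structure: "structure_over ar (F i)" "finite (univ (F i))"
  using fin by (auto simp: finite_structure_def)

lemmas F_nonempty = transfer_nonempty[OF U ee univ_nonempty]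

lemma eventually_sat:
  "formula_in ar 0 \<phi> \<Longrightarrow> (\<And>v. sat M v \<phi>) \<Longrightarrow> \<forall>\<^sub>F i in U. \<forall>v. sat (F i) v \<phi>"
  using transfer_sentence[OF U ee univ_nonempty] by blast

lemma low_bounded:
  "\<exists>b. \<forall>X. finite X \<and> X \<subseteq> univ M \<and> predim M X \<le> K \<longrightarrow> card X \<le> b"
proof -
  have "\<forall>\<^sub>F x in at_top. real_of_int K < f x" using f_lim by (simp add: filterlim_at_top_dense)
  then obtain x0 where x0: "\<And>x. x0 \<le> x \<Longrightarrow> real_of_int K < f x"
    by (auto simp: eventually_at_top_linorder)
  obtain b :: nat where b: "x0 \<le> real b" using real_arch_simple by blast
  have "card X \<le> b" if X: "finite X" "X \<subseteq> univ M" "predim M X \<le> K" for X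
  proof (rule ccontr)
    assume "\<not> card X \<le> b"
    then have "real_of_int K < f (real (card X))" using b by (intro x0) simp
    also have "\<dots> \<le> real_of_int (predim M X)" by (rule generic_predim_ge[OF M X(1,2)])
    finally show False using X(3) by simp
  qed
  then show ?thesis by blast
qed

lemma eventually_large: "\<forall>\<^sub>F i in U. Q \<le> card (univ (F i))"
proof -
  obtain Y where Y: "Y \<subseteq> univ M" "finite Y" "card Y = Q"
    using infinite_arbitrarily_large[OF infinite_univ] by blast
  then have "predim M Y \<le> int Q" using predim_le_card[of M Y] by simp
  then have "sat M v (small_low ar Q Q (int Q))" for v
    unfolding sat_small_low[OF str univ_nonempty] using Y by blast
  then have "\<forall>\<^sub>F i in U. \<forall>v. sat (F i) v (small_low ar Q Q (int Q))"
    by (intro eventually_sat formula_in_small_low)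
  then show ?thesis
  proof eventually_elim
    case (elim i)
    then obtain Y where "Y \<subseteq> univ (F i)" "Q \<le> card Y"
      unfolding sat_small_low[OF F_structure(1) F_nonempty] by blast
    then show ?case using card_mono[OF F_structure(2)] by (meson order_trans)
  qed
qed

lemma eventually_tame:
  assumes b: "\<And>X. finite X \<Longrightarrow> X \<subseteq> univ M \<Longrightarrow> predim M X \<le> K \<Longrightarrow> card X \<le> n"
  shows "\<forall>\<^sub>F i in U. tame n K (F i)"
proof -
  let ?\<phi> = "small_low ar (2 * n) 0 (- 1)" and ?\<psi> = "small_low ar (2 * n) (Suc n) K"
  have "sat M v (Neg ?\<phi>)" for v
    using generic_predim_nonneg[OF M ar] unfolding sat.simps sat_small_low[OF str univ_nonempty]
    by force
  then have 1: "\<forall>\<^sub>F i in U. \<forall>v. sat (F i) v (Neg ?\<phi>)"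
    using formula_in_small_low[of ar "2 * n" 0 "- 1"] by (intro eventually_sat) (simp_all add: formula_in_def)
  have "sat M v (Neg ?\<psi>)" for v
    using b unfolding sat.simps sat_small_low[OF str univ_nonempty] by (meson not_less_eq_eq)
  then have 2: "\<forall>\<^sub>F i in U. \<forall>v. sat (F i) v (Neg ?\<psi>)"
    using formula_in_small_low[of ar "2 * n" "Suc n" K] by (intro eventually_sat) (simp_all add: formula_in_def)
  from 1 2 show ?thesis
  proof eventually_elim
    case (elim i)
    note low = sat_small_low[OF F_structure(1) F_nonempty, of i]
    show ?case
      unfolding tame_def
    proof (intro allI impI, elim conjE, intro conjI impI)
      fix Y assume Y: "finite Y" "Y \<subseteq> univ (F i)" "card Y \<le> 2 * n"
      show "0 \<le> predim (F i) Y"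
        using elim(1) Y unfolding sat.simps low by force
      show "card Y \<le> n" if "predim (F i) Y \<le> K"
        using elim(2) Y that unfolding sat.simps low by (meson not_less_eq_eq)
    qed
  qed
qed

context
  fixes n :: nat and \<Phi> :: "'r formula" and k :: nat
  assumes \<Phi>: "formula_in ar n \<Phi>" and ne: "solutions M n \<Phi> \<noteq> {}" and k: "dim_formula M n \<Phi> = int k"
begin

lemma finite_solutions: "finite (solutions (F i) n \<Phi>)"
  by (rule finite_subset[OF _ finite_lists_length_eq[OF F_structure(2), of i n]]) (auto simp: solutions_def)

lemma solutions_upper:
  "\<exists>C. \<forall>\<^sub>F i in U. card (solutions (F i) n \<Phi>) \<le> C * card (univ (F i)) ^ k"
proof -
  obtain b where b: "\<And>X. finite X \<Longrightarrow> X \<subseteq> univ M \<Longrightarrow> predim M X \<le> int k \<Longrightarrow> card X \<le> b"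
    using low_bounded[of "int k"] by blast
  have "sat M v (low_solutions ar n \<Phi> b (int k))" for v
    unfolding sat_low_solutions[OF str univ_nonempty \<Phi>]
  proof
    fix bs assume bs: "bs \<in> solutions M n \<Phi>"
    then have "set bs \<subseteq> univ M" by (simp add: solutions_def)
    then obtain Y where Y: "set bs \<subseteq> Y" "Y \<subseteq> univ M" "finite Y" "dim_set M (set bs) = predim M Y"
      using dim_set_attained[OF M ar] by blast
    then have "predim M Y \<le> int k" using dim_formula_ge[OF M ar ne bs] k by simp
    moreover have "card (Y - set bs) \<le> card Y" using Y(3) by (intro card_mono) auto
    ultimately have "card (Y - set bs) \<le> b" using b[OF Y(3,2)] by simp
    then show "low_over M (set bs) b (int k)"
      using Y \<open>predim M Y \<le> int k\<close> unfolding low_over_def by blast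
  qed
  then have 1: "\<forall>\<^sub>F i in U. \<forall>v. sat (F i) v (low_solutions ar n \<Phi> b (int k))"
    by (intro eventually_sat formula_in_low_solutions \<Phi>)
  have 2: "\<forall>\<^sub>F i in U. tame (n + b) (int k) (F i)"
    by (rule eventually_tame) (use b trans_le_add2 in blast)
  from 1 2 have "\<forall>\<^sub>F i in U. card (solutions (F i) n \<Phi>) \<le> (n + b + 1) ^ n * card (univ (F i)) ^ k"
  proof eventually_elim
    case (elim i)
    have "solutions (F i) n \<Phi> \<subseteq> low_tuples (n + b) (F i) n (int k)"
    proof
      fix bs assume bs: "bs \<in> solutions (F i) n \<Phi>"
      then have len: "length bs = n" "set bs \<subseteq> univ (F i)" by (auto simp: solutions_def)
      have "low_over (F i) (set bs) b (int k)"
        using elim(1) bs unfolding sat_low_solutions[OF F_structure(1) F_nonempty \<Phi>] by blast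
      then obtain Y where Y: "set bs \<subseteq> Y" "Y \<subseteq> univ (F i)" "finite Y" "card (Y - set bs) \<le> b"
        "predim (F i) Y \<le> int k" unfolding low_over_def by blast
      have "card Y = card (Y - set bs) + card (set bs)"
        using Y(1,3) by (metis card_Diff_subset card_mono finite_set le_add_diff_inverse2)
      then have "card Y \<le> n + b" using Y(4) card_length[of bs] len by simp
      then show "bs \<in> low_tuples (n + b) (F i) n (int k)"
        using len Y unfolding low_tuples_def by blast
    qed
    then have "card (solutions (F i) n \<Phi>) \<le> card (low_tuples (n + b) (F i) n (int k))"
      by (rule card_mono[OF finite_low_tuples[OF F_structure(2)]])
    also have "\<dots> \<le> (n + b + 1) ^ n * card (univ (F i)) ^ k"
      by (rule card_low_tuples[OF fin elim(2) F_nonempty order_refl])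
    finally show ?case .
  qed
  then show ?thesis by blast
qed

lemma basis_indices:
  "\<exists>bs \<iota>. bs \<in> solutions M n \<Phi> \<and> (\<forall>i<k. \<iota> i < n) \<and>
    (\<forall>Y. (\<forall>i<k. bs ! \<iota> i \<in> Y) \<and> Y \<subseteq> univ M \<and> finite Y \<longrightarrow> int k \<le> predim M Y)"
proof -
  obtain bs where bs: "bs \<in> solutions M n \<Phi>" "dim_set M (set bs) = int k"
    using dim_formula_attained[OF M ar ne] k by auto
  have sub: "set bs \<subseteq> univ M" and len: "length bs = n" using bs(1) by (auto simp: solutions_def)
  from dim_basis[OF M ar finite_set sub] obtain J where J: "J \<subseteq> set bs" "card J = k"
    "\<And>Y. J \<subseteq> Y \<Longrightarrow> Y \<subseteq> univ M \<Longrightarrow> finite Y \<Longrightarrow> int k \<le> predim M Y"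
    unfolding bs(2) of_nat_eq_iff by blast
  have "finite J" using J(1) finite_subset by blast
  then obtain h where h: "bij_betw h {0..<k} J" using ex_bij_betw_nat_finite J(2) by blast
  have "\<exists>l<n. bs ! l = h i" if "i < k" for i
  proof -
    have "h i \<in> set bs" using bij_betwE[OF h] J(1) that by auto
    then show ?thesis using len by (auto simp: in_set_conv_nth)
  qed
  then obtain \<iota> where \<iota>: "\<And>i. i < k \<Longrightarrow> \<iota> i < n \<and> bs ! \<iota> i = h i" by metis
  have "int k \<le> predim M Y" if Y: "\<forall>i<k. bs ! \<iota> i \<in> Y" "Y \<subseteq> univ M" "finite Y" for Y
  proof (rule J(3)[OF _ Y(2,3)])
    have "J = h ` {0..<k}" using h by (simp add: bij_betw_def)
    then show "J \<subseteq> Y" using Y(1) \<iota> by auto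
  qed
  then show ?thesis using bs(1) \<iota> by blast
qed

text \<open>Both \<open>as\<close> and the solution \<open>bs\<close> are enlarged to self-sufficient finite sets before gluing. The
images of \<open>bs\<close> in the copies of its hull are solutions by homogeneity.\<close>

lemma generic_hub_config:
  assumes bs: "bs \<in> solutions M n \<Phi>" and \<iota>: "\<And>i. i < k \<Longrightarrow> \<iota> i < n"
    and ind: "\<And>Y. (\<forall>i<k. bs ! \<iota> i \<in> Y) \<Longrightarrow> Y \<subseteq> univ M \<Longrightarrow> finite Y \<Longrightarrow> int k \<le> predim M Y"
    and as: "length as = s * k" "set as \<subseteq> univ M"
    and ind_as: "\<And>Y. set as \<subseteq> Y \<Longrightarrow> Y \<subseteq> univ M \<Longrightarrow> finite Y \<Longrightarrow> int (s * k) \<le> predim M Y"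
  shows "hub_config M R (solutions M n \<Phi>) s k \<iota> as"
proof -
  have len: "length bs = n" "set bs \<subseteq> univ M" "sat M (\<lambda>i. bs ! i) \<Phi>"
    using bs by (auto simp: solutions_def)
  obtain E where E: "set as \<subseteq> E" "finite E" "selfsuff M E"
    using generic_cover[OF M finite_set as(2)] by blast
  obtain B where B: "set bs \<subseteq> B" "finite B" "selfsuff M B"
    using generic_cover[OF M finite_set len(2)] by blast
  have EM: "E \<subseteq> univ M" and BM: "B \<subseteq> univ M" using E B by (auto simp: selfsuff_iff)
  define a where "a j i = as ! (j * k + i)" for j i
  define y where "y i = bs ! \<iota> i" for i
  have a: "a j i \<in> set as" if "j < s" "i < k" for j i
    unfolding a_def by (rule nth_mem) (use index_less[OF that] as(1) in simp)
  have y: "y i \<in> B" if "i < k" for i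
    using B(1) nth_mem[of "\<iota> i" bs] \<iota>[OF that] len(1) by (auto simp: y_def)
  have "int (card {(j, i). j < s \<and> i < k \<and> a j i \<in> X}) \<le> predim M X" if X: "X \<subseteq> E" for X
  proof -
    let ?I = "{..<s} \<times> {..<k}" and ?h = "\<lambda>(j, i). a j i"
    have as_sub: "set as \<subseteq> ?h ` ?I"
    proof
      fix x assume "x \<in> set as"
      then obtain l where l: "l < s * k" "x = as ! l" using as(1) by (auto simp: in_set_conv_nth)
      have k0: "0 < k" using l by (cases k) auto
      have "x = ?h (l div k, l mod k)" using l by (simp add: a_def)
      moreover have "(l div k, l mod k) \<in> ?I" using l k0 by (simp add: less_mult_imp_div_less)
      ultimately show "x \<in> ?h ` ?I" by (rule image_eqI)
    qed
    have "int (card {x \<in> ?I. ?h x \<in> X}) \<le> predim M X"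
    proof (rule independent_count[OF str])
      show "?h ` ?I \<subseteq> univ M" using a as(2) by auto
      show "int (card ?I) \<le> predim M Y" if "?h ` ?I \<subseteq> Y" "Y \<subseteq> univ M" "finite Y" for Y
        using ind_as[of Y] as_sub that by auto
      show "finite X" "X \<subseteq> univ M" using X E(2) EM finite_subset by blast+
    qed simp
    moreover have "{x \<in> ?I. ?h x \<in> X} = {(j, i). j < s \<and> i < k \<and> a j i \<in> X}" by auto
    ultimately show ?thesis by simp
  qed
  moreover have "int (card {i. i < k \<and> y i \<in> X}) \<le> predim M X" if X: "X \<subseteq> B" for X
  proof -
    have "int (card {i \<in> {..<k}. y i \<in> X}) \<le> predim M X"
    proof (rule independent_count[OF str])
      show "y ` {..<k} \<subseteq> univ M" using y BM by auto
      show "int (card {..<k}) \<le> predim M Y" if "y ` {..<k} \<subseteq> Y" "Y \<subseteq> univ M" "finite Y" for Y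
        using ind[of Y] that by (auto simp: y_def)
      show "finite X" "X \<subseteq> univ M" using X B(2) BM finite_subset by blast+
    qed simp
    then show ?thesis by simp
  qed
  moreover have "a j i \<in> E" if "j < s" "i < k" for j i using a[OF that] E(1) by blast
  ultimately obtain c g where cg: "c \<in> univ M"
    "\<forall>j<s. embedding (induced M B) M (g j) \<and> selfsuff M (g j ` B) \<and> (\<forall>i<k. [a j i, c, g j (y i)] \<in> interp M R)"
    using generic_glue[OF M slow ar R E(2,3) B(2) BM, of s k a y] y by blast
  have "\<exists>bs'\<in>solutions M n \<Phi>. \<forall>i<k. [as ! (j * k + i), c, bs' ! \<iota> i] \<in> interp M R" if j: "j < s" for j
  proof (intro bexI allI impI)
    let ?bs = "map (g j) bs"
    have emb: "embedding (induced M B) M (g j)" and ss: "selfsuff M (g j ` B)" using cg(2) j by auto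
    have "bs ! x \<in> B" if "x \<in> free_vars \<Phi>" for x
    proof -
      have "x < length bs" using \<Phi> that len(1) by (auto simp: formula_in_def)
      then show ?thesis using B(1) nth_mem by blast
    qed
    then have "sat M (g j \<circ> (\<lambda>i. bs ! i)) \<Phi>"
      using sat_embedding[OF M B(2,3) emb ss, of \<Phi> "\<lambda>i. bs ! i"] len(3) by blast
    also have "sat M (g j \<circ> (\<lambda>i. bs ! i)) \<Phi> \<longleftrightarrow> sat M (\<lambda>i. ?bs ! i) \<Phi>"
      by (rule sat_cong) (use \<Phi> len(1) in \<open>auto simp: formula_in_def\<close>)
    finally have "sat M (\<lambda>i. ?bs ! i) \<Phi>" .
    moreover have "set ?bs \<subseteq> univ M" using emb B(1) by (auto simp: embedding_def)
    ultimately show "?bs \<in> solutions M n \<Phi>" using len(1) by (simp add: solutions_def)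
    fix i assume i: "i < k"
    then have "?bs ! \<iota> i = g j (y i)" using \<iota> len(1) by (simp add: y_def)
    then show "[as ! (j * k + i), c, ?bs ! \<iota> i] \<in> interp M R"
      using cg(2) j i by (simp add: a_def)
  qed
  then show ?thesis using cg(1) by (auto simp: hub_config_def)
qed

text \<open>Independence of \<open>as\<close> is a condition on all finite sets around it, but it can fail only for those of size
at most \<open>b\<close>, which makes it expressible. The summand \<open>2\<close> in \<open>K\<close> serves the bound on the fibres of \<open>R\<close>, and the summand \<open>3\<close> in
\<open>l\<close> meets its requirement on the size.\<close>

lemma solutions_lower:
  "\<exists>D. \<forall>\<^sub>F i in U. card (univ (F i)) ^ (s * k) \<le> D * (card (univ (F i)) * card (solutions (F i) n \<Phi>) ^ s)"
proof -
  define K where "K = int (s * k) + 2"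
  obtain b where b: "\<And>X. finite X \<Longrightarrow> X \<subseteq> univ M \<Longrightarrow> predim M X \<le> K \<Longrightarrow> card X \<le> b"
    using low_bounded[of K] by blast
  from basis_indices obtain bs \<iota> where bs: "bs \<in> solutions M n \<Phi>" and \<iota>': "\<forall>i<k. \<iota> i < n"
    and ind': "\<forall>Y. (\<forall>i<k. bs ! \<iota> i \<in> Y) \<and> Y \<subseteq> univ M \<and> finite Y \<longrightarrow> int k \<le> predim M Y"
    by (elim exE conjE)
  have \<iota>: "\<iota> i < n" if "i < k" for i
    using \<iota>' that by simp
  have ind: "int k \<le> predim M Y" if "\<forall>i<k. bs ! \<iota> i \<in> Y" "Y \<subseteq> univ M" "finite Y" for Y
    using ind' that by simp
  define l where "l = s * k + b + 3"
  have "sat M v (config_sentence ar R n \<Phi> s k \<iota> b)" for v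
    unfolding sat_config_sentence[OF str univ_nonempty \<Phi> \<iota>']
  proof (intro allI impI, elim conjE)
    fix as assume as: "length as = s * k" "set as \<subseteq> univ M" "\<not> low_over M (set as) b (int (s * k) - 1)"
    show "hub_config M R (solutions M n \<Phi>) s k \<iota> as"
    proof (rule generic_hub_config[OF bs \<iota> ind as(1,2)])
      fix Y assume Y: "set as \<subseteq> Y" "Y \<subseteq> univ M" "finite Y"
      show "int (s * k) \<le> predim M Y"
      proof (rule ccontr)
        assume "\<not> ?thesis"
        then have low: "predim M Y \<le> int (s * k) - 1" by simp
        then have "card Y \<le> b" using b[OF Y(3,2)] by (simp add: K_def)
        moreover have "card (Y - set as) \<le> card Y" using Y(3) by (intro card_mono) auto
        ultimately have "card (Y - set as) \<le> b" by simp
        then show False using as(3) Y low unfolding low_over_def by blast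
      qed
    qed
  qed
  then have 1: "\<forall>\<^sub>F i in U. \<forall>v. sat (F i) v (config_sentence ar R n \<Phi> s k \<iota> b)"
    by (intro eventually_sat formula_in_config_sentence[OF \<Phi> R \<iota>'])
  have 2: "\<forall>\<^sub>F i in U. tame l K (F i)"
    by (rule eventually_tame) (use b in \<open>fastforce simp: l_def\<close>)
  from 1 2 eventually_large[of "2 * (l + 1) ^ (s * k)"]
  have "\<forall>\<^sub>F i in U. card (univ (F i)) ^ (s * k) \<le>
      2 * l ^ (s * k) * (card (univ (F i)) * card (solutions (F i) n \<Phi>) ^ s)"
  proof eventually_elim
    case (elim i)
    have "card (univ (F i)) ^ (s * k) \<le>
      2 * (card (univ (F i)) * card (solutions (F i) n \<Phi>) ^ s * l ^ (s * k))"
    proof (rule card_power_le_configurations[OF fin F_nonempty elim(2) _ _ _ _ finite_solutions _ _ _ elim(3)])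
      show "2 \<le> K" "int (s * k) \<le> K" "3 \<le> l" "s * k + b \<le> l" by (auto simp: K_def l_def)
      show "set bs \<subseteq> univ (F i)" if "bs \<in> solutions (F i) n \<Phi>" for bs
        using that by (simp add: solutions_def)
      show "\<iota> j < length bs" if "bs \<in> solutions (F i) n \<Phi>" "j < k" for bs j
        using that \<iota> by (simp add: solutions_def)
      show "hub_config (F i) R (solutions (F i) n \<Phi>) s k \<iota> as"
        if "length as = s * k" "set as \<subseteq> univ (F i)" "\<not> low_over (F i) (set as) b (int (s * k) - 1)" for as
        using elim(1) that unfolding sat_config_sentence[OF F_structure(1) F_nonempty \<Phi> \<iota>'] by blast
    qed
    then show ?case by (simp add: mult.commute mult.left_commute)
  qed
  then show ?thesis by blast
qed

lemma coarse_dim_eq: "coarse_dim U F n \<Phi> = ereal (real k)"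
  unfolding coarse_dim_def standard_part_eq_real_iff[OF U]
  using log_ratio_limit[OF eventually_large solutions_upper solutions_lower] by blast

end

end

theorem mainTheorem4:
  fixes ar :: "'r::finite \<Rightarrow> nat"
    and f f' :: "real \<Rightarrow> real"
    and M :: "('r, 'a) struc"
    and U :: "'i filter"
    and F :: "'i \<Rightarrow> ('r, 'b) struc"
    and n :: nat
    and \<Phi> :: "'r formula"
  assumes "\<forall>r. 0 < ar r"
    and "\<exists>R. ar R = 3"
    and "good f f'"
    and "\<forall>x\<ge>0. f' x \<le> 1 / (2 * (x + 1))"
    and "generic ar f M"
    and "ultrafilter U"
    and "\<forall>i. finite_structure ar (F i)"
    and "elementarily_equivalent ar M (ultraproduct U F)"
    and "formula_in ar n \<Phi>"
    and "solutions M n \<Phi> \<noteq> {}"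
  shows "coarse_dim U F n \<Phi> = ereal (real_of_int (dim_formula M n \<Phi>))"
proof -
  obtain R where R: "ar R = 3" using assms(2) by blast
  have "f (real (card ({} :: 'a set))) \<le> real_of_int (predim M {})"
    by (rule generic_predim_ge[OF assms(5)]) auto
  then have "f 0 \<le> 0"
    using predim_empty[OF generic_structure_over[OF assms(5)] assms(1)] by simp
  then have slow: "slow f"
    using good_growth[OF assms(3,4)] assms(3) by (simp add: slow_def good_def)
  interpret pseudofinite_generic ar f M U F R
    by unfold_locales (use assms R slow in \<open>auto simp: good_def\<close>)
  have "dim_formula M n \<Phi> = int (nat (dim_formula M n \<Phi>))"
    using dim_formula_nonneg[OF assms(5,1,10)] by simp
  from coarse_dim_eq[OF assms(9,10) this] show ?thesis
    using dim_formula_nonneg[OF assms(5,1,10)] by simp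
qed

end
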